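(* The average number $\sum_{i=0}^\infty i\cdot A_i(N)$ of intersection points of pairs of curves $(f,g)\in B(N,R)\times B(N,R)$ satisfies $$\sum_{i=0}^\infty i\cdot A_i(N)=\frac{\pi}{3}N^2+O(N)\qquad\text{as } N\to\infty.$$
   Context: For a natural number $N$, let $V_N$ be the $2(2N+1)$-dimensional real vector space of maps $f=(x,y):S^1=\mathbb{R}/2\pi\mathbb{Z}\to\mathbb{R}^2$ whose two components are trigonometric polynomials of degree $\le N$: $x(\varphi)=a_0+\sum_{j=1}^N(a_j\cos j\varphi+b_j\sin j\varphi)$, $y(\varphi)=\tilde a_0+\sum_{j=1}^N(\tilde a_j\cos j\varphi+\tilde b_j\sin j\varphi)$, with real coefficients. Equip $V_N$ with the Euclidean ($L_2$) structure in which the dot product of $(x_1,y_1)$ and $(x_2,y_2)$ is $\frac1\pi\int_0^{2\pi}(x_1x_2+y_1y_2)\,d\varphi$; equivalently, the squared norm of $f$ is $2(a_0^2+\tilde a_0^2)+\sum_{j=1}^N(a_j^2+b_j^2+\tilde a_j^2+\tilde b_j^2)$. Let $B(N,R)\subset V_N$ be the ball of radius $R>0$ centered at $0$, and $B^2(N,R)=B(N,R)\times B(N,R)\subset V_N\oplus V_N$, with the Euclidean volume of the direct sum. The number of intersection points of a pair of curves $(f,g)$ is the number of pairs $(\varphi,\psi)\in S^1\times S^1$ with $f(\varphi)=g(\psi)$; for almost all pairs this is finite and agrees with the number of common points of the two plane curves. Let $A_i(N)$ be the volume of the set of pairs $(f,g)\in B^2(N,R)$ with exactly $i$ intersection points,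 divided by the volume of $B^2(N,R)$; by scaling this does not depend on $R$. *)

theory Defs
  imports "HOL-Analysis.Analysis" "HOL-Library.Landau_Symbols"
begin

text \<open>Functions on the circle \<open>\<real>/2\<pi>\<int>\<close> are represented as \<open>2\<pi>\<close>-periodic functions on \<open>\<real>\<close>.\<close>

type_synonym curve = "real \<Rightarrow> real \<times> real"

definition trig_polys :: "nat \<Rightarrow> (real \<Rightarrow> real) set" where
  "trig_polys N = {x. \<exists>a b :: nat \<Rightarrow> real. \<forall>\<phi>.
     x \<phi> = a 0 + (\<Sum>j=1..N. a j * cos (real j * \<phi>) + b j * sin (real j * \<phi>))}"

definition trig_curves :: "nat \<Rightarrow> curve set" where
  "trig_curves N = {f. (\<lambda>\<phi>. fst (f \<phi>)) \<in> trig_polys N \<and> (\<lambda>\<phi>. snd (f \<phi>)) \<in> trig_polys N}"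

definition curve_dot :: "curve \<Rightarrow> curve \<Rightarrow> real" where
  "curve_dot f g = (1 / pi) * integral {0..2*pi} (\<lambda>\<phi>. f \<phi> \<bullet> g \<phi>)"

definition curve_ball :: "nat \<Rightarrow> real \<Rightarrow> curve set" where
  "curve_ball N R = {f \<in> trig_curves N. sqrt (curve_dot f f) \<le> R}"

text \<open>
  The functions \<open>trig_basis j\<close> with \<open>\<bar>j\<bar> \<le> N\<close> (cosines for \<open>j > 0\<close>, sines for \<open>j < 0\<close>) form an
  orthonormal basis of the trigonometric polynomials of degree at most \<open>N\<close>. Hence \<open>curve_of N\<close> is
  an isometry from \<open>(\<real> \<times> \<real>)\<^sup>2\<^sup>N\<^sup>+\<^sup>1\<close> onto \<open>trig_curves N\<close> (lemmas \<open>curve_dot_curve_of\<close> and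
  \<open>bij_betw_curve_of\<close> below), and Euclidean volume on \<open>trig_curves N\<close> is Lebesgue measure
  transported along it. It is taken on Borel sets: the sets measured below are Borel.
\<close>

definition trig_basis :: "int \<Rightarrow> real \<Rightarrow> real" where
  "trig_basis j \<phi> =
     (if j = 0 then 1 / sqrt 2 else if 0 < j then cos (of_int j * \<phi>) else sin (of_int (- j) * \<phi>))"

definition curve_of :: "nat \<Rightarrow> (int \<Rightarrow> real \<times> real) \<Rightarrow> curve" where
  "curve_of N c = (\<lambda>\<phi>. \<Sum>j\<in>{- int N..int N}. trig_basis j \<phi> *\<^sub>R c j)"

definition curve_vol :: "nat \<Rightarrow> curve measure" where
  "curve_vol N = embed_measure (\<Pi>\<^sub>M j\<in>{- int N..int N}. lborel) (curve_of N)"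

definition pair_vol :: "nat \<Rightarrow> (curve \<times> curve) measure" where
  "pair_vol N = curve_vol N \<Otimes>\<^sub>M curve_vol N"

definition intersections :: "curve \<Rightarrow> curve \<Rightarrow> (real \<times> real) set" where
  "intersections f g = {(\<phi>, \<psi>) \<in> {0..<2*pi} \<times> {0..<2*pi}. f \<phi> = g \<psi>}"

text \<open>Finiteness is required explicitly because the cardinality of an infinite set is \<open>0\<close>.\<close>

definition intersection_fraction :: "nat \<Rightarrow> real \<Rightarrow> nat \<Rightarrow> real" where
  "intersection_fraction N R i =
     measure (pair_vol N) {(f, g) \<in> curve_ball N R \<times> curve_ball N R.
        finite (intersections f g) \<and> card (intersections f g) = i}
     / measure (pair_vol N) (curve_ball N R \<times> curve_ball N R)"

lemma has_integral_cos_int: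
  "((\<lambda>\<phi>. cos (of_int m * \<phi>)) has_integral (if m = 0 then 2*pi else 0)) {0..2*pi}"
proof (cases "m = 0")
  case True
  then show ?thesis
    using has_integral_const_real[of "1::real" 0 "2*pi"] by simp
next
  case False
  have "((\<lambda>\<phi>. cos (of_int m * \<phi>)) has_integral
      (sin (of_int m * (2*pi)) / of_int m - sin (of_int m * 0) / of_int m)) {0..2*pi}"
    using False by (intro fundamental_theorem_of_calculus)
      (auto intro!: derivative_eq_intros simp flip: has_real_derivative_iff_has_vector_derivative)
  moreover have "sin (of_int m * (2*pi)) = 0"
    using sin_int_2pin[of m] by (simp add: mult.commute mult.left_commute)
  ultimately show ?thesis using False by simp
qed

lemma has_integral_sin_int:
  "((\<lambda>\<phi>. sin (of_int m * \<phi>)) has_integral 0) {0..2*pi}"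
proof (cases "m = 0")
  case False
  have "((\<lambda>\<phi>. sin (of_int m * \<phi>)) has_integral
      (- cos (of_int m * (2*pi)) / of_int m - (- cos (of_int m * 0) / of_int m))) {0..2*pi}"
    using False by (intro fundamental_theorem_of_calculus)
      (auto intro!: derivative_eq_intros simp flip: has_real_derivative_iff_has_vector_derivative)
  moreover have "cos (of_int m * (2*pi)) = 1"
    using cos_int_2pin[of m] by (simp add: mult.commute mult.left_commute)
  ultimately show ?thesis by simp
qed simp

lemma trig_basis_orthonormal:
  "((\<lambda>\<phi>. trig_basis j \<phi> * trig_basis k \<phi>) has_integral (if j = k then pi else 0)) {0..2*pi}"
proof -
  note C = has_integral_cos_int and S = has_integral_sin_int
  have cc: "((\<lambda>\<phi>. cos (of_int m * \<phi>) * cos (of_int n * \<phi>)) has_integral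
      ((if m = n then 2*pi else 0) + (if m + n = 0 then 2*pi else 0)) / 2) {0..2*pi}" for m n :: int
    using has_integral_divide[OF has_integral_add[OF C[of "m - n"] C[of "m + n"]], of 2]
    by (simp add: cos_times_cos algebra_simps)
  have ss: "((\<lambda>\<phi>. sin (of_int m * \<phi>) * sin (of_int n * \<phi>)) has_integral
      ((if m = n then 2*pi else 0) - (if m + n = 0 then 2*pi else 0)) / 2) {0..2*pi}" for m n :: int
    using has_integral_divide[OF has_integral_diff[OF C[of "m - n"] C[of "m + n"]], of 2]
    by (simp add: sin_times_sin algebra_simps)
  have sc: "((\<lambda>\<phi>. sin (of_int m * \<phi>) * cos (of_int n * \<phi>)) has_integral 0) {0..2*pi}" for m n :: int
    using has_integral_divide[OF has_integral_add[OF S[of "m + n"] S[of "m - n"]], of 2]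
    by (simp add: sin_times_cos ring_distribs)
  have cs: "((\<lambda>\<phi>. cos (of_int m * \<phi>) * sin (of_int n * \<phi>)) has_integral 0) {0..2*pi}" for m n :: int
    using sc[of n m] by (simp add: mult.commute)
  have c1: "((\<lambda>\<phi>. cos (of_int m * \<phi>) / sqrt 2) has_integral 0) {0..2*pi}" if "m \<noteq> 0" for m :: int
    using has_integral_divide[OF C[of m], of "sqrt 2"] that by simp
  have s1: "((\<lambda>\<phi>. sin (of_int m * \<phi>) / sqrt 2) has_integral 0) {0..2*pi}" for m :: int
    using has_integral_divide[OF S[of m], of "sqrt 2"] by simp
  have o1: "((\<lambda>\<phi>::real. 1 / sqrt 2 * (1 / sqrt 2)) has_integral pi) {0..2*pi}"
    using has_integral_const_real[of "1/2::real" 0 "2*pi"] by simp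
  consider "j = 0" "k = 0" | "j = 0" "k > 0" | "j = 0" "k < 0" | "j > 0" "k = 0" | "j < 0" "k = 0"
    | "j > 0" "k > 0" | "j > 0" "k < 0" | "j < 0" "k > 0" | "j < 0" "k < 0"
    by linarith
  then show ?thesis
  proof cases
    case 1 then show ?thesis using o1 by (simp add: trig_basis_def)
  next
    case 2 then show ?thesis using c1[of k] by (simp add: trig_basis_def)
  next
    case 3 then show ?thesis using s1[of "-k"] by (simp add: trig_basis_def)
  next
    case 4 then show ?thesis using c1[of j] by (simp add: trig_basis_def)
  next
    case 5 then show ?thesis using s1[of "-j"] by (simp add: trig_basis_def)
  next
    case 6 then show ?thesis using cc[of j k] by (cases "j = k") (simp_all add: trig_basis_def)
  next
    case 7 then show ?thesis using cs[of j "-k"] by (simp add: trig_basis_def)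
  next
    case 8 then show ?thesis using sc[of "-j" k] by (simp add: trig_basis_def)
  next
    case 9 then show ?thesis using ss[of "-j" "-k"] by (cases "j = k") (simp_all add: trig_basis_def)
  qed
qed

lemma curve_dot_curve_of:
  "curve_dot (curve_of N c) (curve_of N d) = (\<Sum>j\<in>{- int N..int N}. c j \<bullet> d j)"
proof -
  let ?I = "{- int N..int N}"
  have "((\<lambda>\<phi>. \<Sum>j\<in>?I. \<Sum>k\<in>?I. (trig_basis j \<phi> * trig_basis k \<phi>) * (c j \<bullet> d k)) has_integral
      (\<Sum>j\<in>?I. \<Sum>k\<in>?I. (if j = k then pi else 0) * (c j \<bullet> d k))) {0..2*pi}"
    by (intro has_integral_sum has_integral_mult_left trig_basis_orthonormal) auto
  moreover have "(\<Sum>j\<in>?I. \<Sum>k\<in>?I. (if j = k then pi else 0) * (c j \<bullet> d k)) = pi * (\<Sum>j\<in>?I. c j \<bullet> d j)"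
  proof -
    have "(\<Sum>k\<in>?I. (if j = k then pi else 0) * (c j \<bullet> d k)) = pi * (c j \<bullet> d j)" if "j \<in> ?I" for j
    proof -
      have "(\<Sum>k\<in>?I. (if j = k then pi else 0) * (c j \<bullet> d k))
          = (\<Sum>k\<in>?I. if j = k then pi * (c j \<bullet> d k) else 0)"
        by (rule sum.cong) auto
      then show ?thesis using that by simp
    qed
    then show ?thesis by (simp add: sum_distrib_left)
  qed
  moreover have "curve_of N c \<phi> \<bullet> curve_of N d \<phi>
      = (\<Sum>j\<in>?I. \<Sum>k\<in>?I. (trig_basis j \<phi> * trig_basis k \<phi>) * (c j \<bullet> d k))" for \<phi>
    unfolding curve_of_def inner_sum_left by (simp add: inner_sum_right sum_distrib_left ac_simps)
  ultimately show ?thesis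
    by (simp add: curve_dot_def integral_unique)
qed

lemma sum_int_split:
  "(\<Sum>j\<in>{- int N..int N}. F j) = F 0 + (\<Sum>j=1..N. F (int j) + F (- int j))"
  for F :: "int \<Rightarrow> 'b::comm_monoid_add"
proof (induction N)
  case (Suc N)
  have "{- int (Suc N)..int (Suc N)} = insert (int (Suc N)) (insert (- int (Suc N)) {- int N..int N})"
    by auto
  then show ?case using Suc by (simp add: ac_simps)
qed simp

lemma trig_polys_iff:
  "x \<in> trig_polys N \<longleftrightarrow> (\<exists>c. \<forall>\<phi>. x \<phi> = (\<Sum>j\<in>{- int N..int N}. trig_basis j \<phi> * c j))"
proof
  assume "x \<in> trig_polys N"
  then obtain a b where x: "\<And>\<phi>. x \<phi> = a 0 +
      (\<Sum>j=1..N. a j * cos (real j * \<phi>) + b j * sin (real j * \<phi>))"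
    by (auto simp: trig_polys_def)
  define c where "c j = (if j = 0 then sqrt 2 * a 0 else if j > 0 then a (nat j) else b (nat (- j)))"
    for j :: int
  have "x \<phi> = (\<Sum>j\<in>{- int N..int N}. trig_basis j \<phi> * c j)" for \<phi>
    unfolding x sum_int_split
    by (intro arg_cong2[where f = "(+)"] sum.cong) (auto simp: trig_basis_def c_def)
  then show "\<exists>c. \<forall>\<phi>. x \<phi> = (\<Sum>j\<in>{- int N..int N}. trig_basis j \<phi> * c j)" by blast
next
  assume "\<exists>c. \<forall>\<phi>. x \<phi> = (\<Sum>j\<in>{- int N..int N}. trig_basis j \<phi> * c j)"
  then obtain c where x: "\<And>\<phi>. x \<phi> = (\<Sum>j\<in>{- int N..int N}. trig_basis j \<phi> * c j)" by blast
  define a where "a j = (if j = 0 then c 0 / sqrt 2 else c (int j))" for j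
  have "x \<phi> = a 0 + (\<Sum>j=1..N. a j * cos (real j * \<phi>) + c (- int j) * sin (real j * \<phi>))" for \<phi>
    unfolding x sum_int_split
    by (intro arg_cong2[where f = "(+)"] sum.cong) (auto simp: trig_basis_def a_def)
  then show "x \<in> trig_polys N"
    unfolding trig_polys_def
    by (intro CollectI exI[of _ a] exI[of _ "\<lambda>j. c (- int j)"]) blast
qed

lemma curve_of_in_trig_curves: "curve_of N c \<in> trig_curves N"
  unfolding trig_curves_def trig_polys_iff curve_of_def
  by (simp add: fst_sum snd_sum) (metis (no_types))

lemma bij_betw_curve_of:
  "bij_betw (curve_of N) ({- int N..int N} \<rightarrow>\<^sub>E UNIV) (trig_curves N)"
  unfolding bij_betw_def
proof
  let ?I = "{- int N..int N}"
  show "inj_on (curve_of N) (?I \<rightarrow>\<^sub>E UNIV)"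
  proof (rule inj_onI)
    fix c d :: "int \<Rightarrow> real \<times> real"
    assume c: "c \<in> ?I \<rightarrow>\<^sub>E UNIV" and d: "d \<in> ?I \<rightarrow>\<^sub>E UNIV" and eq: "curve_of N c = curve_of N d"
    have "curve_of N (\<lambda>j. c j - d j) = curve_of N (\<lambda>_. 0)"
      using fun_cong[OF eq] by (auto simp: curve_of_def scaleR_diff_right sum_subtractf)
    then have "curve_dot (curve_of N (\<lambda>j. c j - d j)) (curve_of N (\<lambda>j. c j - d j)) = 0"
      using curve_dot_curve_of[of N "\<lambda>_. 0" "\<lambda>_. 0"] by simp
    then have "\<forall>j\<in>?I. (c j - d j) \<bullet> (c j - d j) = 0"
      unfolding curve_dot_curve_of by (subst (asm) sum_nonneg_eq_0_iff) auto
    then show "c = d" using PiE_ext[OF c d] by auto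
  qed
  show "curve_of N ` (?I \<rightarrow>\<^sub>E UNIV) = trig_curves N"
  proof (intro equalityI subsetI)
    fix f assume "f \<in> trig_curves N"
    then obtain c d where c: "\<And>\<phi>. fst (f \<phi>) = (\<Sum>j\<in>?I. trig_basis j \<phi> * c j)"
      and d: "\<And>\<phi>. snd (f \<phi>) = (\<Sum>j\<in>?I. trig_basis j \<phi> * d j)"
      unfolding trig_curves_def trig_polys_iff by auto
    have "f = curve_of N (restrict (\<lambda>j. (c j, d j)) ?I)"
      by (rule ext) (simp add: prod_eq_iff c d curve_of_def fst_sum snd_sum)
    moreover have "restrict (\<lambda>j. (c j, d j)) ?I \<in> ?I \<rightarrow>\<^sub>E UNIV"
      by (simp add: PiE_def)
    ultimately show "f \<in> curve_of N ` (?I \<rightarrow>\<^sub>E UNIV)" by (rule image_eqI)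
  next
    fix f assume "f \<in> curve_of N ` (?I \<rightarrow>\<^sub>E UNIV)"
    then show "f \<in> trig_curves N" by (elim imageE) (simp add: curve_of_in_trig_curves)
  qed
qed

lemma space_curve_vol: "space (curve_vol N) = trig_curves N"
  using bij_betw_curve_of[of N]
  by (simp add: curve_vol_def space_embed_measure space_PiM bij_betw_def)

end

theory Submission
  imports Defs
begin

text \<open>
  Write a curve of degree \<open>N\<close> as a constant plus an oscillating part. With all coefficients but the
  constant one of the first curve fixed, the number of intersections with \<open>g\<close> is the number of
  preimages of that coefficient under a smooth map from the parameter square to the plane, so the
  area formula turns its integral into an integral of the Jacobian \<open>|det (f', g')|\<close> over all
  parameter pairs. For fixed parameters, value and derivative are orthogonal linear functions of the
  coefficients; rotating the two coefficients of each frequency and completing squares gives their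
  joint density in a ball, independently of the parameters. The remaining integrals are Beta
  integrals and yield the exact mean
  \<open>\<pi>/3 \<cdot> N (N + 1) \<Gamma>(2N + 1) \<Gamma>(2N + 2) / \<Gamma>(2N + 3/2)\<^sup>2\<close> for \<open>N \<ge> 1\<close>; log-convexity of the Gamma
  function bounds the Gamma quotient between \<open>1\<close> and \<open>1 + O(1/N)\<close>.
\<close>

section \<open>Integrals over the plane\<close>

text \<open>Differentiation acts on the cosine and sine of one frequency as a quarter turn times the
  frequency. This makes value and derivative orthogonal at every parameter, with squared norms N +
  1/2 and 1 + 4 + ... + N^2 per coordinate. A ball therefore induces on (value, derivative) the
  volume of a fibre ball, a power of the remaining squared radius; this is why truncated powers run
  through all the integrals. At a crossing the two curves share their value while the derivatives
  stay independent given that value. So the two densities are multiplied, integrated against the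
  determinant of the derivatives, and only then integrated over the common value. Half-integer
  powers arise on the way but occur in pairs, and the radius cancels against the squared volume of
  one ball. An obstacle is that the number of intersections can be infinite and is not visibly
  measurable. It is treated as a counting measure with values in \<open>ennreal\<close>; that its
  integral is finite shows afterwards that the pairs in the balls with infinitely many intersections
  form a null set.\<close>

text \<open>The case distinction, rather than a power of \<open>max 0 s\<close>, makes
  \<open>pos_power 0\<close> the indicator of the nonnegative half-line. This is the density from
  which the recursion over frequencies starts.\<close>

definition pos_power :: "nat \<Rightarrow> real \<Rightarrow> real" where
  "pos_power m s = (if 0 \<le> s then s ^ m else 0)"

lemma pos_power_nonneg [simp]: "0 \<le> pos_power m s"
  by (simp add: pos_power_def)

lemma pos_power_measurable [measurable]: "pos_power m \<in> borel_measurable borel"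
  unfolding pos_power_def by measurable

lemma pos_power_neg: "s < 0 \<Longrightarrow> pos_power m s = 0"
  by (simp add: pos_power_def)

text \<open>The side condition excludes \<open>r = 0\<close>, \<open>m = 0\<close>, where the left
  side is 1 but the right side vanishes for negative \<open>s\<close>.\<close>

lemma pos_power_mult: "0 \<le> r \<Longrightarrow> 0 < r \<or> m \<noteq> 0 \<Longrightarrow> pos_power m (r * s) = r ^ m * pos_power m s"
  by (auto simp: pos_power_def zero_le_mult_iff power_mult_distrib)

text \<open>A disc of squared radius t has area pi t, so the image of plane Lebesgue measure under
  the squared norm is pi times Lebesgue measure on the half-line. The two measures are compared on
  the half-lines \<open>{..t}\<close>.\<close>

lemma nn_integral_norm_square:
  fixes k :: "real \<Rightarrow> ennreal"
  assumes [measurable]: "k \<in> borel_measurable borel"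
  shows "(\<integral>\<^sup>+(x::real \<times> real). k ((norm x)\<^sup>2) \<partial>lborel) = ennreal pi * (\<integral>\<^sup>+t. k t * indicator {0..} t \<partial>lborel)"
proof -
  define M where "M = distr (lborel :: (real \<times> real) measure) borel (\<lambda>x. (norm x)\<^sup>2)"
  define D where "D = density lborel (\<lambda>t::real. ennreal pi * indicator {0..} t)"
  have M: "emeasure M {..t} = ennreal (pi * max 0 t)" for t
  proof -
    have "emeasure M {..t} = emeasure lborel {x::real \<times> real. (norm x)\<^sup>2 \<le> t}"
      unfolding M_def by (subst emeasure_distr) (auto simp: vimage_def)
    also have "{x::real \<times> real. (norm x)\<^sup>2 \<le> t} = (if 0 \<le> t then cball 0 (sqrt t) else {})"
    proof (cases "0 \<le> t")
      case True
      then have "(norm x)\<^sup>2 \<le> t \<longleftrightarrow> norm x \<le> sqrt t" for x :: "real \<times> real"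
        by (metis norm_ge_zero power_mono real_le_rsqrt real_sqrt_pow2)
      then show ?thesis using True by auto
    next
      case False
      then have "\<not> (norm x)\<^sup>2 \<le> t" for x :: "real \<times> real"
        by (smt (verit) zero_le_power2)
      then show ?thesis using False by simp
    qed
    also have "emeasure lborel \<dots> = ennreal (pi * max 0 t)"
      using unit_ball_vol_2 by (auto simp: emeasure_cball mult.commute)
    finally show ?thesis .
  qed
  have D: "emeasure D {..t} = ennreal (pi * max 0 t)" for t
  proof -
    have "emeasure D {..t} = (\<integral>\<^sup>+x. ennreal pi * indicator {0..t} x \<partial>lborel)"
      unfolding D_def by (subst emeasure_density) (auto intro!: nn_integral_cong split: split_indicator)
    also have "\<dots> = ennreal (pi * max 0 t)"
      by (cases "0 \<le> t") (simp_all add: nn_integral_cmult ennreal_mult)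
    finally show ?thesis .
  qed
  have "M = D"
  proof (rule measure_eqI_generator_eq[where \<Omega> = UNIV and E = "range (\<lambda>a::real. {..a})" and A = "\<lambda>n. {..real n}"])
    show "Int_stable (range (\<lambda>a::real. {..a}))"
      by (auto simp: Int_stable_def)
    show "sets M = sigma_sets UNIV (range (\<lambda>a. {..a}))" "sets D = sigma_sets UNIV (range (\<lambda>a. {..a}))"
      by (simp_all add: M_def D_def borel_eq_atMost)
    show "(\<Union>i. {..real i}) = UNIV"
      by (auto simp: real_arch_simple)
  qed (auto simp: M D)
  have "(\<integral>\<^sup>+(x::real \<times> real). k ((norm x)\<^sup>2) \<partial>lborel) = (\<integral>\<^sup>+t. k t \<partial>M)"
    unfolding M_def by (subst nn_integral_distr) auto
  also have "\<dots> = (\<integral>\<^sup>+t. ennreal pi * (k t * indicator {0..} t) \<partial>lborel)"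
    unfolding \<open>M = D\<close> D_def by (subst nn_integral_density) (auto simp: ac_simps)
  also have "\<dots> = ennreal pi * (\<integral>\<^sup>+t. k t * indicator {0..} t \<partial>lborel)"
    by (rule nn_integral_cmult) auto
  finally show ?thesis .
qed

lemma nn_integral_affine:
  fixes f :: "'a::euclidean_space \<Rightarrow> ennreal"
  assumes [measurable]: "f \<in> borel_measurable borel" and c: "c \<noteq> 0"
  shows "(\<integral>\<^sup>+x. f x \<partial>lborel) = ennreal (\<bar>c\<bar> ^ DIM('a)) * (\<integral>\<^sup>+x. f (t + c *\<^sub>R x) \<partial>lborel)"
  by (subst lborel_affine[OF c, of t])
     (simp add: nn_integral_density nn_integral_distr nn_integral_cmult)

lemma nn_integral_shift:
  fixes f :: "'a::euclidean_space \<Rightarrow> ennreal"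
  assumes [measurable]: "f \<in> borel_measurable borel"
  shows "(\<integral>\<^sup>+x. f (x + t) \<partial>lborel) = (\<integral>\<^sup>+x. f x \<partial>lborel)"
  using nn_integral_affine[OF assms, of 1 t] by (simp add: add.commute)

lemma nn_integral_swap:
  fixes f :: "'a::euclidean_space \<times> 'b::euclidean_space \<Rightarrow> ennreal"
  assumes [measurable]: "f \<in> borel_measurable borel"
  shows "(\<integral>\<^sup>+x. \<integral>\<^sup>+y. f (x, y) \<partial>lborel \<partial>lborel) = (\<integral>\<^sup>+y. \<integral>\<^sup>+x. f (x, y) \<partial>lborel \<partial>lborel)"
proof -
  have [measurable]: "f \<in> borel_measurable (lborel \<Otimes>\<^sub>M lborel)"
    using assms by (simp add: lborel_prod)
  show ?thesis
    by (rule lborel_pair.Fubini'[symmetric]) simp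
qed

lemma nn_integral_lborel_pair:
  fixes f :: "'a::euclidean_space \<times> 'b::euclidean_space \<Rightarrow> ennreal"
  assumes [measurable]: "f \<in> borel_measurable borel"
  shows "(\<integral>\<^sup>+z. f z \<partial>lborel) = (\<integral>\<^sup>+x. \<integral>\<^sup>+y. f (x, y) \<partial>lborel \<partial>lborel)"
proof -
  have "f \<in> borel_measurable (lborel \<Otimes>\<^sub>M lborel)"
    using assms by (simp add: lborel_prod)
  then show ?thesis
    by (subst lborel_prod[symmetric], subst lborel.nn_integral_fst[symmetric]) simp_all
qed

lemma borel_measurable_pairI:
  fixes f :: "'a::euclidean_space \<times> 'b::euclidean_space \<Rightarrow> 'c::topological_space"
  shows "f \<in> borel_measurable (borel \<Otimes>\<^sub>M borel) \<Longrightarrow> f \<in> borel_measurable borel"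
  by (simp add: borel_prod)

text \<open>A plane rotation is a product of three shears unless its sine vanishes.\<close>

lemma nn_integral_rotation:
  fixes h :: "'a::euclidean_space \<times> 'a \<Rightarrow> ennreal"
  assumes h [measurable]: "h \<in> borel_measurable borel" and cs: "c\<^sup>2 + s\<^sup>2 = 1"
  shows "(\<integral>\<^sup>+x. \<integral>\<^sup>+y. h (c *\<^sub>R x + s *\<^sub>R y, c *\<^sub>R y - s *\<^sub>R x) \<partial>lborel \<partial>lborel) = (\<integral>\<^sup>+x. \<integral>\<^sup>+y. h (x, y) \<partial>lborel \<partial>lborel)"
proof -
  \<comment> \<open>For one fixed coordinate a shear is a translation of the other one, so both
    kinds of shear preserve the integral.\<close>
  have low: "(\<integral>\<^sup>+x. \<integral>\<^sup>+y. k (x, y + q *\<^sub>R x) \<partial>lborel \<partial>lborel) = (\<integral>\<^sup>+x. \<integral>\<^sup>+y. k (x, y) \<partial>lborel \<partial>lborel)"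
    if [measurable]: "k \<in> borel_measurable borel" for k :: "'a \<times> 'a \<Rightarrow> ennreal" and q
    by (intro nn_integral_cong nn_integral_shift) simp
  have up: "(\<integral>\<^sup>+x. \<integral>\<^sup>+y. k (x + p *\<^sub>R y, y) \<partial>lborel \<partial>lborel) = (\<integral>\<^sup>+x. \<integral>\<^sup>+y. k (x, y) \<partial>lborel \<partial>lborel)"
    if [measurable]: "k \<in> borel_measurable borel" for k :: "'a \<times> 'a \<Rightarrow> ennreal" and p
  proof -
    have "(\<integral>\<^sup>+x. \<integral>\<^sup>+y. k (x + p *\<^sub>R y, y) \<partial>lborel \<partial>lborel) = (\<integral>\<^sup>+y. \<integral>\<^sup>+x. k (x + p *\<^sub>R y, y) \<partial>lborel \<partial>lborel)"
      by (rule nn_integral_swap[of "\<lambda>(x, y). k (x + p *\<^sub>R y, y)", simplified])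
        (auto intro!: borel_measurable_pairI)
    also have "\<dots> = (\<integral>\<^sup>+y. \<integral>\<^sup>+x. k (x, y) \<partial>lborel \<partial>lborel)"
      by (intro nn_integral_cong nn_integral_shift) simp
    also have "\<dots> = (\<integral>\<^sup>+x. \<integral>\<^sup>+y. k (x, y) \<partial>lborel \<partial>lborel)"
      by (rule nn_integral_swap[symmetric]) simp
    finally show ?thesis .
  qed
  show ?thesis
  proof (cases "s = 0")
    case False
    \<comment> \<open>\<open>p\<close> is the tangent of half the rotation angle; shearing by
      \<open>p\<close>, \<open>q\<close>, \<open>p\<close> in turn composes to the rotation.\<close>
    define p q where "p = (1 - c) / s" and "q = - s"
    have 1: "1 + p * q = c" "p + p * (1 + p * q) = s"
      using False cs by (auto simp: p_def q_def field_simps power2_eq_square)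
    define k1 where "k1 = (\<lambda>(x, y). h (x + p *\<^sub>R y, y))"
    define k2 where "k2 = (\<lambda>(x, y). k1 (x, y + q *\<^sub>R x))"
    have [measurable]: "k1 \<in> borel_measurable borel"
      unfolding k1_def by (rule borel_measurable_pairI) simp
    have [measurable]: "k2 \<in> borel_measurable borel"
      unfolding k2_def by (rule borel_measurable_pairI) simp
    have "x + p *\<^sub>R y + p *\<^sub>R (y + q *\<^sub>R (x + p *\<^sub>R y)) = (1 + p * q) *\<^sub>R x + (p + p * (1 + p * q)) *\<^sub>R y"
      "y + q *\<^sub>R (x + p *\<^sub>R y) = (1 + p * q) *\<^sub>R y + q *\<^sub>R x" for x y :: 'a
      by (simp_all only: scaleR_add_left scaleR_add_right distrib_left scaleR_scaleR scaleR_one mult_1_left mult_1_right mult_ac add_ac)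
    then have "(c *\<^sub>R x + s *\<^sub>R y, c *\<^sub>R y - s *\<^sub>R x) =
        (x + p *\<^sub>R y + p *\<^sub>R (y + q *\<^sub>R (x + p *\<^sub>R y)), y + q *\<^sub>R (x + p *\<^sub>R y))" for x y :: 'a
      unfolding 1(1) 1(2)[unfolded 1(1)] by (simp add: q_def)
    then have "h (c *\<^sub>R x + s *\<^sub>R y, c *\<^sub>R y - s *\<^sub>R x) = k2 (x + p *\<^sub>R y, y)" for x y
      by (simp only: k2_def k1_def prod.case)
    then have "(\<integral>\<^sup>+x. \<integral>\<^sup>+y. h (c *\<^sub>R x + s *\<^sub>R y, c *\<^sub>R y - s *\<^sub>R x) \<partial>lborel \<partial>lborel)
        = (\<integral>\<^sup>+x. \<integral>\<^sup>+y. k2 (x, y) \<partial>lborel \<partial>lborel)"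
      by (simp add: up)
    also have "\<dots> = (\<integral>\<^sup>+x. \<integral>\<^sup>+y. k1 (x, y) \<partial>lborel \<partial>lborel)"
      using low[of k1 q] by (simp add: k2_def)
    also have "\<dots> = (\<integral>\<^sup>+x. \<integral>\<^sup>+y. h (x, y) \<partial>lborel \<partial>lborel)"
      using up[of h p] by (simp add: k1_def)
    finally show ?thesis .
  next
    case True
    then have c: "c = 1 \<or> c = -1"
      using cs by (simp add: power2_eq_1_iff)
    have neg: "(\<integral>\<^sup>+x. f (- x) \<partial>lborel) = (\<integral>\<^sup>+x. f x \<partial>lborel)"
      if "f \<in> borel_measurable borel" for f :: "'a \<Rightarrow> ennreal"
      using nn_integral_affine[OF that, of "-1" 0] by simp
    have "(\<integral>\<^sup>+x. \<integral>\<^sup>+y. h (- x, - y) \<partial>lborel \<partial>lborel) = (\<integral>\<^sup>+x. \<integral>\<^sup>+y. h (- x, y) \<partial>lborel \<partial>lborel)"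
      by (intro nn_integral_cong neg) simp
    also have "\<dots> = (\<integral>\<^sup>+x. \<integral>\<^sup>+y. h (x, y) \<partial>lborel \<partial>lborel)"
      by (rule neg[of "\<lambda>x. \<integral>\<^sup>+y. h (x, y) \<partial>lborel"]) simp
    finally show ?thesis
      using True c by auto
  qed
qed

lemma nn_integral_pos_power_Ici:
  fixes A s :: real
  assumes "A > 0"
  shows "(\<integral>\<^sup>+t. ennreal (pos_power m (s - A * t)) * indicator {0..} t \<partial>lborel) = ennreal (pos_power (Suc m) s / (A * Suc m))"
proof (cases "s < 0")
  case True
  have "s - A * t < 0" if "t \<ge> 0" for t
    using True assms that by (smt (verit) mult_nonneg_nonneg)
  then have "ennreal (pos_power m (s - A * t)) * indicator {0..} t = 0" for t
    by (cases "t \<ge> 0") (simp_all add: pos_power_neg)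
  then have "(\<integral>\<^sup>+t. ennreal (pos_power m (s - A * t)) * indicator {0..} t \<partial>lborel) = 0"
    by (simp only: nn_integral_const) simp
  then show ?thesis
    using True by (simp add: pos_power_def)
next
  case False
  then have s: "0 \<le> s / A"
    using assms by simp
  define F where "F = (\<lambda>t. - ((s - A * t) ^ Suc m / (A * Suc m)))"
  have "(\<integral>\<^sup>+t. ennreal (pos_power m (s - A * t)) * indicator {0..} t \<partial>lborel)
      = (\<integral>\<^sup>+t. ennreal ((s - A * t) ^ m) * indicator {0..s / A} t \<partial>lborel)"
  proof (rule nn_integral_cong)
    fix t
    have "0 \<le> s - A * t \<longleftrightarrow> t \<le> s / A"
      using assms by (simp add: pos_le_divide_eq mult.commute)
    then show "ennreal (pos_power m (s - A * t)) * indicator {0..} t = ennreal ((s - A * t) ^ m) * indicator {0..s / A} t"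
      by (simp add: pos_power_def indicator_def del: diff_ge_0_iff_ge)
  qed
  also have "\<dots> = ennreal (F (s / A) - F 0)"
  proof (rule nn_integral_FTC_Icc[where F = F, OF _ _ _ s])
    show "DERIV F x :> (s - A * x) ^ m" if "x \<in> {0..s / A}" for x
    proof -
      have "DERIV F x :> - (real (Suc m) * (s - A * x) ^ m * (0 - A) / (A * Suc m))"
        unfolding F_def using assms by (auto intro!: derivative_eq_intros simp del: of_nat_Suc power_Suc)
      also have "- (real (Suc m) * (s - A * x) ^ m * (0 - A) / (A * Suc m)) = (s - A * x) ^ m"
        using assms by (simp del: of_nat_Suc)
      finally show ?thesis .
    qed
    show "0 \<le> (s - A * x) ^ m" if "x \<in> {0..s / A}" for x
      using that assms by (intro zero_le_power) (simp add: pos_le_divide_eq mult.commute)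
  qed simp
  also have "\<dots> = ennreal (pos_power (Suc m) s / (A * Suc m))"
    using False assms by (simp add: pos_power_def F_def)
  finally show ?thesis .
qed

lemma nn_integral_pos_power_norm:
  fixes A s :: real
  assumes "A > 0"
  shows "(\<integral>\<^sup>+(x::real \<times> real). ennreal (pos_power m (s - A * (norm x)\<^sup>2)) \<partial>lborel) = ennreal (pi * pos_power (Suc m) s / (A * Suc m))"
  using assms by (simp add: nn_integral_norm_square[of "\<lambda>t. ennreal (pos_power m (s - A * t))"] nn_integral_pos_power_Ici
      flip: ennreal_mult del: of_nat_Suc)

text \<open>Completing the square reduces the integral to the centred case.\<close>

lemma nn_integral_pos_power_square:
  fixes z :: "real \<times> real"
  assumes A: "A > 0" and B: "B \<ge> 0"
  shows "(\<integral>\<^sup>+x. ennreal (pos_power m (s - A * (norm x)\<^sup>2 - B * (norm (z - b *\<^sub>R x))\<^sup>2)) \<partial>lborel)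
    = ennreal (pi / ((A + B * b\<^sup>2) * Suc m) * pos_power (Suc m) (s - A * B / (A + B * b\<^sup>2) * (norm z)\<^sup>2))"
proof -
  define G where "G = A + B * b\<^sup>2"
  have G: "G > 0"
    using A B by (simp add: G_def add_pos_nonneg)
  \<comment> \<open>\<open>w\<close> minimizes the quadratic form A |x|^2 + B |z - b x|^2 in x. Its
    minimum A B / G |z|^2 is what remains after centring at \<open>w\<close>. The identity is
    checked after multiplication by \<open>G\<close>.\<close>
  define w where "w = (B * b / G) *\<^sub>R z"
  have sq: "A * (norm (x + w))\<^sup>2 + B * (norm (z - b *\<^sub>R (x + w)))\<^sup>2 = G * (norm x)\<^sup>2 + A * B / G * (norm z)\<^sup>2" for x
  proof -
    have "G * (A * (norm (x + w))\<^sup>2 + B * (norm (z - b *\<^sub>R (x + w)))\<^sup>2)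
        = G * (G * (norm (x + w))\<^sup>2 - 2 * B * b * (z \<bullet> (x + w)) + B * (norm z)\<^sup>2)"
      unfolding G_def power2_norm_eq_inner
      by (simp add: inner_simps inner_commute power2_eq_square algebra_simps)
    also have "\<dots> = (norm (G *\<^sub>R (x + w)))\<^sup>2 - 2 * B * b * (z \<bullet> (G *\<^sub>R (x + w))) + G * B * (norm z)\<^sup>2"
      by (simp only: norm_scaleR power_mult_distrib power2_abs inner_scaleR_right) (simp add: power2_eq_square algebra_simps)
    also have "G *\<^sub>R (x + w) = G *\<^sub>R x + (B * b) *\<^sub>R z"
      using G by (simp add: w_def algebra_simps)
    also have "(norm (G *\<^sub>R x + (B * b) *\<^sub>R z))\<^sup>2 - 2 * B * b * (z \<bullet> (G *\<^sub>R x + (B * b) *\<^sub>R z)) + G * B * (norm z)\<^sup>2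
        = G * (G * (norm x)\<^sup>2) + (G - B * b\<^sup>2) * B * (norm z)\<^sup>2"
      unfolding power2_norm_eq_inner by (simp add: inner_simps inner_commute power2_eq_square algebra_simps)
    also have "\<dots> = G * (G * (norm x)\<^sup>2 + A * B / G * (norm z)\<^sup>2)"
      using G by (simp add: distrib_left) (simp add: G_def)
    finally show ?thesis using G by simp
  qed
  have "(\<integral>\<^sup>+x. ennreal (pos_power m (s - A * (norm x)\<^sup>2 - B * (norm (z - b *\<^sub>R x))\<^sup>2)) \<partial>lborel)
      = (\<integral>\<^sup>+x. ennreal (pos_power m (s - A * (norm (x + w))\<^sup>2 - B * (norm (z - b *\<^sub>R (x + w)))\<^sup>2)) \<partial>lborel)"
    by (rule nn_integral_shift[symmetric]) simp
  also have "\<dots> = (\<integral>\<^sup>+(x::real \<times> real). ennreal (pos_power m ((s - A * B / G * (norm z)\<^sup>2) - G * (norm x)\<^sup>2)) \<partial>lborel)"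
  proof (rule nn_integral_cong)
    fix x
    have "s - A * (norm (x + w))\<^sup>2 - B * (norm (z - b *\<^sub>R (x + w)))\<^sup>2 = (s - A * B / G * (norm z)\<^sup>2) - G * (norm x)\<^sup>2"
      using sq[of x] by linarith
    then show "ennreal (pos_power m (s - A * (norm (x + w))\<^sup>2 - B * (norm (z - b *\<^sub>R (x + w)))\<^sup>2)) =
        ennreal (pos_power m ((s - A * B / G * (norm z)\<^sup>2) - G * (norm x)\<^sup>2))"
      by (rule arg_cong)
  qed
  also have "\<dots> = ennreal (pi * pos_power (Suc m) (s - A * B / G * (norm z)\<^sup>2) / (G * Suc m))"
    by (rule nn_integral_pos_power_norm[OF G])
  finally show ?thesis
    unfolding G_def by simp
qed

text \<open>The factor |x| makes the integrand elementary: its primitive \<open>F\<close> carries 2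
  A (n + 1) in the denominator, and the two half-lines contribute equally, which removes the
  2.\<close>

lemma nn_integral_abs_pos_power:
  fixes A s :: real
  assumes A: "A > 0"
  shows "(\<integral>\<^sup>+x. ennreal (\<bar>x\<bar> * pos_power n (s - A * x\<^sup>2)) \<partial>lborel) = ennreal (pos_power (Suc n) s / (A * Suc n))"
proof (cases "s < 0")
  case True
  then have "s - A * x\<^sup>2 < 0" for x
    using A by (smt (verit) mult_nonneg_nonneg zero_le_power2)
  then show ?thesis
    using True by (simp add: pos_power_neg)
next
  case False
  define r where "r = sqrt (s / A)"
  have r: "0 \<le> r" "A * r\<^sup>2 = s"
    using False A by (simp_all add: r_def)
  have iff: "0 \<le> s - A * x\<^sup>2 \<longleftrightarrow> \<bar>x\<bar> \<le> r" for x
    using A r by (simp add: r(2)[symmetric] abs_le_square_iff[of x r, simplified, symmetric])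
  define F where "F = (\<lambda>x. - ((s - A * x\<^sup>2) ^ Suc n / (2 * A * Suc n)))"
  have DF: "DERIV F x :> x * (s - A * x\<^sup>2) ^ n" for x
  proof -
    have "DERIV F x :> - (real (Suc n) * (s - A * x\<^sup>2) ^ n * (0 - A * (2 * x)) / (2 * A * Suc n))"
      unfolding F_def using A by (auto intro!: derivative_eq_intros simp del: of_nat_Suc power_Suc)
    also have "- (real (Suc n) * (s - A * x\<^sup>2) ^ n * (0 - A * (2 * x)) / (2 * A * Suc n)) = x * (s - A * x\<^sup>2) ^ n"
      using A by (simp del: of_nat_Suc)
    finally show ?thesis .
  qed
  have right: "(\<integral>\<^sup>+x. ennreal (x * (s - A * x\<^sup>2) ^ n) * indicator {0..r} x \<partial>lborel) = ennreal (F r - F 0)"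
  proof (rule nn_integral_FTC_Icc[where F = F, OF _ DF _ r(1)])
    show "0 \<le> x * (s - A * x\<^sup>2) ^ n" if "x \<in> {0..r}" for x
      using that iff[of x] by (intro mult_nonneg_nonneg zero_le_power) auto
  qed simp
  have left: "(\<integral>\<^sup>+x. ennreal (- x * (s - A * x\<^sup>2) ^ n) * indicator {-r..0} x \<partial>lborel)
      = (\<integral>\<^sup>+x. ennreal (x * (s - A * x\<^sup>2) ^ n) * indicator {0..r} x \<partial>lborel)"
    by (subst nn_integral_real_affine[where c = "-1" and t = 0])
       (auto intro!: nn_integral_cong split: split_indicator)
  have "(\<integral>\<^sup>+x. ennreal (\<bar>x\<bar> * pos_power n (s - A * x\<^sup>2)) \<partial>lborel)
      = (\<integral>\<^sup>+x. ennreal (x * (s - A * x\<^sup>2) ^ n) * indicator {0..r} x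
           + ennreal (- x * (s - A * x\<^sup>2) ^ n) * indicator {-r..0} x \<partial>lborel)"
  proof (rule nn_integral_cong)
    fix x :: real
    consider "r < \<bar>x\<bar>" | "x = 0" | "0 < x" "x \<le> r" | "x < 0" "- x \<le> r" by linarith
    then show "ennreal (\<bar>x\<bar> * pos_power n (s - A * x\<^sup>2)) = ennreal (x * (s - A * x\<^sup>2) ^ n) * indicator {0..r} x
           + ennreal (- x * (s - A * x\<^sup>2) ^ n) * indicator {-r..0} x"
      using iff[of x] r(1) by cases (auto simp: pos_power_def indicator_def)
  qed
  also have "\<dots> = ennreal (F r - F 0) + ennreal (F r - F 0)"
    by (subst nn_integral_add) (simp_all only: left right, simp_all)
  also have "\<dots> = ennreal (pos_power (Suc n) s / (A * Suc n))"
    using False A r by (simp add: F_def pos_power_def flip: ennreal_plus del: of_nat_Suc)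
  finally show ?thesis .
qed

lemma nn_integral_pos_power_real:
  fixes A s :: real
  assumes A: "A > 0"
  shows "(\<integral>\<^sup>+x. ennreal (pos_power n (s - A * x\<^sup>2)) \<partial>lborel) = ennreal (sqrt (s / A) * pos_power n s * Beta (1/2) (n + 1))"
proof (cases "s \<le> 0")
  case True
  then have "s - A * x\<^sup>2 < 0" if "x \<noteq> 0" for x
    using A that by (smt (verit) mult_pos_pos zero_less_power2)
  \<comment> \<open>For \<open>s = 0\<close> and \<open>n = 0\<close> the integrand is 1 at the
    origin, so it vanishes only almost everywhere.\<close>
  then have "AE x in lborel. ennreal (pos_power n (s - A * x\<^sup>2)) = 0"
    by (intro AE_I2 impI AE_mp[OF AE_lborel_singleton[of 0], of "\<lambda>x. ennreal (pos_power n (s - A * x\<^sup>2)) = 0"])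
      (simp add: pos_power_neg)
  then have "(\<integral>\<^sup>+x. ennreal (pos_power n (s - A * x\<^sup>2)) \<partial>lborel) = 0"
    by (subst nn_integral_0_iff_AE) auto
  then show ?thesis
    using True A by (cases "s = 0") (simp_all add: pos_power_def)
next
  case False
  define r where "r = sqrt (s / A)"
  have r: "0 < r" "A * r\<^sup>2 = s"
    using False A by (simp_all add: r_def)
  have "(\<integral>\<^sup>+x. ennreal (pos_power n (s - A * x\<^sup>2)) \<partial>lborel) = ennreal r * (\<integral>\<^sup>+x. ennreal (pos_power n (s - A * (0 + r * x)\<^sup>2)) \<partial>lborel)"
    using r(1) by (subst nn_integral_real_affine[where c = r and t = 0]) auto
  \<comment> \<open>After scaling by \<open>r\<close> the integral is that of (1 - x^2)^n over
    [-1, 1]. It is written with an even power of the square root to match the Beta integral known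
    from ball volumes.\<close>
  also have "(\<integral>\<^sup>+x. ennreal (pos_power n (s - A * (0 + r * x)\<^sup>2)) \<partial>lborel)
      = (\<integral>\<^sup>+x. ennreal (s ^ n) * ennreal (indicator {-1..1} x * sqrt (1 - x\<^sup>2) ^ (2 * n)) \<partial>lborel)"
  proof (rule nn_integral_cong)
    fix x
    have "s - A * (0 + r * x)\<^sup>2 = s * (1 - x\<^sup>2)"
      by (simp add: r(2)[symmetric] algebra_simps)
    moreover have "0 \<le> 1 - x\<^sup>2 \<longleftrightarrow> x \<in> {-1..1}"
      by (auto simp: abs_square_le_1)
    ultimately show "ennreal (pos_power n (s - A * (0 + r * x)\<^sup>2)) = ennreal (s ^ n) * ennreal (indicator {-1..1} x * sqrt (1 - x\<^sup>2) ^ (2 * n))"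
      using False by (simp add: pos_power_mult power_mult) (simp add: pos_power_def indicator_def ennreal_mult[symmetric])
  qed
  also have "\<dots> = ennreal (s ^ n) * ennreal (Beta (1/2) (n + 1))"
    by (subst nn_integral_cmult) (simp_all add: emeasure_cball_aux_integral add.commute)
  finally show ?thesis
    using False r by (simp add: r_def pos_power_def ennreal_mult Beta_def mult.assoc add.commute flip: ennreal_mult)
qed

section \<open>Integrals of the Jacobian determinant\<close>

definition det2 :: "real \<times> real \<Rightarrow> real \<times> real \<Rightarrow> real" where
  "det2 v w = fst v * snd w - snd v * fst w"

lemma borel_measurable_fst_snd [measurable (raw)]:
  fixes f :: "'a \<Rightarrow> 'b::second_countable_topology \<times> 'c::second_countable_topology"
  assumes "f \<in> borel_measurable M"
  shows "(\<lambda>x. fst (f x)) \<in> borel_measurable M" "(\<lambda>x. snd (f x)) \<in> borel_measurable M"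
  by (rule measurable_compose[OF assms], intro borel_measurable_continuous_onI continuous_intros)+

lemma det2_measurable [measurable (raw)]:
  assumes [measurable]: "f \<in> borel_measurable M" "g \<in> borel_measurable M"
  shows "(\<lambda>x. det2 (f x) (g x)) \<in> borel_measurable M"
  unfolding det2_def by measurable

text \<open>(c, d) is the unit normal of \<open>w\<close>, so in coordinates rotated to it the
  determinant is \<open>norm w\<close> times the first coordinate, while the norm is unchanged.
  Integrating out that coordinate is elementary and raises the exponent by one; the other coordinate
  gives the Beta factor.\<close>

lemma nn_integral_det2_pos_power:
  fixes A s :: real
  assumes A: "A > 0"
  shows "(\<integral>\<^sup>+v. ennreal (\<bar>det2 v w\<bar> * pos_power n (s - A * (norm v)\<^sup>2)) \<partial>lborel)
    = ennreal (norm w * (sqrt (s / A) * pos_power (Suc n) s * Beta (1/2) (n + 2) / (A * Suc n)))"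
proof (cases "w = 0")
  case True
  then show ?thesis by (simp add: det2_def)
next
  case False
  define c d where "c = snd w / norm w" and "d = - (fst w / norm w)"
  have nw: "(norm w)\<^sup>2 = (fst w)\<^sup>2 + (snd w)\<^sup>2" "norm w > 0"
    subgoal by (simp add: norm_prod_def)
    subgoal using False by simp
    done
  have "c\<^sup>2 + d\<^sup>2 = ((fst w)\<^sup>2 + (snd w)\<^sup>2) / (norm w)\<^sup>2"
    by (simp add: c_def d_def power_divide add_divide_distrib)
  then have cd: "c\<^sup>2 + d\<^sup>2 = 1"
    using nw(2) unfolding nw(1)[symmetric] by simp
  define h where "h = (\<lambda>(x, y). ennreal (norm w * (\<bar>x\<bar> * pos_power n (s - A * y\<^sup>2 - A * x\<^sup>2))))"
  have h: "h \<in> borel_measurable borel"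
    unfolding h_def by (rule borel_measurable_pairI) simp
  have "ennreal (\<bar>det2 (x, y) w\<bar> * pos_power n (s - A * (norm (x, y))\<^sup>2)) = h (c *\<^sub>R x + d *\<^sub>R y, c *\<^sub>R y - d *\<^sub>R x)" for x y
  proof -
    have "det2 (x, y) w = norm w * (c * x + d * y)"
      using nw by (simp add: det2_def c_def d_def field_simps)
    moreover have "(c * x + d * y)\<^sup>2 + (c * y - d * x)\<^sup>2 = (c\<^sup>2 + d\<^sup>2) * (x\<^sup>2 + y\<^sup>2)"
      by (simp add: power2_eq_square algebra_simps)
    then have "A * (c * x + d * y)\<^sup>2 + A * (c * y - d * x)\<^sup>2 = A * (x\<^sup>2 + y\<^sup>2)"
      by (simp only: cd mult_1 distrib_left[symmetric])
    then have "pos_power n (s - A * (c * y - d * x)\<^sup>2 - A * (c * x + d * y)\<^sup>2) = pos_power n (s - A * (x\<^sup>2 + y\<^sup>2))"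
      by (intro arg_cong[where f = "pos_power n"]) linarith
    ultimately show ?thesis
      by (simp add: h_def norm_Pair abs_mult mult.assoc)
  qed
  then have "(\<integral>\<^sup>+v. ennreal (\<bar>det2 v w\<bar> * pos_power n (s - A * (norm v)\<^sup>2)) \<partial>lborel)
    = (\<integral>\<^sup>+x. \<integral>\<^sup>+y. h (c *\<^sub>R x + d *\<^sub>R y, c *\<^sub>R y - d *\<^sub>R x) \<partial>lborel \<partial>lborel)"
    by (subst nn_integral_lborel_pair) simp_all
  also have "\<dots> = (\<integral>\<^sup>+x. \<integral>\<^sup>+y. h (x, y) \<partial>lborel \<partial>lborel)"
    by (rule nn_integral_rotation[OF h cd])
  also have "\<dots> = (\<integral>\<^sup>+y. \<integral>\<^sup>+x. h (x, y) \<partial>lborel \<partial>lborel)"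
    by (rule nn_integral_swap[OF h])
  also have "\<dots> = (\<integral>\<^sup>+y. ennreal (norm w / (A * Suc n)) * ennreal (pos_power (Suc n) (s - A * y\<^sup>2)) \<partial>lborel)"
  proof (rule nn_integral_cong)
    fix y :: real
    have "(\<integral>\<^sup>+x. h (x, y) \<partial>lborel) = ennreal (norm w) * (\<integral>\<^sup>+x. ennreal (\<bar>x\<bar> * pos_power n (s - A * y\<^sup>2 - A * x\<^sup>2)) \<partial>lborel)"
      by (subst nn_integral_cmult[symmetric]) (simp_all add: h_def ennreal_mult)
    also have "\<dots> = ennreal (norm w / (A * Suc n)) * ennreal (pos_power (Suc n) (s - A * y\<^sup>2))"
      using A by (simp add: nn_integral_abs_pos_power flip: ennreal_mult del: of_nat_Suc)
    finally show "(\<integral>\<^sup>+x. h (x, y) \<partial>lborel) = ennreal (norm w / (A * Suc n)) * ennreal (pos_power (Suc n) (s - A * y\<^sup>2))" .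
  qed
  also have "\<dots> = ennreal (norm w / (A * Suc n)) * ennreal (sqrt (s / A) * pos_power (Suc n) s * Beta (1/2) (Suc n + 1))"
    by (subst nn_integral_cmult) (simp_all add: nn_integral_pos_power_real[OF A] add.commute)
  also have "\<dots> = ennreal (norm w * (sqrt (s / A) * pos_power (Suc n) s * Beta (1/2) (n + 2) / (A * Suc n)))"
    using A by (simp add: ennreal_mult'[symmetric] add_ac del: of_nat_Suc)
  finally show ?thesis by (simp only: of_nat_add of_nat_numeral)
qed

text \<open>The substitution t = |w|^2 and scaling by s / A leave the integral of t^(1/2) (1 - t)^n
  over [0, 1].\<close>

lemma nn_integral_norm_pos_power:
  fixes A s :: real
  assumes A: "A > 0" and n: "n > 0"
  shows "(\<integral>\<^sup>+(w::real \<times> real). ennreal (norm w * pos_power n (s - A * (norm w)\<^sup>2)) \<partial>lborel)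
    = ennreal (pi * (s / A * sqrt (s / A) * pos_power n s * Beta (3/2) (n + 1)))"
proof -
  have "(\<integral>\<^sup>+(w::real \<times> real). ennreal (norm w * pos_power n (s - A * (norm w)\<^sup>2)) \<partial>lborel)
    = ennreal pi * (\<integral>\<^sup>+t. ennreal (sqrt t * pos_power n (s - A * t)) * indicator {0..} t \<partial>lborel)"
    using nn_integral_norm_square[of "\<lambda>t. ennreal (sqrt t * pos_power n (s - A * t))"] by simp
  also have "(\<integral>\<^sup>+t. ennreal (sqrt t * pos_power n (s - A * t)) * indicator {0..} t \<partial>lborel)
    = ennreal (s / A * sqrt (s / A) * pos_power n s * Beta (3/2) (n + 1))"
  proof (cases "s \<le> 0")
    case True
    have "ennreal (sqrt t * pos_power n (s - A * t)) * indicator {0..} t = 0" for t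
    proof (cases "t > 0")
      case True
      then have "s - A * t < 0" using \<open>s \<le> 0\<close> A by (smt (verit) mult_pos_pos)
      then show ?thesis by (simp add: pos_power_neg)
    qed (cases "t = 0"; simp)
    then have "(\<integral>\<^sup>+t. ennreal (sqrt t * pos_power n (s - A * t)) * indicator {0..} t \<partial>lborel) = 0"
      by (simp only: nn_integral_const) simp
    then show ?thesis
      using True A n by (cases "s = 0") (simp_all add: pos_power_def)
  next
    case False
    then have r: "s / A > 0" using A by simp
    have "(\<integral>\<^sup>+t. ennreal (sqrt t * pos_power n (s - A * t)) * indicator {0..} t \<partial>lborel)
        = ennreal (s / A) * (\<integral>\<^sup>+t. ennreal (sqrt (0 + s / A * t) * pos_power n (s - A * (0 + s / A * t))) * indicator {0..} (0 + s / A * t) \<partial>lborel)"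
      using nn_integral_real_affine[of "\<lambda>t. ennreal (sqrt t * pos_power n (s - A * t)) * indicator {0..} t" "s / A" 0] r False A
      unfolding abs_of_pos[OF r] by simp
    also have "(\<integral>\<^sup>+t. ennreal (sqrt (0 + s / A * t) * pos_power n (s - A * (0 + s / A * t))) * indicator {0..} (0 + s / A * t) \<partial>lborel)
        = (\<integral>\<^sup>+t. ennreal (sqrt (s / A) * s ^ n) * (ennreal (t powr (3/2 - 1) * (1 - t) powr (real (n + 1) - 1)) * indicator {0..1} t) \<partial>lborel)"
    proof (rule nn_integral_cong)
      fix t
      have 1: "s - A * (0 + s / A * t) = s * (1 - t)"
        using A by (simp add: algebra_simps)
      have 2: "indicator {0..} (0 + s / A * t) = (indicator {0..} t :: ennreal)"
        using r by (simp add: indicator_def zero_le_mult_iff del: times_divide_eq_left)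
      \<comment> \<open>At \<open>t = 1\<close> the left side is 0 for every exponent, whereas
        \<open>0 ^ 0\<close> is 1; positivity of \<open>n\<close> makes them agree.\<close>
      have 3: "(1 - t) powr (real (n + 1) - 1) = (1 - t) ^ n" if "t \<le> 1"
        using that n by (cases "t = 1") (simp_all add: powr_realpow)
      show "ennreal (sqrt (0 + s / A * t) * pos_power n (s - A * (0 + s / A * t))) * indicator {0..} (0 + s / A * t) =
          ennreal (sqrt (s / A) * s ^ n) * (ennreal (t powr (3/2 - 1) * (1 - t) powr (real (n + 1) - 1)) * indicator {0..1} t)"
      proof (cases "0 \<le> t \<and> t \<le> 1")
        case True
        then show ?thesis
          unfolding 1 2 using False n 3 r
          by (simp add: pos_power_mult powr_half_sqrt real_sqrt_mult ennreal_mult[symmetric] ac_simps) (simp add: pos_power_def ac_simps real_sqrt_mult real_sqrt_divide)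
      next
        case out: False
        then show ?thesis
          unfolding 1 2 using False pos_power_neg[OF mult_pos_neg, of s "1 - t" n]
          by (cases "0 \<le> t") (simp_all add: indicator_def)
      qed
    qed
    also have "\<dots> = ennreal (sqrt (s / A) * s ^ n) * ennreal (Beta (3/2) (n + 1))"
      by (subst nn_integral_cmult) (simp_all add: nn_integral_has_integral_lebesgue'[OF _ has_integral_Beta_real[of "3/2" "n + 1", simplified], simplified])
    finally show ?thesis
      using False r by (simp add: pos_power_def Beta_def ennreal_mult'[symmetric] mult.assoc)
  qed
  finally show ?thesis
    by (simp only: ennreal_mult'[symmetric] pi_ge_zero of_nat_add of_nat_1)
qed

text \<open>The inner integral contributes \<open>norm w\<close> and one factor
  \<open>sqrt (s / A)\<close>, the outer one a second such factor. Their product is s / A, so the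
  result is again a truncated power, now of exponent (n + 1) + n + 2. This keeps the later integral
  over the common value within reach of \<open>nn_integral_pos_power_norm\<close>.\<close>

lemma nn_integral_det2_pos_power_pos_power:
  fixes A s :: real
  assumes A: "A > 0" and n: "n > 0"
  shows "(\<integral>\<^sup>+w. \<integral>\<^sup>+v. ennreal (\<bar>det2 v w\<bar> * pos_power n (s - A * (norm v)\<^sup>2) * pos_power n (s - A * (norm w)\<^sup>2)) \<partial>lborel \<partial>lborel)
    = ennreal (pi * Beta (1/2) (n + 2) * Beta (3/2) (n + 1) / (A ^ 3 * Suc n) * pos_power (2 * n + 3) s)"
proof -
  define K where "K = sqrt (s / A) * pos_power (Suc n) s * Beta (1/2) (n + 2) / (A * Suc n)"
  have K: "K \<ge> 0"
    using A by (cases "s \<ge> 0") (auto simp: K_def pos_power_def Beta_def intro!: mult_nonneg_nonneg divide_nonneg_nonneg)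
  have "(\<integral>\<^sup>+v. ennreal (\<bar>det2 v w\<bar> * pos_power n (s - A * (norm v)\<^sup>2) * pos_power n (s - A * (norm w)\<^sup>2)) \<partial>lborel)
      = ennreal K * ennreal (norm w * pos_power n (s - A * (norm w)\<^sup>2))" for w
  proof -
    have "(\<integral>\<^sup>+v. ennreal (\<bar>det2 v w\<bar> * pos_power n (s - A * (norm v)\<^sup>2) * pos_power n (s - A * (norm w)\<^sup>2)) \<partial>lborel)
      = (\<integral>\<^sup>+v. ennreal (\<bar>det2 v w\<bar> * pos_power n (s - A * (norm v)\<^sup>2)) \<partial>lborel) * ennreal (pos_power n (s - A * (norm w)\<^sup>2))"
      by (subst nn_integral_multc[symmetric]) (simp_all add: ennreal_mult'')
    also have "(\<integral>\<^sup>+v. ennreal (\<bar>det2 v w\<bar> * pos_power n (s - A * (norm v)\<^sup>2)) \<partial>lborel) = ennreal (norm w * K)"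
      by (simp only: nn_integral_det2_pos_power[OF A] K_def of_nat_add of_nat_numeral)
    finally show ?thesis
      using K by (simp add: ennreal_mult'[symmetric] ennreal_mult''[symmetric] mult_ac)
  qed
  then have "(\<integral>\<^sup>+w. \<integral>\<^sup>+v. ennreal (\<bar>det2 v w\<bar> * pos_power n (s - A * (norm v)\<^sup>2) * pos_power n (s - A * (norm w)\<^sup>2)) \<partial>lborel \<partial>lborel)
      = ennreal K * (\<integral>\<^sup>+(w::real \<times> real). ennreal (norm w * pos_power n (s - A * (norm w)\<^sup>2)) \<partial>lborel)"
    by (simp add: nn_integral_cmult)
  also have "\<dots> = ennreal (K * (pi * (s / A * sqrt (s / A) * pos_power n s * Beta (3/2) (n + 1))))"
    using K by (simp only: nn_integral_norm_pos_power[OF A n] ennreal_mult'[symmetric] of_nat_add of_nat_1)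
  also have "K * (pi * (s / A * sqrt (s / A) * pos_power n s * Beta (3/2) (n + 1)))
      = pi * Beta (1/2) (n + 2) * Beta (3/2) (n + 1) / (A ^ 3 * Suc n) * pos_power (2 * n + 3) s"
  proof (cases "s \<ge> 0")
    case True
    have "q * S * B / (A * m) * (pi * (s / A * q * T * C)) = pi * B * C / (A ^ 3 * m) * (S * T * s * s)"
      if "q * q = s / A" "m \<noteq> 0" for q S T B C m :: real
    proof -
      have "q * S * B / (A * m) * (pi * (s / A * q * T * C)) = pi * B * C * (q * q) * (S * T) * (s / A) / (A * m)"
        by (simp add: ac_simps)
      also have "\<dots> = pi * B * C / (A ^ 3 * m) * (S * T * s * s)"
        unfolding that(1) by (simp add: power3_eq_cube ac_simps)
      finally show ?thesis .
    qed
    from this[of "sqrt (s / A)" "real (Suc n)" "s ^ Suc n" "Beta (1/2) (n + 2)" "s ^ n" "Beta (3/2) (n + 1)"]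
    have "K * (pi * (s / A * sqrt (s / A) * pos_power n s * Beta (3/2) (n + 1)))
      = pi * Beta (1/2) (n + 2) * Beta (3/2) (n + 1) / (A ^ 3 * Suc n) * (s ^ Suc n * s ^ n * s * s)"
      using True A by (simp only: K_def pos_power_def if_True) simp
    also have "s ^ Suc n * s ^ n * s * s = s ^ (2 * n + 3)"
      unfolding mult_2 power_add by (simp add: power3_eq_cube)
    finally show ?thesis using True by (simp add: pos_power_def)
  qed (simp add: pos_power_def)
  finally show ?thesis by (simp only: of_nat_add of_nat_numeral of_nat_1)
qed

section \<open>The area formula in the plane\<close>

lemma emeasure_count_image:
  "inj_on f S \<Longrightarrow> emeasure (count_space UNIV) (f ` S) = emeasure (count_space UNIV) S"
  by (simp add: emeasure_count_space finite_image_iff card_image)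

lemma emeasure_count_fibre:
  assumes "inj_on G C"
  shows "emeasure (count_space UNIV) {x \<in> C. G x = w} = indicator (G ` C) w"
proof (cases "w \<in> G ` C")
  case True
  then obtain x where "x \<in> C" "G x = w" by auto
  then have "{x \<in> C. G x = w} = {x}"
    using assms by (auto dest: inj_onD)
  then show ?thesis using True by simp
next
  case False
  then have "{x \<in> C. G x = w} = {}" by auto
  then show ?thesis using False by (simp only:) simp
qed

text \<open>Off the zeros of the Jacobian the map is locally injective, so countably many balls,
  made disjoint, cut \<open>A\<close> into pieces with injective restriction. The change of
  variables formula applies to each piece, and a fibre is counted by the number of piece images
  containing the point. The critical points have a null image. Counting measure replaces
  \<open>card\<close> because it is infinite on infinite fibres.\<close>

lemma nn_integral_fibre_count:
  fixes G :: "real^'n::{finite,wellorder} \<Rightarrow> real^'n::_"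
  assumes der: "\<And>x. (G has_derivative G' x) (at x)"
    and cont: "\<And>x e. e > 0 \<Longrightarrow> \<exists>d>0. \<forall>y. dist x y < d \<longrightarrow> onorm (\<lambda>v. G' y v - G' x v) < e"
    and det: "continuous_on UNIV (\<lambda>x. det (matrix (G' x)))"
    and A: "A \<in> sets borel" "bounded A"
  shows "(\<integral>\<^sup>+w. emeasure (count_space UNIV) {x \<in> A. G x = w} \<partial>lebesgue)
    = (\<integral>\<^sup>+x. ennreal \<bar>det (matrix (G' x))\<bar> * indicator A x \<partial>lborel)"
proof -
  define D where "D x = \<bar>det (matrix (G' x))\<bar>" for x
  have Dfun: "(\<lambda>x. \<bar>det (matrix (G' x))\<bar>) = D"
    by (simp add: D_def fun_eq_iff)
  have Dc: "continuous_on UNIV D"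
    unfolding D_def by (intro continuous_intros det)
  then have [measurable]: "D \<in> borel_measurable borel"
    by (rule borel_measurable_continuous_onI)
  note [measurable] = A(1)
  define S N where "S = {x \<in> A. D x \<noteq> 0}" and "N = {x \<in> A. D x = 0}"
  have [measurable]: "S \<in> sets borel" "N \<in> sets borel"
    unfolding S_def N_def by measurable
  have int: "D integrable_on T" "(\<integral>\<^sup>+x. ennreal (D x) * indicator T x \<partial>lborel) = ennreal (integral T D)"
    if T: "T \<in> sets borel" "T \<subseteq> A" for T
  proof -
    obtain a b where ab: "A \<subseteq> cbox a b"
      using bounded_subset_cbox_symmetric[OF A(2)] by metis
    have "set_integrable lborel (cbox a b) D"
      unfolding set_integrable_def
      by (intro borel_integrable_compact) (auto intro: continuous_on_subset[OF Dc])
    then have si: "set_integrable lborel T D"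
      by (rule set_integrable_subset) (use T ab in auto)
    then show "D integrable_on T"
      by (rule set_borel_integral_eq_integral)
    have "integral T D = (LINT x|lborel. indicator T x *\<^sub>R D x)"
      using set_borel_integral_eq_integral(2)[OF si] by (simp add: set_lebesgue_integral_def)
    then have "ennreal (integral T D) = (\<integral>\<^sup>+x. ennreal (indicator T x *\<^sub>R D x) \<partial>lborel)"
      using si by (subst nn_integral_eq_integral) (auto simp: set_integrable_def D_def)
    also have "\<dots> = (\<integral>\<^sup>+x. ennreal (D x) * indicator T x \<partial>lborel)"
      by (intro nn_integral_cong) (auto simp: indicator_def)
    finally show "(\<integral>\<^sup>+x. ennreal (D x) * indicator T x \<partial>lborel) = ennreal (integral T D)" ..
  qed
  \<comment> \<open>A nonzero determinant gives a left inverse of the derivative; with continuity of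
    the derivative in operator norm this forces injectivity on a small ball.\<close>
  have "\<exists>r>0. inj_on G (ball x r)" if "D x \<noteq> 0" for x
  proof -
    have lin: "linear (G' x)"
      using der has_derivative_linear by blast
    have "inj (G' x)"
      using that lin by (simp add: D_def det_nz_iff_inj)
    then obtain g' where g': "linear g'" "g' \<circ> G' x = id"
      using linear_injective_left_inverse[OF lin] by auto
    obtain r where "r > 0" "inj_on G (ball x r)"
      using has_derivative_locally_injective[of x UNIV g' G' G] g' der cont[of _ x]
      by (auto simp: linear_conv_bounded_linear)
    then show ?thesis by blast
  qed
  then obtain r where r: "\<And>x. D x \<noteq> 0 \<Longrightarrow> r x > 0 \<and> inj_on G (ball x (r x))"
    by metis
  obtain \<F> where F: "\<F> \<subseteq> (\<lambda>x. ball x (r x)) ` {x. D x \<noteq> 0}" "countable \<F>"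
      "\<Union>\<F> = \<Union>((\<lambda>x. ball x (r x)) ` {x. D x \<noteq> 0})"
    using Lindelof[of "(\<lambda>x. ball x (r x)) ` {x. D x \<noteq> 0}"] by auto
  \<comment> \<open>Adding the empty set makes the family nonempty, so it is the range of a sequence
    even when \<open>D\<close> vanishes everywhere.\<close>
  define B where "B = from_nat_into (insert {} \<F>)"
  have rB: "range B = insert {} \<F>"
    unfolding B_def using F(2) by (intro range_from_nat_into) auto
  have B: "open (B k)" "inj_on G (B k)" for k
  proof -
    have "B k \<in> insert {} \<F>" using rB by auto
    then show "open (B k)" "inj_on G (B k)" using F(1) r by auto
  qed
  have SB: "S \<subseteq> (\<Union>k. B k)"
  proof
    fix x assume "x \<in> S"
    then have "D x \<noteq> 0" by (simp add: S_def)
    then have "x \<in> \<Union>\<F>" unfolding F(3) using r[of x] by auto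
    then show "x \<in> (\<Union>k. B k)" using rB by auto
  qed
  define C where "C k = S \<inter> disjointed B k" for k
  have [measurable]: "B k \<in> sets borel" for k using B(1) by auto
  have Cm [measurable]: "C k \<in> sets borel" for k
    unfolding C_def disjointed_def by measurable
  have CB: "C k \<subseteq> B k" "C k \<subseteq> A" for k
    using disjointed_subset[of B k] by (auto simp: C_def S_def)
  have Cdisj: "disjoint_family C"
    using disjoint_family_disjointed[of B] by (auto simp: C_def disjoint_family_on_def)
  have CU: "(\<Union>k. C k) = S"
    using SB UN_disjointed_eq[of B] by (auto simp: C_def)
  have der_within: "(G has_derivative G' x) (at x within T)" for x T
    using der by (rule has_derivative_at_withinI)
  have Cimg: "G ` C k \<in> sets lebesgue" "emeasure lebesgue (G ` C k) = (\<integral>\<^sup>+x. ennreal (D x) * indicator (C k) x \<partial>lborel)" for k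
  proof -
    have inj: "inj_on G (C k)"
      using B(2) CB(1) by (rule inj_on_subset)
    have leb: "C k \<in> sets lebesgue" by simp
    note i = int[OF Cm CB(2), of k]
    have lm: "G ` C k \<in> lmeasurable"
      using measurable_differentiable_image_eq[OF leb der_within inj] i(1) by (simp add: Dfun)
    then show "G ` C k \<in> sets lebesgue" by auto
    have "measure lebesgue (G ` C k) = integral (C k) D"
      using measure_differentiable_image_eq[OF leb der_within inj] i(1) by (simp add: Dfun)
    then show "emeasure lebesgue (G ` C k) = (\<integral>\<^sup>+x. ennreal (D x) * indicator (C k) x \<partial>lborel)"
      using lm i(2) by (simp add: emeasure_eq_measure2)
  qed
  \<comment> \<open>The measure of the image is at most the integral of the Jacobian, which is zero
    on \<open>N\<close>.\<close>
  have null: "G ` N \<in> null_sets lebesgue"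
  proof -
    have NA: "N \<subseteq> A" by (auto simp: N_def)
    note i = int[OF \<open>N \<in> sets borel\<close> NA]
    have leb: "N \<in> sets lebesgue" by simp
    have "measure lebesgue (G ` N) \<le> integral N D" "G ` N \<in> lmeasurable"
      using measure_differentiable_image[OF leb der_within] measurable_differentiable_image[OF leb der_within] i(1)
      by (simp_all add: Dfun)
    moreover have "integral N D = integral N (\<lambda>x. 0)"
      by (rule integral_cong) (simp add: N_def)
    ultimately have "measure lebesgue (G ` N) = 0" "G ` N \<in> lmeasurable"
      by (simp_all add: measure_le_0_iff)
    then show ?thesis
      by (simp add: null_setsI emeasure_eq_measure2)
  qed
  have "AE w in lebesgue. emeasure (count_space UNIV) {x \<in> A. G x = w} = (\<Sum>k. indicator (G ` C k) w)"
    using AE_not_in[OF null]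
  proof (rule AE_mp, intro AE_I2 impI)
    fix w assume w: "w \<notin> G ` N"
    have "{x \<in> A. G x = w} = (\<Union>k. {x \<in> C k. G x = w})"
      using w CU by (auto simp: S_def N_def)
    also have "emeasure (count_space UNIV) \<dots> = (\<Sum>k. emeasure (count_space UNIV) {x \<in> C k. G x = w})"
      by (rule suminf_emeasure[symmetric]) (use Cdisj in \<open>auto simp: disjoint_family_on_def\<close>)
    also have "\<dots> = (\<Sum>k. indicator (G ` C k) w)"
      by (intro suminf_cong emeasure_count_fibre inj_on_subset[OF B(2) CB(1)])
    finally show "emeasure (count_space UNIV) {x \<in> A. G x = w} = (\<Sum>k. indicator (G ` C k) w)" .
  qed
  then have "(\<integral>\<^sup>+w. emeasure (count_space UNIV) {x \<in> A. G x = w} \<partial>lebesgue) = (\<integral>\<^sup>+w. (\<Sum>k. indicator (G ` C k) w) \<partial>lebesgue)"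
    by (rule nn_integral_cong_AE)
  also have "\<dots> = (\<Sum>k. emeasure lebesgue (G ` C k))"
    using Cimg(1) by (subst nn_integral_suminf) auto
  also have "\<dots> = (\<Sum>k. emeasure (density lborel (\<lambda>x. ennreal (D x))) (C k))"
    by (simp add: Cimg(2) emeasure_density)
  also have "\<dots> = emeasure (density lborel (\<lambda>x. ennreal (D x))) S"
    unfolding CU[symmetric] by (rule suminf_emeasure) (use Cdisj Cm in \<open>auto\<close>)
  also have "\<dots> = (\<integral>\<^sup>+x. ennreal (D x) * indicator S x \<partial>lborel)"
    by (rule emeasure_density) auto
  also have "\<dots> = (\<integral>\<^sup>+x. ennreal \<bar>det (matrix (G' x))\<bar> * indicator A x \<partial>lborel)"
    by (intro nn_integral_cong) (auto simp: S_def D_def indicator_def)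
  finally show ?thesis .
qed

section \<open>The area formula for sums of two curves\<close>

text \<open>Determinants of derivatives are formed on \<open>real^2\<close>, while curves take
  values in \<open>real \<times> real\<close>; these two maps identify the planes.\<close>

definition vec2 :: "real \<times> real \<Rightarrow> real^2" where "vec2 z = vector [fst z, snd z]"
definition unvec2 :: "real^2 \<Rightarrow> real \<times> real" where "unvec2 v = (v $ 1, v $ 2)"

lemma vec2_unvec2 [simp]: "vec2 (unvec2 v) = v" "unvec2 (vec2 z) = z"
  by (simp_all add: vec2_def unvec2_def vec_eq_iff forall_2)

lemma bounded_linear_vec2: "bounded_linear vec2"
  unfolding linear_conv_bounded_linear[symmetric]
  by (rule linearI) (simp_all add: vec2_def vec_eq_iff forall_2)

lemma bounded_linear_unvec2: "bounded_linear unvec2"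
  unfolding linear_conv_bounded_linear[symmetric]
  by (rule linearI) (simp_all add: unvec2_def)

lemma unvec2_measurable [measurable]: "unvec2 \<in> borel_measurable borel"
  by (intro borel_measurable_continuous_onI linear_continuous_on bounded_linear_unvec2)

text \<open>Lebesgue measure is determined by its values on open boxes, and the identification takes
  boxes to boxes with the same sides.\<close>

lemma distr_unvec2: "distr lborel borel unvec2 = lborel"
proof (rule lborel_eqI[symmetric])
  fix l u :: "real \<times> real"
  assume lu: "\<And>b. b \<in> Basis \<Longrightarrow> l \<bullet> b \<le> u \<bullet> b"
  have "unvec2 v \<in> box l u \<longleftrightarrow> fst l < v $ 1 \<and> v $ 1 < fst u \<and> snd l < v $ 2 \<and> v $ 2 < snd u" for v
    by (auto simp: mem_box Basis_prod_def unvec2_def inner_prod_def)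
  moreover have "v \<in> box (vec2 l) (vec2 u) \<longleftrightarrow> fst l < v $ 1 \<and> v $ 1 < fst u \<and> snd l < v $ 2 \<and> v $ 2 < snd u" for v
    by (auto simp add: mem_box_cart forall_2 vec2_def)
  ultimately have "unvec2 -` box l u = box (vec2 l) (vec2 u)"
    by (simp add: set_eq_iff)
  then have "emeasure (distr lborel borel unvec2) (box l u) = emeasure lborel (box (vec2 l) (vec2 u))"
    by (subst emeasure_distr) auto
  also have "\<dots> = (\<Prod>b\<in>Basis. (u - l) \<bullet> b)"
  proof -
    have "fst l \<le> fst u" "snd l \<le> snd u"
      using lu[of "(1, 0)"] lu[of "(0, 1)"] by (auto simp: Basis_prod_def inner_prod_def)
    then have "vec2 l $ i \<le> vec2 u $ i" for i
      using exhaust_2[of i] by (auto simp: vec2_def)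
    then have "emeasure lborel (box (vec2 l) (vec2 u)) = ennreal (\<Prod>b\<in>Basis. (vec2 u - vec2 l) \<bullet> b)"
      by (intro emeasure_lborel_box) (auto simp: Basis_vec_def inner_axis)
    also have "(\<Prod>b\<in>Basis. (vec2 u - vec2 l) \<bullet> b) = (\<Prod>i\<in>UNIV. (vec2 u - vec2 l) $ i)"
      by (simp add: Basis_vec_def prod.UNION_disjoint axis_eq_axis inner_axis)
    also have "\<dots> = (\<Prod>b\<in>Basis. (u - l) \<bullet> b)"
      by (simp add: UNIV_2 vec2_def Basis_prod_def inner_prod_def)
    finally show ?thesis .
  qed
  finally show "emeasure (distr lborel borel unvec2) (box l u) = (\<Prod>b\<in>Basis. (u - l) \<bullet> b)" .
qed simp

lemma nn_integral_unvec2: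
  assumes [measurable]: "h \<in> borel_measurable borel"
  shows "(\<integral>\<^sup>+z. h z \<partial>lborel) = (\<integral>\<^sup>+v. h (unvec2 v) \<partial>lborel)"
  by (subst distr_unvec2[symmetric], subst nn_integral_distr) auto

lemma norm_vec2 [simp]: "norm (vec2 z) = norm z"
  by (simp add: norm_vec_def L2_set_def UNIV_2 vec2_def norm_prod_def)

text \<open>The Jacobian matrix of (\<phi>, \<psi>) \<mapsto> p \<phi> + q \<psi> has the columns p'
  \<phi> and q' \<psi>, so its determinant is \<open>det2\<close> of the two velocities.\<close>

lemma nn_integral_fibre_count_curves:
  fixes p q p' q' :: "real \<Rightarrow> real \<times> real"
  assumes dp: "\<And>x. (p has_vector_derivative p' x) (at x)" and dq: "\<And>x. (q has_vector_derivative q' x) (at x)"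
    and cp: "continuous_on UNIV p'" and cq: "continuous_on UNIV q'"
    and A: "A \<in> sets borel" "bounded A"
    and m: "(\<lambda>w. emeasure (count_space UNIV) {z \<in> A. p (fst z) + q (snd z) = w}) \<in> borel_measurable borel"
  shows "(\<integral>\<^sup>+w. emeasure (count_space UNIV) {z \<in> A. p (fst z) + q (snd z) = w} \<partial>lborel)
    = (\<integral>\<^sup>+z. ennreal \<bar>det2 (p' (fst z)) (q' (snd z))\<bar> * indicator A z \<partial>lborel)"
proof -
  define F where "F z = p (fst z) + q (snd z)" for z
  define F' where "F' z u = fst u *\<^sub>R p' (fst z) + snd u *\<^sub>R q' (snd z)" for z u :: "real \<times> real"
  define G where "G v = vec2 (F (unvec2 v))" for v
  define G' where "G' v u = vec2 (F' (unvec2 v) (unvec2 u))" for v u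
  define B where "B = unvec2 -` A"
  have derF: "(F has_derivative F' z) (at z)" for z
  proof -
    have "((\<lambda>z. p (fst z)) has_derivative (\<lambda>u. fst u *\<^sub>R p' (fst z))) (at z)"
      using has_derivative_compose[OF bounded_linear.has_derivative[OF bounded_linear_fst has_derivative_ident], of p] dp
      unfolding has_vector_derivative_def by fast
    moreover have "((\<lambda>z. q (snd z)) has_derivative (\<lambda>u. snd u *\<^sub>R q' (snd z))) (at z)"
      using has_derivative_compose[OF bounded_linear.has_derivative[OF bounded_linear_snd has_derivative_ident], of q] dq
      unfolding has_vector_derivative_def by fast
    ultimately show ?thesis
      unfolding F_def F'_def by (rule has_derivative_add)
  qed
  have derG: "(G has_derivative G' v) (at v)" for v
  proof -
    have "((\<lambda>v. F (unvec2 v)) has_derivative (\<lambda>u. F' (unvec2 v) (unvec2 u))) (at v)"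
      using has_derivative_compose[OF bounded_linear.has_derivative[OF bounded_linear_unvec2 has_derivative_ident] derF] .
    then show ?thesis
      unfolding G_def G'_def by (rule bounded_linear.has_derivative[OF bounded_linear_vec2])
  qed
  have detG: "det (matrix (G' v)) = det2 (p' (v $ 1)) (q' (v $ 2))" for v
    by (simp add: det_2 matrix_def G'_def F'_def vec2_def unvec2_def axis_def det2_def)
  have cc: "continuous_on UNIV (\<lambda>v::real^2. p' (v $ 1))" "continuous_on UNIV (\<lambda>v::real^2. q' (v $ 2))"
    by (rule continuous_on_compose2[OF cp] continuous_on_compose2[OF cq]; auto intro!: continuous_intros)+
  have "(\<integral>\<^sup>+w. emeasure (count_space UNIV) {z \<in> A. F z = w} \<partial>lborel)
      = (\<integral>\<^sup>+v. emeasure (count_space UNIV) {z \<in> A. F z = unvec2 v} \<partial>lborel)"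
    using m by (intro nn_integral_unvec2) (simp add: F_def)
  \<comment> \<open>The area formula is stated for the completed measure; Borel measurability of the
    fibre count allows the passage.\<close>
  also have "\<dots> = (\<integral>\<^sup>+v. emeasure (count_space UNIV) {z \<in> A. F z = unvec2 v} \<partial>lebesgue)"
    using measurable_compose[OF unvec2_measurable m] by (subst nn_integral_completion) (auto simp: F_def)
  also have "\<dots> = (\<integral>\<^sup>+v. emeasure (count_space UNIV) {x \<in> B. G x = v} \<partial>lebesgue)"
  proof (intro nn_integral_cong)
    fix v
    have "{z \<in> A. F z = unvec2 v} = unvec2 ` {x \<in> B. G x = v}"
    proof (intro equalityI subsetI)
      fix z assume "z \<in> {z \<in> A. F z = unvec2 v}"
      then have "vec2 z \<in> {x \<in> B. G x = v}" by (simp add: B_def G_def)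
      then show "z \<in> unvec2 ` {x \<in> B. G x = v}" by (intro image_eqI[of _ _ "vec2 z"]) auto
    next
      fix z assume "z \<in> unvec2 ` {x \<in> B. G x = v}"
      then show "z \<in> {z \<in> A. F z = unvec2 v}" by (auto simp: B_def G_def)
    qed
    moreover have "inj_on unvec2 {x \<in> B. G x = v}"
      by (metis inj_onI vec2_unvec2(1))
    ultimately show "emeasure (count_space UNIV) {z \<in> A. F z = unvec2 v} = emeasure (count_space UNIV) {x \<in> B. G x = v}"
      by (simp add: emeasure_count_image)
  qed
  also have "\<dots> = (\<integral>\<^sup>+x. ennreal \<bar>det (matrix (G' x))\<bar> * indicator B x \<partial>lborel)"
  proof (rule nn_integral_fibre_count[OF derG])
    fix x :: "real^2" and e :: real assume e: "e > 0"
    \<comment> \<open>\<open>H\<close> bounds the operator norm of the change of derivative, is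
      continuous and vanishes at \<open>x\<close>.\<close>
    define H where "H y = norm (p' (y $ 1) - p' (x $ 1)) + norm (q' (y $ 2) - q' (x $ 2))" for y :: "real^2"
    have "continuous_on UNIV H"
      unfolding H_def by (intro continuous_intros cc)
    then obtain d where d: "d > 0" "\<And>y. dist y x < d \<Longrightarrow> dist (H y) (H x) < e"
      using e unfolding continuous_on_iff by (metis UNIV_I)
    have "onorm (\<lambda>v. G' y v - G' x v) < e" if "dist x y < d" for y
    proof -
      have "norm (G' y v - G' x v) \<le> H y * norm v" for v
      proof -
        have "G' y v - G' x v = vec2 (F' (unvec2 y) (unvec2 v) - F' (unvec2 x) (unvec2 v))"
          by (simp add: G'_def linear_diff[OF bounded_linear.linear[OF bounded_linear_vec2]])
        also have "norm \<dots> = norm ((v $ 1) *\<^sub>R (p' (y $ 1) - p' (x $ 1)) + (v $ 2) *\<^sub>R (q' (y $ 2) - q' (x $ 2)))"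
          by (simp add: F'_def unvec2_def algebra_simps)
        also have "\<dots> \<le> \<bar>v $ 1\<bar> * norm (p' (y $ 1) - p' (x $ 1)) + \<bar>v $ 2\<bar> * norm (q' (y $ 2) - q' (x $ 2))"
          by (rule order_trans[OF norm_triangle_ineq]) simp
        also have "\<dots> \<le> norm v * norm (p' (y $ 1) - p' (x $ 1)) + norm v * norm (q' (y $ 2) - q' (x $ 2))"
          by (intro add_mono mult_right_mono component_le_norm_cart) auto
        finally show ?thesis by (simp add: H_def algebra_simps)
      qed
      then have "onorm (\<lambda>v. G' y v - G' x v) \<le> H y"
        by (rule onorm_le)
      also have "H y < e"
        using d(2)[of y] that by (simp add: H_def dist_real_def dist_commute)
      finally show ?thesis .
    qed
    then show "\<exists>d>0. \<forall>y. dist x y < d \<longrightarrow> onorm (\<lambda>v. G' y v - G' x v) < e"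
      using d(1) by blast
  next
    have "continuous_on UNIV (\<lambda>v::real^2. fst (p' (v $ 1)) * snd (q' (v $ 2)) - snd (p' (v $ 1)) * fst (q' (v $ 2)))"
      by (intro continuous_on_diff continuous_on_mult continuous_on_fst continuous_on_snd cc)
    then show "continuous_on UNIV (\<lambda>x. det (matrix (G' x)))"
      by (simp add: detG det2_def)
    show "B \<in> sets borel"
      unfolding B_def using measurable_sets[OF unvec2_measurable A(1)] by simp
    have "B = vec2 ` A"
      by (auto simp: B_def image_iff) (metis vec2_unvec2(1))
    then show "bounded B"
      using bounded_linear_image[OF A(2) bounded_linear_vec2] by simp
  qed
  also have "\<dots> = (\<integral>\<^sup>+z. ennreal \<bar>det2 (p' (fst z)) (q' (snd z))\<bar> * indicator A z \<partial>lborel)"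
  proof (subst nn_integral_unvec2)
    have "continuous_on UNIV (\<lambda>z. det2 (p' (fst z)) (q' (snd z)))"
      unfolding det2_def by (intro continuous_intros continuous_on_compose2[OF cp] continuous_on_compose2[OF cq]) auto
    then have [measurable]: "(\<lambda>z. det2 (p' (fst z)) (q' (snd z))) \<in> borel_measurable borel"
      by (rule borel_measurable_continuous_onI)
    note [measurable] = A(1)
    show "(\<lambda>z. ennreal \<bar>det2 (p' (fst z)) (q' (snd z))\<bar> * indicator A z) \<in> borel_measurable borel"
      by measurable
  qed (simp add: detG B_def unvec2_def indicator_def)
  finally show ?thesis
    by (simp add: F_def)
qed

section \<open>Distribution of value and derivative\<close>

text \<open>Zero is excluded because the constant coefficient is treated apart: it is the variable
  of the area formula for the first curve and it does not affect the derivative.\<close>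

definition freqs :: "nat \<Rightarrow> int set" where
  "freqs N = {- int N..int N} - {0}"

definition trig_basis_deriv :: "int \<Rightarrow> real \<Rightarrow> real" where
  "trig_basis_deriv j \<phi> =
     (if j = 0 then 0 else if 0 < j then - of_int j * sin (of_int j * \<phi>) else of_int (- j) * cos (of_int (- j) * \<phi>))"

definition osc :: "nat \<Rightarrow> real \<Rightarrow> (int \<Rightarrow> real \<times> real) \<Rightarrow> real \<times> real" where
  "osc N \<phi> c = (\<Sum>j\<in>freqs N. trig_basis j \<phi> *\<^sub>R c j)"

definition osc_deriv :: "nat \<Rightarrow> real \<Rightarrow> (int \<Rightarrow> real \<times> real) \<Rightarrow> real \<times> real" where
  "osc_deriv N \<phi> c = (\<Sum>j\<in>freqs N. trig_basis_deriv j \<phi> *\<^sub>R c j)"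

definition sqn :: "int set \<Rightarrow> (int \<Rightarrow> real \<times> real) \<Rightarrow> real" where
  "sqn I c = (\<Sum>j\<in>I. (norm (c j))\<^sup>2)"

abbreviation coeffs :: "int set \<Rightarrow> (int \<Rightarrow> real \<times> real) measure" where
  "coeffs I \<equiv> \<Pi>\<^sub>M j\<in>I. lborel"

interpretation coeffs: product_sigma_finite "\<lambda>_::int. lborel :: (real \<times> real) measure"
  by standard

lemma sigma_finite_coeffs: "finite I \<Longrightarrow> sigma_finite_measure (coeffs I)"
  by (rule coeffs.sigma_finite)

lemma freqs_Suc: "freqs (Suc N) = insert (int (Suc N)) (insert (- int (Suc N)) (freqs N))"
  by (auto simp: freqs_def)

lemma freqs_notin [simp]: "int (Suc N) \<notin> freqs N" "- int (Suc N) \<notin> freqs N" "finite (freqs N)"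
  by (auto simp: freqs_def)

lemma osc_measurable [measurable]:
  "freqs N \<subseteq> I \<Longrightarrow> osc N \<phi> \<in> borel_measurable (coeffs I)"
  "freqs N \<subseteq> I \<Longrightarrow> osc_deriv N \<phi> \<in> borel_measurable (coeffs I)"
  unfolding osc_def[abs_def] osc_deriv_def[abs_def] by (auto intro!: borel_measurable_sum borel_measurable_scaleR)

lemma sqn_measurable [measurable]: "J \<subseteq> I \<Longrightarrow> sqn J \<in> borel_measurable (coeffs I)"
  unfolding sqn_def[abs_def] by (auto intro!: borel_measurable_sum borel_measurable_power borel_measurable_norm)

lemma borel_measurable_nn_integral_coeffs:
  assumes "case_prod f \<in> borel_measurable (M \<Otimes>\<^sub>M coeffs I)" "finite I"
  shows "(\<lambda>x. \<integral>\<^sup>+c. f x c \<partial>coeffs I) \<in> borel_measurable M"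
  using sigma_finite_measure.borel_measurable_nn_integral[OF sigma_finite_coeffs] assms by blast

lemma sum_insert2_upd:
  assumes "finite A" "p \<notin> A" "q \<notin> A" "p \<noteq> q"
  shows "(\<Sum>j\<in>insert p (insert q A). G j ((c(q := b, p := a)) j)) = G p a + G q b + (\<Sum>j\<in>A. G j (c j))"
proof -
  have "(\<Sum>j\<in>A. G j ((c(q := b, p := a)) j)) = (\<Sum>j\<in>A. G j (c j))"
    using assms by (intro sum.cong) auto
  then show ?thesis
    using assms by (simp add: add.assoc)
qed

text \<open>The coefficients of frequency \<open>N + 1\<close> are rotated so that one of them contributes to the value
  and the other one to the derivative.\<close>

lemma nn_integral_coeffs_Suc:
  fixes h :: "(real \<times> real) \<times> (real \<times> real) \<times> real \<Rightarrow> ennreal"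
  assumes h [measurable]: "h \<in> borel_measurable borel"
  shows "(\<integral>\<^sup>+c. h (osc (Suc N) \<phi> c, osc_deriv (Suc N) \<phi> c, sqn (freqs (Suc N)) c) \<partial>coeffs (freqs (Suc N)))
    = (\<integral>\<^sup>+x. \<integral>\<^sup>+y. \<integral>\<^sup>+c. h (osc N \<phi> c + x, osc_deriv N \<phi> c + real (Suc N) *\<^sub>R y, sqn (freqs N) c + (norm x)\<^sup>2 + (norm y)\<^sup>2)
        \<partial>coeffs (freqs N) \<partial>lborel \<partial>lborel)"
proof -
  define m where "m = Suc N"
  define C S where "C = cos (real m * \<phi>)" and "S = sin (real m * \<phi>)"
  define k where "k = (\<lambda>z. \<integral>\<^sup>+c. h (osc N \<phi> c + fst z, osc_deriv N \<phi> c + real m *\<^sub>R snd z,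
      sqn (freqs N) c + (norm (fst z))\<^sup>2 + (norm (snd z))\<^sup>2) \<partial>coeffs (freqs N))"
  have k: "k \<in> borel_measurable borel"
  proof -
    have [measurable]: "osc N \<phi> \<in> borel_measurable (coeffs (freqs N))" "osc_deriv N \<phi> \<in> borel_measurable (coeffs (freqs N))"
      "sqn (freqs N) \<in> borel_measurable (coeffs (freqs N))"
      by (simp_all add: osc_measurable sqn_measurable)
    show ?thesis
      unfolding k_def by (intro borel_measurable_nn_integral_coeffs) (unfold case_prod_beta, measurable)
  qed
  let ?h = "\<lambda>c. h (osc m \<phi> c, osc_deriv m \<phi> c, sqn (freqs m) c)"
  have m0: "int m \<noteq> 0" "int m \<noteq> - int m" by (auto simp: m_def)
  have fm: "freqs m = insert (int m) (insert (- int m) (freqs N))"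
    unfolding m_def by (rule freqs_Suc)
  have nin: "int m \<notin> freqs N" "- int m \<notin> freqs N" "int m \<notin> insert (- int m) (freqs N)"
    using m0 by (simp_all add: m_def del: of_nat_Suc)
  have "(\<integral>\<^sup>+c. ?h c \<partial>coeffs (freqs m)) = (\<integral>\<^sup>+a. \<integral>\<^sup>+c. ?h (c(int m := a)) \<partial>coeffs (insert (- int m) (freqs N)) \<partial>lborel)"
    unfolding fm by (rule coeffs.product_nn_integral_insert_rev) (use nin in \<open>simp_all add: fm[symmetric]\<close>)
  also have "\<dots> = (\<integral>\<^sup>+a. \<integral>\<^sup>+b. \<integral>\<^sup>+c. ?h (c(- int m := b, int m := a)) \<partial>coeffs (freqs N) \<partial>lborel \<partial>lborel)"
  proof (intro nn_integral_cong coeffs.product_nn_integral_insert_rev)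
    fix a :: "real \<times> real"
    have "(\<lambda>c. c(int m := a)) \<in> measurable (coeffs (insert (- int m) (freqs N))) (coeffs (freqs m))"
      unfolding fm by (rule measurable_fun_upd[where J = "insert (- int m) (freqs N)"]) auto
    moreover have "?h \<in> borel_measurable (coeffs (freqs m))" by simp
    ultimately show "(\<lambda>c. ?h (c(int m := a))) \<in> borel_measurable (coeffs (insert (- int m) (freqs N)))"
      by (rule measurable_compose)
  qed (use nin in auto)
  \<comment> \<open>With x = C a + S b and y = C b - S a the frequency contributes x to the value, m
    y to the derivative and |x|^2 + |y|^2 to the squared norm. The parameter enters only through
    this rotation, so rotation invariance removes it.\<close>
  also have "\<dots> = (\<integral>\<^sup>+a. \<integral>\<^sup>+b. k (C *\<^sub>R a + S *\<^sub>R b, C *\<^sub>R b - S *\<^sub>R a) \<partial>lborel \<partial>lborel)"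
  proof (intro nn_integral_cong)
    fix a b :: "real \<times> real"
    note sum = sum_insert2_upd[OF freqs_notin(3) nin(1,2) m0(2), folded fm]
    have 1: "osc m \<phi> (c(- int m := b, int m := a)) = osc N \<phi> c + (C *\<^sub>R a + S *\<^sub>R b)" for c
      unfolding osc_def sum[where G = "\<lambda>j x. trig_basis j \<phi> *\<^sub>R x"] using m0 by (simp add: trig_basis_def C_def S_def m_def algebra_simps)
    have 2: "osc_deriv m \<phi> (c(- int m := b, int m := a)) = osc_deriv N \<phi> c + real m *\<^sub>R (C *\<^sub>R b - S *\<^sub>R a)" for c
      unfolding osc_deriv_def sum[where G = "\<lambda>j x. trig_basis_deriv j \<phi> *\<^sub>R x"] using m0 by (simp add: trig_basis_deriv_def C_def S_def m_def algebra_simps)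
    have "(norm (C *\<^sub>R a + S *\<^sub>R b))\<^sup>2 + (norm (C *\<^sub>R b - S *\<^sub>R a))\<^sup>2 = (C\<^sup>2 + S\<^sup>2) * ((norm a)\<^sup>2 + (norm b)\<^sup>2)"
      unfolding power2_norm_eq_inner by (simp add: inner_simps inner_commute power2_eq_square algebra_simps)
    then have "(norm (C *\<^sub>R a + S *\<^sub>R b))\<^sup>2 + (norm (C *\<^sub>R b - S *\<^sub>R a))\<^sup>2 = (norm a)\<^sup>2 + (norm b)\<^sup>2"
      by (simp add: C_def S_def)
    then have 3: "sqn (freqs m) (c(- int m := b, int m := a))
        = sqn (freqs N) c + (norm (C *\<^sub>R a + S *\<^sub>R b))\<^sup>2 + (norm (C *\<^sub>R b - S *\<^sub>R a))\<^sup>2" for c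
      unfolding sqn_def sum[where G = "\<lambda>j x. (norm x)\<^sup>2"] by simp
    show "(\<integral>\<^sup>+c. ?h (c(- int m := b, int m := a)) \<partial>coeffs (freqs N)) = k (C *\<^sub>R a + S *\<^sub>R b, C *\<^sub>R b - S *\<^sub>R a)"
      unfolding 1 2 3 k_def by simp
  qed
  also have "\<dots> = (\<integral>\<^sup>+x. \<integral>\<^sup>+y. k (x, y) \<partial>lborel \<partial>lborel)"
    by (rule nn_integral_rotation[OF k]) (simp add: C_def S_def)
  finally show ?thesis
    by (simp add: k_def m_def)
qed

text \<open>The squared norm of the functional sending the coefficients to one coordinate of the
  derivative: frequency j contributes (j sin)^2 + (j cos)^2.\<close>

definition sumsq :: "nat \<Rightarrow> real" where "sumsq N = (\<Sum>j=1..N. (real j)\<^sup>2)"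

lemma sumsq_Suc: "sumsq (Suc N) = sumsq N + (real (Suc N))\<^sup>2"
  by (simp add: sumsq_def)

lemma sumsq_pos: "sumsq (Suc N) > 0"
  by (simp add: sumsq_Suc sumsq_def add_nonneg_pos sum_nonneg)

text \<open>The recursion step for one new frequency m: completing the square in \<open>y\<close>
  turns b into b + m^2, completing it in \<open>x\<close> turns a into a + 1, and each raises the
  exponent by one.\<close>

lemma nn_integral_pos_power_two_squares:
  fixes u v :: "real \<times> real"
  assumes "a > 0" "b > 0"
  shows "(\<integral>\<^sup>+x. \<integral>\<^sup>+y. ennreal (pos_power k (t - (norm x)\<^sup>2 - (norm y)\<^sup>2 - (norm (u - x))\<^sup>2 / a - (norm (v - m *\<^sub>R y))\<^sup>2 / b)) \<partial>lborel \<partial>lborel)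
    = ennreal (pi\<^sup>2 * a * b / ((a + 1) * (b + m\<^sup>2) * Suc k * Suc (Suc k)) *
        pos_power (Suc (Suc k)) (t - (norm u)\<^sup>2 / (a + 1) - (norm v)\<^sup>2 / (b + m\<^sup>2)))"
proof -
  have bm: "b + m\<^sup>2 > 0" "1 + 1 / b * m\<^sup>2 = (b + m\<^sup>2) / b" "1 + 1 / a * 1\<^sup>2 = (a + 1) / a"
    using assms by (simp_all add: add_pos_nonneg field_simps)
  have y: "(\<integral>\<^sup>+y. ennreal (pos_power k (t - (norm x)\<^sup>2 - (norm y)\<^sup>2 - (norm (u - x))\<^sup>2 / a - (norm (v - m *\<^sub>R y))\<^sup>2 / b)) \<partial>lborel)
     = ennreal (pi * b / ((b + m\<^sup>2) * Suc k)) *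
       ennreal (pos_power (Suc k) ((t - (norm v)\<^sup>2 / (b + m\<^sup>2)) - 1 * (norm x)\<^sup>2 - 1 / a * (norm (u - 1 *\<^sub>R x))\<^sup>2))" for x
  proof -
    have "(\<integral>\<^sup>+y. ennreal (pos_power k (t - (norm x)\<^sup>2 - (norm y)\<^sup>2 - (norm (u - x))\<^sup>2 / a - (norm (v - m *\<^sub>R y))\<^sup>2 / b)) \<partial>lborel)
      = (\<integral>\<^sup>+y. ennreal (pos_power k ((t - (norm x)\<^sup>2 - (norm (u - x))\<^sup>2 / a) - 1 * (norm y)\<^sup>2 - 1 / b * (norm (v - m *\<^sub>R y))\<^sup>2)) \<partial>lborel)"
      by (simp add: algebra_simps)
    also have "\<dots> = ennreal (pi * b / ((b + m\<^sup>2) * Suc k) *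
       pos_power (Suc k) ((t - (norm v)\<^sup>2 / (b + m\<^sup>2)) - 1 * (norm x)\<^sup>2 - 1 / a * (norm (u - 1 *\<^sub>R x))\<^sup>2))"
      using assms bm by (subst nn_integral_pos_power_square) (simp_all add: algebra_simps)
    moreover have "0 \<le> pi * b / ((b + m\<^sup>2) * Suc k)"
      using assms bm by simp
    ultimately show ?thesis
      by (simp only: ennreal_mult')
  qed
  have "(\<integral>\<^sup>+x. ennreal (pos_power (Suc k) ((t - (norm v)\<^sup>2 / (b + m\<^sup>2)) - 1 * (norm x)\<^sup>2 - 1 / a * (norm (u - 1 *\<^sub>R x))\<^sup>2)) \<partial>lborel)
    = ennreal (pi * a / ((a + 1) * Suc (Suc k)) * pos_power (Suc (Suc k)) (t - (norm u)\<^sup>2 / (a + 1) - (norm v)\<^sup>2 / (b + m\<^sup>2)))"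
  proof (subst nn_integral_pos_power_square)
    have "pi / ((a + 1) / a * real (Suc (Suc k))) = pi * a / ((a + 1) * Suc (Suc k))" "1 * (1 / a) / ((a + 1) / a) = 1 / (a + 1)"
      using assms by simp_all
    then show "ennreal (pi / ((1 + 1 / a * 1\<^sup>2) * real (Suc (Suc k))) *
        pos_power (Suc (Suc k)) (t - (norm v)\<^sup>2 / (b + m\<^sup>2) - 1 * (1 / a) / (1 + 1 / a * 1\<^sup>2) * (norm u)\<^sup>2))
      = ennreal (pi * a / ((a + 1) * Suc (Suc k)) * pos_power (Suc (Suc k)) (t - (norm u)\<^sup>2 / (a + 1) - (norm v)\<^sup>2 / (b + m\<^sup>2)))"
      by (simp only: bm) (simp add: diff_diff_eq add.commute)
  qed (use assms in simp_all)
  then show ?thesis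
    unfolding y using assms bm(1)
    by (subst nn_integral_cmult) (simp, simp only: ennreal_mult'[symmetric] divide_nonneg_nonneg mult_nonneg_nonneg pi_ge_zero less_imp_le of_nat_0_le_iff,
      simp add: power2_eq_square ac_simps del: of_nat_Suc)
qed

lemma nn_integral_swap_pairs:
  fixes g :: "('a::euclidean_space \<times> 'a) \<times> ('b::euclidean_space \<times> 'b) \<Rightarrow> ennreal"
  assumes g [measurable]: "g \<in> borel_measurable borel"
  shows "(\<integral>\<^sup>+x. \<integral>\<^sup>+y. \<integral>\<^sup>+u. \<integral>\<^sup>+v. g ((x, y), (u, v)) \<partial>lborel \<partial>lborel \<partial>lborel \<partial>lborel)
    = (\<integral>\<^sup>+u. \<integral>\<^sup>+v. \<integral>\<^sup>+x. \<integral>\<^sup>+y. g ((x, y), (u, v)) \<partial>lborel \<partial>lborel \<partial>lborel \<partial>lborel)"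
proof -
  have "(\<integral>\<^sup>+x. \<integral>\<^sup>+y. \<integral>\<^sup>+u. \<integral>\<^sup>+v. g ((x, y), (u, v)) \<partial>lborel \<partial>lborel \<partial>lborel \<partial>lborel)
      = (\<integral>\<^sup>+x. \<integral>\<^sup>+y. \<integral>\<^sup>+w. g ((x, y), w) \<partial>lborel \<partial>lborel \<partial>lborel)"
    by (intro nn_integral_cong nn_integral_lborel_pair[symmetric]) simp
  also have "\<dots> = (\<integral>\<^sup>+z. \<integral>\<^sup>+w. g (z, w) \<partial>lborel \<partial>lborel)"
    by (rule nn_integral_lborel_pair[symmetric]) simp
  also have "\<dots> = (\<integral>\<^sup>+w. \<integral>\<^sup>+z. g (z, w) \<partial>lborel \<partial>lborel)"
    by (rule nn_integral_swap[OF g])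
  also have "\<dots> = (\<integral>\<^sup>+u. \<integral>\<^sup>+v. \<integral>\<^sup>+z. g (z, (u, v)) \<partial>lborel \<partial>lborel \<partial>lborel)"
    by (rule nn_integral_lborel_pair) simp
  also have "\<dots> = (\<integral>\<^sup>+u. \<integral>\<^sup>+v. \<integral>\<^sup>+x. \<integral>\<^sup>+y. g ((x, y), (u, v)) \<partial>lborel \<partial>lborel \<partial>lborel \<partial>lborel)"
    by (intro nn_integral_cong nn_integral_lborel_pair) simp
  finally show ?thesis .
qed

text \<open>With N = k + 1, the coefficients with given value u and derivative v form a translate of
  a space of dimension 4 N - 4 = 4 k, on which the norm bound cuts out a ball. Its volume is pi^(2k)
  / (2k)! times the power 2 k of the remaining squared radius; the factor
  \<open>Suc k * sumsq (Suc k)\<close> is the Jacobian of the projection. The bound \<open>T\<close>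
  may depend on (u, v): for a curve forced through a point, the eliminated constant coefficient uses
  up squared norm that depends on u.\<close>

lemma nn_integral_osc:
  fixes H :: "(real \<times> real) \<times> (real \<times> real) \<Rightarrow> ennreal" and T :: "(real \<times> real) \<times> (real \<times> real) \<Rightarrow> real"
  assumes "H \<in> borel_measurable borel" "T \<in> borel_measurable borel"
  shows "(\<integral>\<^sup>+c. H (osc (Suc k) \<phi> c, osc_deriv (Suc k) \<phi> c) *
        indicator {..T (osc (Suc k) \<phi> c, osc_deriv (Suc k) \<phi> c)} (sqn (freqs (Suc k)) c) \<partial>coeffs (freqs (Suc k)))
    = (\<integral>\<^sup>+u. \<integral>\<^sup>+v. H (u, v) * ennreal (pi ^ (2 * k) / (fact (2 * k) * real (Suc k) * sumsq (Suc k)) *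
        pos_power (2 * k) (T (u, v) - (norm u)\<^sup>2 / Suc k - (norm v)\<^sup>2 / sumsq (Suc k))) \<partial>lborel \<partial>lborel)"
  using assms
proof (induction k arbitrary: H T)
  case (0 H T)
  note [measurable] = 0
  have "(\<integral>\<^sup>+c. H (osc (Suc 0) \<phi> c, osc_deriv (Suc 0) \<phi> c) *
        indicator {..T (osc (Suc 0) \<phi> c, osc_deriv (Suc 0) \<phi> c)} (sqn (freqs (Suc 0)) c) \<partial>coeffs (freqs (Suc 0)))
    = (\<integral>\<^sup>+x. \<integral>\<^sup>+y. \<integral>\<^sup>+c. H (osc 0 \<phi> c + x, osc_deriv 0 \<phi> c + real (Suc 0) *\<^sub>R y) *
        indicator {..T (osc 0 \<phi> c + x, osc_deriv 0 \<phi> c + real (Suc 0) *\<^sub>R y)} (sqn (freqs 0) c + (norm x)\<^sup>2 + (norm y)\<^sup>2)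
          \<partial>coeffs (freqs 0) \<partial>lborel \<partial>lborel)"
    using nn_integral_coeffs_Suc[of "\<lambda>z. H (fst z, fst (snd z)) * indicator {..T (fst z, fst (snd z))} (snd (snd z))" 0 \<phi>]
    by (simp add: indicator_def)
  \<comment> \<open>For frequency 1 nothing is left over besides the value and the derivative, so
    the density is an indicator.\<close>
  also have "\<dots> = (\<integral>\<^sup>+u. \<integral>\<^sup>+v. H (u, v) * ennreal (pi ^ (2 * 0) / (fact (2 * 0) * real (Suc 0) * sumsq (Suc 0)) *
        pos_power (2 * 0) (T (u, v) - (norm u)\<^sup>2 / Suc 0 - (norm v)\<^sup>2 / sumsq (Suc 0))) \<partial>lborel \<partial>lborel)"
    by (intro nn_integral_cong)
       (simp add: osc_def osc_deriv_def sqn_def freqs_def PiM_empty nn_integral_count_space_finite sumsq_def pos_power_def indicator_def algebra_simps)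
  finally show ?case .
next
  case (Suc k H T)
  note [measurable] = Suc.prems
  define a b m where "a = real (Suc k)" and "b = sumsq (Suc k)" and "m = real (Suc (Suc k))"
  define K where "K = pi ^ (2 * k) / (fact (2 * k) * a * b)"
  have pos: "a > 0" "b > 0" "K \<ge> 0"
    by (simp_all add: a_def b_def K_def sumsq_pos less_imp_le)
  define N where "N = Suc k"
  have "(\<integral>\<^sup>+c. H (osc (Suc N) \<phi> c, osc_deriv (Suc N) \<phi> c) *
        indicator {..T (osc (Suc N) \<phi> c, osc_deriv (Suc N) \<phi> c)} (sqn (freqs (Suc N)) c) \<partial>coeffs (freqs (Suc N)))
    = (\<integral>\<^sup>+x. \<integral>\<^sup>+y. \<integral>\<^sup>+c. H (osc N \<phi> c + x, osc_deriv N \<phi> c + m *\<^sub>R y) *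
        indicator {..T (osc N \<phi> c + x, osc_deriv N \<phi> c + m *\<^sub>R y) - (norm x)\<^sup>2 - (norm y)\<^sup>2} (sqn (freqs N) c)
          \<partial>coeffs (freqs N) \<partial>lborel \<partial>lborel)"
    using nn_integral_coeffs_Suc[of "\<lambda>z. H (fst z, fst (snd z)) * indicator {..T (fst z, fst (snd z))} (snd (snd z))" N \<phi>]
    by (simp add: indicator_def m_def N_def algebra_simps)
  also have "\<dots> = (\<integral>\<^sup>+x. \<integral>\<^sup>+y. \<integral>\<^sup>+u. \<integral>\<^sup>+v. H (u + x, v + m *\<^sub>R y) *
      ennreal (K * pos_power (2 * k) (T (u + x, v + m *\<^sub>R y) - (norm x)\<^sup>2 - (norm y)\<^sup>2 - (norm u)\<^sup>2 / a - (norm v)\<^sup>2 / b))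
       \<partial>lborel \<partial>lborel \<partial>lborel \<partial>lborel)"
  proof (intro nn_integral_cong)
    fix x y :: "real \<times> real"
    show "(\<integral>\<^sup>+c. H (osc N \<phi> c + x, osc_deriv N \<phi> c + m *\<^sub>R y) *
        indicator {..T (osc N \<phi> c + x, osc_deriv N \<phi> c + m *\<^sub>R y) - (norm x)\<^sup>2 - (norm y)\<^sup>2} (sqn (freqs N) c) \<partial>coeffs (freqs N))
      = (\<integral>\<^sup>+u. \<integral>\<^sup>+v. H (u + x, v + m *\<^sub>R y) *
      ennreal (K * pos_power (2 * k) (T (u + x, v + m *\<^sub>R y) - (norm x)\<^sup>2 - (norm y)\<^sup>2 - (norm u)\<^sup>2 / a - (norm v)\<^sup>2 / b)) \<partial>lborel \<partial>lborel)"
      using Suc.IH[of "\<lambda>z. H (fst z + x, snd z + m *\<^sub>R y)" "\<lambda>z. T (fst z + x, snd z + m *\<^sub>R y) - (norm x)\<^sup>2 - (norm y)\<^sup>2"]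
      by (simp add: N_def K_def a_def b_def del: of_nat_Suc)
  qed
  \<comment> \<open>Translating u and v makes the arguments of \<open>H\<close> and \<open>T\<close>
    independent of the new pair (x, y), which can then be integrated innermost.\<close>
  also have "\<dots> = (\<integral>\<^sup>+x. \<integral>\<^sup>+y. \<integral>\<^sup>+u. \<integral>\<^sup>+v. H (u, v) *
      ennreal (K * pos_power (2 * k) (T (u, v) - (norm x)\<^sup>2 - (norm y)\<^sup>2 - (norm (u - x))\<^sup>2 / a - (norm (v - m *\<^sub>R y))\<^sup>2 / b))
       \<partial>lborel \<partial>lborel \<partial>lborel \<partial>lborel)"
    (is "_ = (\<integral>\<^sup>+x. \<integral>\<^sup>+y. \<integral>\<^sup>+u. \<integral>\<^sup>+v. ?g x y u v \<partial>lborel \<partial>lborel \<partial>lborel \<partial>lborel)")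
  proof (rule nn_integral_cong, rule nn_integral_cong)
    fix x y :: "real \<times> real"
    have "(\<integral>\<^sup>+u. \<integral>\<^sup>+v. ?g x y u v \<partial>lborel \<partial>lborel) = (\<integral>\<^sup>+u. \<integral>\<^sup>+v. ?g x y (u + x) v \<partial>lborel \<partial>lborel)"
      by (rule nn_integral_shift[symmetric]) simp
    also have "\<dots> = (\<integral>\<^sup>+u. \<integral>\<^sup>+v. ?g x y (u + x) (v + m *\<^sub>R y) \<partial>lborel \<partial>lborel)"
      by (intro nn_integral_cong nn_integral_shift[symmetric]) simp
    finally show "(\<integral>\<^sup>+u. \<integral>\<^sup>+v. H (u + x, v + m *\<^sub>R y) *
      ennreal (K * pos_power (2 * k) (T (u + x, v + m *\<^sub>R y) - (norm x)\<^sup>2 - (norm y)\<^sup>2 - (norm u)\<^sup>2 / a - (norm v)\<^sup>2 / b)) \<partial>lborel \<partial>lborel)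
      = (\<integral>\<^sup>+u. \<integral>\<^sup>+v. ?g x y u v \<partial>lborel \<partial>lborel)"
      by simp
  qed
  also have "\<dots> = (\<integral>\<^sup>+u. \<integral>\<^sup>+v. \<integral>\<^sup>+x. \<integral>\<^sup>+y. ?g x y u v \<partial>lborel \<partial>lborel \<partial>lborel \<partial>lborel)"
    using nn_integral_swap_pairs[of "\<lambda>z. ?g (fst (fst z)) (snd (fst z)) (fst (snd z)) (snd (snd z))"] by simp
  also have "\<dots> = (\<integral>\<^sup>+u. \<integral>\<^sup>+v. H (u, v) * ennreal (pi ^ (2 * Suc k) / (fact (2 * Suc k) * m * sumsq (Suc (Suc k))) *
        pos_power (2 * Suc k) (T (u, v) - (norm u)\<^sup>2 / m - (norm v)\<^sup>2 / sumsq (Suc (Suc k)))) \<partial>lborel \<partial>lborel)"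
  proof (intro nn_integral_cong)
    fix u v :: "real \<times> real"
    have am: "a + 1 = m" "b + m\<^sup>2 = sumsq (Suc (Suc k))"
      by (simp_all add: a_def b_def m_def sumsq_Suc)
    have "(\<integral>\<^sup>+x. \<integral>\<^sup>+y. ?g x y u v \<partial>lborel \<partial>lborel) = H (u, v) * (ennreal K * (\<integral>\<^sup>+x. \<integral>\<^sup>+y.
        ennreal (pos_power (2 * k) (T (u, v) - (norm x)\<^sup>2 - (norm y)\<^sup>2 - (norm (u - x))\<^sup>2 / a - (norm (v - m *\<^sub>R y))\<^sup>2 / b)) \<partial>lborel \<partial>lborel))"
      using pos by (simp add: ennreal_mult' nn_integral_cmult)
    also have "\<dots> = H (u, v) * (ennreal (K * (pi\<^sup>2 * a * b / (m * sumsq (Suc (Suc k)) * Suc (2 * k) * Suc (Suc (2 * k))) *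
        pos_power (Suc (Suc (2 * k))) (T (u, v) - (norm u)\<^sup>2 / m - (norm v)\<^sup>2 / sumsq (Suc (Suc k))))))"
      using pos by (simp only: nn_integral_pos_power_two_squares am ennreal_mult')
    also have "K * (pi\<^sup>2 * a * b / (m * sumsq (Suc (Suc k)) * Suc (2 * k) * Suc (Suc (2 * k))) *
        pos_power (Suc (Suc (2 * k))) (T (u, v) - (norm u)\<^sup>2 / m - (norm v)\<^sup>2 / sumsq (Suc (Suc k))))
      = pi ^ (2 * Suc k) / (fact (2 * Suc k) * m * sumsq (Suc (Suc k))) *
        pos_power (2 * Suc k) (T (u, v) - (norm u)\<^sup>2 / m - (norm v)\<^sup>2 / sumsq (Suc (Suc k)))"
    proof -
      have "K * (pi\<^sup>2 * a * b / (m * sumsq (Suc (Suc k)) * Suc (2 * k) * Suc (Suc (2 * k))))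
        = pi ^ (2 * Suc k) / (fact (2 * Suc k) * m * sumsq (Suc (Suc k)))"
      proof -
        have "fact (2 * Suc k) = real (Suc (Suc (2 * k))) * (real (Suc (2 * k)) * fact (2 * k))"
          by (simp only: mult_Suc_right add_2_eq_Suc fact_Suc of_nat_mult)
        moreover have "pi ^ (2 * Suc k) = pi ^ (2 * k) * pi\<^sup>2"
          by (simp add: power2_eq_square)
        ultimately show ?thesis
          using pos unfolding K_def by (simp only:) (simp add: divide_simps del: of_nat_Suc)
      qed
      note e = this
      show ?thesis
        by (subst mult.assoc[symmetric], subst e) simp
    qed
    finally show "(\<integral>\<^sup>+x. \<integral>\<^sup>+y. ?g x y u v \<partial>lborel \<partial>lborel) = H (u, v) * ennreal (pi ^ (2 * Suc k) / (fact (2 * Suc k) * m * sumsq (Suc (Suc k))) *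
        pos_power (2 * Suc k) (T (u, v) - (norm u)\<^sup>2 / m - (norm v)\<^sup>2 / sumsq (Suc (Suc k))))" .
  qed
  finally show ?case
    by (simp only: N_def m_def)
qed

section \<open>Measurability of the number of intersections\<close>

text \<open>A nonnegative continuous function on a compact set has a zero iff it takes arbitrarily
  small values on a countable dense subset: density gives one direction, attainment of the minimum
  the other. The latter condition involves only countably many measurable sets.\<close>

lemma sets_has_zero_compact:
  fixes D :: "'a \<Rightarrow> 'b::euclidean_space \<Rightarrow> real"
  assumes K: "compact K" and cont: "\<And>c. c \<in> space M \<Longrightarrow> continuous_on K (D c)"
    and D: "\<And>c z. 0 \<le> D c z" and [measurable]: "\<And>z. (\<lambda>c. D c z) \<in> borel_measurable M"
  shows "{c \<in> space M. \<exists>z\<in>K. D c z = 0} \<in> sets M"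
proof -
  obtain T where T: "countable T" "T \<subseteq> K" "K \<subseteq> closure T"
    using separable by blast
  have "(\<exists>z\<in>K. D c z = 0) \<longleftrightarrow> (\<forall>n. \<exists>t\<in>T. D c t < inverse (real (Suc n)))" if c: "c \<in> space M" for c
  proof
    assume "\<exists>z\<in>K. D c z = 0"
    then obtain z where z: "z \<in> K" "D c z = 0" by blast
    show "\<forall>n. \<exists>t\<in>T. D c t < inverse (real (Suc n))"
    proof
      fix n
      have "inverse (real (Suc n)) > 0" by simp
      then obtain \<delta> where \<delta>: "\<delta> > 0" "\<And>x. x \<in> K \<Longrightarrow> dist x z < \<delta> \<Longrightarrow> dist (D c x) (D c z) < inverse (real (Suc n))"
        using cont[OF c] z(1) unfolding continuous_on_iff by blast
      obtain t where t: "t \<in> T" "dist t z < \<delta>"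
        using z(1) T(3) \<delta>(1) closure_approachable by blast
      then have "dist (D c t) (D c z) < inverse (real (Suc n))"
        using T(2) \<delta>(2) by blast
      then show "\<exists>t\<in>T. D c t < inverse (real (Suc n))"
        using t(1) z(2) D[of c t] by (intro bexI[of _ t]) (auto simp: dist_real_def)
    qed
  next
    assume small: "\<forall>n. \<exists>t\<in>T. D c t < inverse (real (Suc n))"
    then have "K \<noteq> {}" using T(2) by blast
    then obtain x where x: "x \<in> K" "\<And>y. y \<in> K \<Longrightarrow> D c x \<le> D c y"
      using continuous_attains_inf[OF K _ cont[OF c]] by blast
    have "\<not> D c x > 0"
    proof
      assume "D c x > 0"
      then obtain n where "inverse (real (Suc n)) < D c x"
        using reals_Archimedean by blast
      moreover obtain t where "t \<in> T" "D c t < inverse (real (Suc n))"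
        using small by blast
      ultimately show False using x(2)[of t] T(2) by force
    qed
    then show "\<exists>z\<in>K. D c z = 0"
      using x(1) D[of c x] by (intro bexI[of _ x]) auto
  qed
  then have "{c \<in> space M. \<exists>z\<in>K. D c z = 0} = {c \<in> space M. \<forall>n. \<exists>t\<in>T. D c t < inverse (real (Suc n))}"
    by blast
  also have "\<dots> \<in> sets M"
  proof (rule sets.sets_Collect_countable_All)
    fix n
    have "{c \<in> space M. \<exists>t\<in>T. D c t < inverse (real (Suc n))} = (\<Union>t\<in>T. {c \<in> space M. D c t < inverse (real (Suc n))})"
      by blast
    also have "\<dots> \<in> sets M"
      using T(1) by (intro sets.countable_UN'') measurable
    finally show "{c \<in> space M. \<exists>t\<in>T. D c t < inverse (real (Suc n))} \<in> sets M" .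
  qed
  finally show ?thesis .
qed

lemma finite_disjoint_basis:
  fixes T :: "'b::metric_space set"
  assumes B: "topological_basis B" and T: "finite T"
  obtains U where "\<And>t. t \<in> T \<Longrightarrow> U t \<in> B \<and> t \<in> U t" "\<And>s t. s \<in> T \<Longrightarrow> t \<in> T \<Longrightarrow> s \<noteq> t \<Longrightarrow> U s \<inter> U t = {}"
proof -
  define S where "S = (\<lambda>(s, t). dist s t) ` {(s, t) \<in> T \<times> T. s \<noteq> t}"
  have fin: "finite (insert 1 S)"
    unfolding S_def using T by (intro finite.insertI finite_imageI finite_subset[OF _ finite_cartesian_product[OF T T]]) auto
  \<comment> \<open>The 1 in the minimum keeps it defined when \<open>T\<close> has fewer than two
    points. Balls of radius \<open>e\<close> about distinct points of \<open>T\<close> are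
    disjoint.\<close>
  define e where "e = Min (insert 1 S) / 2"
  have "Min (insert 1 S) > 0"
    using fin by (subst Min_gr_iff) (auto simp: S_def)
  then have e: "e > 0" by (simp add: e_def)
  have dist: "2 * e \<le> dist s t" if "s \<in> T" "t \<in> T" "s \<noteq> t" for s t
    unfolding e_def using fin that by (auto intro!: Min_le simp: S_def)
  have "\<forall>t. \<exists>V\<in>B. t \<in> V \<and> V \<subseteq> ball t e"
    using topological_basisE[OF B open_ball] e by (metis centre_in_ball)
  then obtain U where U: "\<And>t. U t \<in> B \<and> t \<in> U t \<and> U t \<subseteq> ball t e"
    by metis
  show ?thesis
  proof
    show "U t \<in> B \<and> t \<in> U t" for t using U by blast
    show "U s \<inter> U t = {}" if "s \<in> T" "t \<in> T" "s \<noteq> t" for s t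
    proof (rule ccontr)
      assume "U s \<inter> U t \<noteq> {}"
      then obtain x where "dist s x < e" "dist t x < e"
        using U[of s] U[of t] by (auto simp: subset_iff)
      then show False
        using dist[OF that] dist_triangle2[of s t x] by linarith
    qed
  qed
qed

text \<open>The number of zeros is the supremum, over finite disjoint families of basic open sets,
  of the number of members containing a zero. Finitely many zeros can be separated by such a family,
  and disjoint members have different zeros. There are countably many families. Only
  sigma-compactness of X within open sets is demanded, since the half-open square of parameters is
  not compact.\<close>

lemma borel_measurable_zero_count:
  fixes D :: "'a \<Rightarrow> 'b::euclidean_space \<Rightarrow> real"
  assumes X: "\<And>U. open U \<Longrightarrow> \<exists>\<K>. countable \<K> \<and> (\<forall>K\<in>\<K>. compact K) \<and> X \<inter> U = \<Union>\<K>"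
    and cont: "\<And>c. c \<in> space M \<Longrightarrow> continuous_on UNIV (D c)"
    and D: "\<And>c z. 0 \<le> D c z" and m: "\<And>z. (\<lambda>c. D c z) \<in> borel_measurable M"
  shows "(\<lambda>c. emeasure (count_space UNIV) {z \<in> X. D c z = 0}) \<in> borel_measurable M"
proof -
  obtain B :: "'b set set" where B: "countable B" "topological_basis B"
    using ex_countable_basis by blast
  define hit where "hit U = {c \<in> space M. \<exists>z\<in>X \<inter> U. D c z = 0}" for U
  have hit: "hit U \<in> sets M" if "open U" for U
  proof -
    obtain \<K> where K: "countable \<K>" "\<forall>K\<in>\<K>. compact K" "X \<inter> U = \<Union>\<K>"
      using X[OF \<open>open U\<close>] by blast
    have "hit U = (\<Union>K\<in>\<K>. {c \<in> space M. \<exists>z\<in>K. D c z = 0})"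
      unfolding hit_def K(3) by blast
    also have "\<dots> \<in> sets M"
      using K(1,2) cont D m by (intro sets.countable_UN'' sets_has_zero_compact) (auto intro: continuous_on_subset)
    finally show ?thesis .
  qed
  define \<F> where "\<F> = {F. finite F \<and> F \<subseteq> B \<and> disjoint F}"
  have cF: "countable \<F>"
    by (rule countable_subset[OF _ countable_Collect_finite_subset[OF B(1)]]) (auto simp: \<F>_def)
  have opn: "open U" if "F \<in> \<F>" "U \<in> F" for F U
    using that topological_basis_open[OF B(2)] by (auto simp: \<F>_def)
  have eq: "emeasure (count_space UNIV) {z \<in> X. D c z = 0} = (SUP F\<in>\<F>. \<Sum>U\<in>F. indicator (hit U) c)" (is "?E = ?S")
    if c: "c \<in> space M" for c
  proof (rule antisym)
    have le: "of_nat (card T) \<le> ?S" if T: "finite T" "T \<subseteq> {z \<in> X. D c z = 0}" for T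
    proof -
      obtain U where U: "\<And>t. t \<in> T \<Longrightarrow> U t \<in> B \<and> t \<in> U t" "\<And>s t. s \<in> T \<Longrightarrow> t \<in> T \<Longrightarrow> s \<noteq> t \<Longrightarrow> U s \<inter> U t = {}"
        using finite_disjoint_basis[OF B(2) T(1)] by metis
      have inj: "inj_on U T"
        by (rule inj_onI) (use U in blast)
      have "U ` T \<in> \<F>"
        using T(1) U by (auto simp: \<F>_def disjoint_def)
      moreover have "(\<Sum>V\<in>U ` T. indicator (hit V) c) = (of_nat (card T) :: ennreal)"
      proof -
        have "(\<Sum>V\<in>U ` T. indicator (hit V) c) = (\<Sum>t\<in>T. indicator (hit (U t)) c :: ennreal)"
          using inj by (simp add: sum.reindex)
        also have "\<dots> = (\<Sum>t\<in>T. 1)"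
        proof (intro sum.cong refl)
          fix t assume t: "t \<in> T"
          then have "t \<in> X \<inter> U t" "D c t = 0" using T(2) U(1)[OF t] by auto
          then have "c \<in> hit (U t)" unfolding hit_def using c by blast
          then show "indicator (hit (U t)) c = (1 :: ennreal)" by simp
        qed
        finally show ?thesis by simp
      qed
      ultimately show ?thesis
        by (metis SUP_upper)
    qed
    show "?E \<le> ?S"
    proof (cases "finite {z \<in> X. D c z = 0}")
      case True
      then show ?thesis using le[OF True] by (simp add: emeasure_count_space)
    next
      case False
      have "\<not> ?S < top"
      proof
        assume "?S < top"
        then obtain n where n: "?S < of_nat n"
          using ennreal_Ex_less_of_nat by blast
        obtain T where "T \<subseteq> {z \<in> X. D c z = 0}" "finite T" "card T = n"
          using infinite_arbitrarily_large[OF False] by blast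
        then show False using le[of T] n by auto
      qed
      then have "?S = top" by (simp only: less_top[symmetric] not_not)
      then show ?thesis by (simp only: top_greatest)
    qed
    show "?S \<le> ?E"
    proof (rule SUP_least)
      fix F assume F: "F \<in> \<F>"
      define F' where "F' = {U \<in> F. c \<in> hit U}"
      have "\<forall>U\<in>F'. \<exists>z. z \<in> X \<inter> U \<and> D c z = 0"
        by (auto simp: F'_def hit_def)
      then obtain w where w: "\<And>U. U \<in> F' \<Longrightarrow> w U \<in> X \<inter> U \<and> D c (w U) = 0"
        by metis
      have fin: "finite F" "finite F'" using F by (auto simp: \<F>_def F'_def)
      have inj: "inj_on w F'"
      proof (rule inj_onI)
        fix U V assume UV: "U \<in> F'" "V \<in> F'" "w U = w V"
        then have "U \<inter> V \<noteq> {}" using w[of U] w[of V] by auto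
        then show "U = V" using UV F by (auto simp: \<F>_def F'_def disjoint_def)
      qed
      have "(\<Sum>U\<in>F. indicator (hit U) c) = (\<Sum>U\<in>F'. 1 :: ennreal)"
        using fin by (intro sum.mono_neutral_cong_right) (auto simp: F'_def)
      also have "\<dots> = of_nat (card (w ` F'))"
        using inj by (simp add: card_image)
      also have "\<dots> = emeasure (count_space UNIV) (w ` F')"
        using fin by (simp add: emeasure_count_space)
      also have "\<dots> \<le> ?E"
        using w by (intro emeasure_mono) auto
      finally show "(\<Sum>U\<in>F. indicator (hit U) c) \<le> ?E" .
    qed
  qed
  have "(\<lambda>c. SUP F\<in>\<F>. \<Sum>U\<in>F. indicator (hit U) c :: ennreal) \<in> borel_measurable M"
    using cF hit opn by (intro borel_measurable_SUP borel_measurable_sum borel_measurable_indicator) auto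
  then show ?thesis
    by (subst measurable_cong[OF eq])
qed

text \<open>The half-open square is exhausted by closed squares with side 2 pi - 1/(n+1), and an
  open set is a countable union of closed boxes.\<close>

lemma square_open_compacts:
  fixes U :: "(real \<times> real) set"
  assumes "open U"
  shows "\<exists>\<K>. countable \<K> \<and> (\<forall>K\<in>\<K>. compact K) \<and> ({0..<2*pi} \<times> {0..<2*pi}) \<inter> U = \<Union>\<K>"
proof -
  obtain \<D> where D: "countable \<D>" "\<And>X. X \<in> \<D> \<Longrightarrow> \<exists>a b. X = cbox a b" "\<Union>\<D> = U"
    using open_countable_Union_open_cbox[OF assms] by metis
  define Q where "Q n = {0..2*pi - inverse (real (Suc n))}" for n
  have Q: "(\<Union>n. Q n \<times> Q n) = {0..<2*pi} \<times> {0..<2*pi}"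
  proof (intro equalityI subsetI)
    fix z assume "z \<in> (\<Union>n. Q n \<times> Q n)"
    then obtain n where n: "z \<in> Q n \<times> Q n" by blast
    have "2*pi - inverse (real (Suc n)) < 2*pi" by simp
    then have "x < 2*pi" if "x \<in> Q n" for x
      using that unfolding Q_def atLeastAtMost_iff by (blast intro: le_less_trans)
    moreover have "0 \<le> x" if "x \<in> Q n" for x
      using that unfolding Q_def by simp
    ultimately show "z \<in> {0..<2*pi} \<times> {0..<2*pi}"
      using n by auto
  next
    fix z :: "real \<times> real" assume z: "z \<in> {0..<2*pi} \<times> {0..<2*pi}"
    then have "min (2*pi - fst z) (2*pi - snd z) > 0" by auto
    then obtain n where "inverse (real (Suc n)) < min (2*pi - fst z) (2*pi - snd z)"
      using reals_Archimedean by blast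
    then show "z \<in> (\<Union>n. Q n \<times> Q n)"
      using z by (intro UN_I[of n]) (auto simp: Q_def)
  qed
  define P where "P n = Q n \<times> Q n" for n
  have P: "compact (P n)" for n
    unfolding P_def Q_def by (intro compact_Times) auto
  define \<K> where "\<K> = (\<lambda>(n, X). P n \<inter> X) ` (UNIV \<times> \<D>)"
  have "countable \<K>"
    unfolding \<K>_def using D(1) by (intro countable_image countable_SIGMA) auto
  moreover have "\<forall>K\<in>\<K>. compact K"
  proof
    fix K assume "K \<in> \<K>"
    then obtain n X where "K = P n \<inter> X" "X \<in> \<D>" by (auto simp: \<K>_def)
    then show "compact K" using D(2) P by (metis compact_Int compact_cbox)
  qed
  moreover have "({0..<2*pi} \<times> {0..<2*pi}) \<inter> U = (\<Union>n. P n) \<inter> \<Union>\<D>"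
    by (simp only: Q P_def D(3))
  then have "({0..<2*pi} \<times> {0..<2*pi}) \<inter> U = \<Union>\<K>"
    unfolding \<K>_def by auto
  ultimately show ?thesis by blast
qed

section \<open>Integrals over pairs of curves in terms of coefficients\<close>

lemma sigma_finite_embed_measure_inj_on:
  assumes "sigma_finite_measure M" and inj: "inj_on f (space M)"
  shows "sigma_finite_measure (embed_measure M f)"
proof -
  interpret sigma_finite_measure M by fact
  obtain A :: "nat \<Rightarrow> 'a set" where A: "range A \<subseteq> sets M" "(\<Union>i. A i) = space M" "\<And>i. emeasure M (A i) \<noteq> \<infinity>"
    using sigma_finite by blast
  have "emeasure (embed_measure M f) (f ` A i) \<noteq> \<infinity>" for i
  proof -
    have "A i \<in> sets M" using A(1) by auto
    moreover have "f -` f ` A i \<inter> space M = A i"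
      using inj sets.sets_into_space[OF \<open>A i \<in> sets M\<close>] by (auto dest: inj_onD)
    ultimately show ?thesis
      using A(3)[of i] by (simp add: emeasure_embed_measure'[OF inj] in_sets_embed_measure)
  qed
  then show ?thesis
    using A(1,2) by (intro sigma_finite_measure.intro exI[of _ "range (\<lambda>i. f ` A i)"])
      (auto simp: in_sets_embed_measure space_embed_measure image_UN[symmetric])
qed

lemma inj_on_curve_of: "inj_on (curve_of N) (space (\<Pi>\<^sub>M j\<in>{- int N..int N}. lborel))"
  using bij_betw_curve_of[of N] by (simp add: bij_betw_def space_PiM)

lemma curve_eval_measurable: "(\<lambda>f. f \<phi>) \<in> borel_measurable (curve_vol N)"
  unfolding curve_vol_def
  by (rule measurable_embed_measure1)
    (auto simp: curve_of_def intro!: borel_measurable_sum borel_measurable_scaleR)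

lemma sigma_finite_curve_vol: "sigma_finite_measure (curve_vol N)"
  unfolding curve_vol_def
  by (intro sigma_finite_embed_measure_inj_on inj_on_curve_of coeffs.sigma_finite) simp

text \<open>The first curve is integrated innermost, so that its constant coefficient can vary while
  the second curve is held fixed.\<close>

lemma nn_integral_pair_vol:
  assumes F: "F \<in> borel_measurable (pair_vol N)"
  shows "(\<integral>\<^sup>+p. F p \<partial>pair_vol N) = (\<integral>\<^sup>+d. \<integral>\<^sup>+c. F (curve_of N c, curve_of N d)
    \<partial>(\<Pi>\<^sub>M j\<in>{- int N..int N}. lborel) \<partial>(\<Pi>\<^sub>M j\<in>{- int N..int N}. lborel))"
proof -
  interpret pair_sigma_finite "curve_vol N" "curve_vol N"
    by (intro pair_sigma_finite.intro sigma_finite_curve_vol)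
  have [measurable]: "F \<in> borel_measurable (curve_vol N \<Otimes>\<^sub>M curve_vol N)"
    using F by (simp add: pair_vol_def)
  have "(\<integral>\<^sup>+p. F p \<partial>pair_vol N) = (\<integral>\<^sup>+g. \<integral>\<^sup>+f. F (f, g) \<partial>curve_vol N \<partial>curve_vol N)"
    unfolding pair_vol_def by (simp add: nn_integral_snd[symmetric])
  also have "\<dots> = (\<integral>\<^sup>+d. \<integral>\<^sup>+f. F (f, curve_of N d) \<partial>curve_vol N \<partial>(\<Pi>\<^sub>M j\<in>{- int N..int N}. lborel))"
    by (subst curve_vol_def, rule nn_integral_embed_measure'[OF inj_on_curve_of])
      (simp add: curve_vol_def[symmetric])
  also have "\<dots> = (\<integral>\<^sup>+d. \<integral>\<^sup>+c. F (curve_of N c, curve_of N d)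
    \<partial>(\<Pi>\<^sub>M j\<in>{- int N..int N}. lborel) \<partial>(\<Pi>\<^sub>M j\<in>{- int N..int N}. lborel))"
  proof (rule nn_integral_cong)
    fix d assume "d \<in> space (\<Pi>\<^sub>M j\<in>{- int N..int N}. lborel :: (real \<times> real) measure)"
    then have "curve_of N d \<in> space (curve_vol N)"
      by (simp add: curve_vol_def space_embed_measure)
    then have "(\<lambda>f. F (f, curve_of N d)) \<in> borel_measurable (embed_measure (\<Pi>\<^sub>M j\<in>{- int N..int N}. lborel) (curve_of N))"
      unfolding curve_vol_def[symmetric] by measurable
    then show "(\<integral>\<^sup>+f. F (f, curve_of N d) \<partial>curve_vol N)
        = (\<integral>\<^sup>+c. F (curve_of N c, curve_of N d) \<partial>(\<Pi>\<^sub>M j\<in>{- int N..int N}. lborel))"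
      unfolding curve_vol_def by (rule nn_integral_embed_measure'[OF inj_on_curve_of])
  qed
  finally show ?thesis .
qed

lemma continuous_curve: "f \<in> trig_curves N \<Longrightarrow> continuous_on UNIV f"
proof -
  assume "f \<in> trig_curves N"
  then obtain c where "f = curve_of N c"
    using bij_betw_curve_of[of N] by (auto simp: bij_betw_def)
  moreover have "continuous_on UNIV (trig_basis j)" for j
    unfolding trig_basis_def[abs_def] by (cases "j = 0"; cases "0 < j"; simp; intro continuous_intros)
  then have "continuous_on UNIV (\<lambda>\<phi>. \<Sum>j\<in>{- int N..int N}. trig_basis j \<phi> *\<^sub>R c j)"
    by (intro continuous_intros)
  ultimately show ?thesis
    by (simp add: curve_of_def)
qed

text \<open>Intersections are the zeros of the distance between the two points, which is continuous
  in the parameters for a fixed pair of curves and measurable in the pair for fixed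
  parameters.\<close>

lemma intersection_count_measurable [measurable]:
  "(\<lambda>p. emeasure (count_space UNIV) (intersections (fst p) (snd p))) \<in> borel_measurable (pair_vol N)"
proof -
  have [measurable]: "(\<lambda>p. fst p \<phi>) \<in> borel_measurable (pair_vol N)" "(\<lambda>p. snd p \<phi>) \<in> borel_measurable (pair_vol N)" for \<phi>
    unfolding pair_vol_def by (auto intro: measurable_compose[OF measurable_fst curve_eval_measurable]
        measurable_compose[OF measurable_snd curve_eval_measurable])
  have "(\<lambda>p. emeasure (count_space UNIV) {z \<in> {0..<2*pi} \<times> {0..<2*pi}. dist (fst p (fst z)) (snd p (snd z)) = 0})
      \<in> borel_measurable (pair_vol N)"
  proof (rule borel_measurable_zero_count[OF square_open_compacts])
    fix p assume "p \<in> space (pair_vol N)"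
    then have p: "continuous_on UNIV (fst p)" "continuous_on UNIV (snd p)"
      by (auto simp: pair_vol_def space_pair_measure space_curve_vol continuous_curve)
    show "continuous_on UNIV (\<lambda>z. dist (fst p (fst z)) (snd p (snd z)))"
      using continuous_on_compose2[OF p(1) continuous_on_fst[OF continuous_on_id]]
        continuous_on_compose2[OF p(2) continuous_on_snd[OF continuous_on_id]]
      by (intro continuous_on_dist) auto
  qed simp_all
  moreover have "intersections f g = {z \<in> {0..<2*pi} \<times> {0..<2*pi}. dist (f (fst z)) (g (snd z)) = 0}" for f g
    by (auto simp: intersections_def)
  ultimately show ?thesis by simp
qed

lemma curve_ball_sets: "curve_ball N R \<in> sets (curve_vol N)"
proof -
  have "(\<lambda>f. curve_dot f f) \<in> borel_measurable (curve_vol N)"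
    unfolding curve_vol_def
    by (rule measurable_embed_measure1)
      (auto simp: curve_dot_curve_of intro!: borel_measurable_sum borel_measurable_inner)
  then have "{f \<in> space (curve_vol N). sqrt (curve_dot f f) \<le> R} \<in> sets (curve_vol N)"
    by measurable
  then show ?thesis
    by (simp add: curve_ball_def space_curve_vol)
qed

section \<open>The mean number of intersections\<close>

text \<open>With N = k + 1 this equals pi^(2k+1) / (2k+1)! / ((N + 1/2) \<open>sumsq N\<close>): the
  volume of the unit ball in dimension 4 k + 2 over the Jacobian of the map to value and derivative.
  It is kept in the form in which the last square completion produces it.\<close>

definition ball_const :: "nat \<Rightarrow> real" where
  "ball_const k = pi ^ (2 * k) / (fact (2 * k) * real (Suc k) * sumsq (Suc k)) * (2 * pi * real (Suc k) / (real (2 * k + 3) * real (2 * k + 1)))"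

lemma ball_const_pos: "ball_const k > 0"
  unfolding ball_const_def by (intro mult_pos_pos divide_pos_pos sumsq_pos) auto

lemma interval_eq_insert: "{- int N..int N} = insert 0 (freqs N)" "0 \<notin> freqs N"
  by (auto simp: freqs_def)

lemma sum_insert_zero_upd:
  "(\<Sum>j\<in>{- int N..int N}. G j ((c(0 := w)) j)) = G 0 w + (\<Sum>j\<in>freqs N. G j (c j))"
proof -
  have "(\<Sum>j\<in>freqs N. G j ((c(0 := w)) j)) = (\<Sum>j\<in>freqs N. G j (c j))"
    by (intro sum.cong) (auto simp: freqs_def)
  then show ?thesis
    unfolding interval_eq_insert(1) by (simp add: interval_eq_insert(2))
qed

lemma curve_of_upd: "curve_of N (c(0 := w)) \<phi> = (1 / sqrt 2) *\<^sub>R w + osc N \<phi> c"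
  unfolding curve_of_def osc_def sum_insert_zero_upd[where G = "\<lambda>j x. trig_basis j \<phi> *\<^sub>R x"]
  by (simp add: trig_basis_def)

lemma osc_deriv_upd: "osc_deriv N \<phi> (c(0 := w)) = osc_deriv N \<phi> c"
  unfolding osc_deriv_def by (intro sum.cong) (auto simp: freqs_def)

lemma sqn_upd: "sqn {- int N..int N} (c(0 := w)) = (norm w)\<^sup>2 + sqn (freqs N) c"
  unfolding sqn_def sum_insert_zero_upd[where G = "\<lambda>j x. (norm x)\<^sup>2"] by simp

lemma curve_of_measurable: "(\<lambda>c. curve_of N c \<phi>) \<in> borel_measurable (coeffs {- int N..int N})"
  unfolding curve_of_def by (auto intro!: borel_measurable_sum borel_measurable_scaleR)

text \<open>The constant coefficient adds w / sqrt 2 to the value and nothing to the derivative. One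
  more square completion therefore raises the squared norm of the value functional from N to N + 1/2
  and the exponent from 2 k to 2 k + 1.\<close>

lemma nn_integral_curve_ball:
  fixes Q :: "(real \<times> real) \<times> (real \<times> real) \<Rightarrow> ennreal" and k :: nat
  defines "N \<equiv> Suc k"
  assumes Q [measurable]: "Q \<in> borel_measurable borel"
  shows "(\<integral>\<^sup>+d. Q (curve_of N d \<psi>, osc_deriv N \<psi> d) * indicator {..r} (sqn {- int N..int N} d) \<partial>coeffs {- int N..int N})
    = (\<integral>\<^sup>+u. \<integral>\<^sup>+v. Q (u, v) * ennreal (ball_const k * pos_power (2 * k + 1)
        (r - (norm u)\<^sup>2 / (real N + 1/2) - (norm v)\<^sup>2 / sumsq N)) \<partial>lborel \<partial>lborel)"
proof -
  define C where "C = pi ^ (2 * k) / (fact (2 * k) * real N * sumsq N)"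
  have C: "C \<ge> 0" by (simp add: C_def N_def sumsq_pos less_imp_le)
  have bc: "ball_const k = C * (2 * pi * real N / (real (2 * k + 3) * real (2 * k + 1)))"
    by (simp only: ball_const_def C_def N_def)
  define b where "b = 1 / sqrt (2::real)"
  have b2: "b\<^sup>2 = 1 / 2" by (simp add: b_def power_divide)
  have N0: "real N > 0" by (simp add: N_def)
  have [measurable]: "(\<lambda>d. curve_of N d \<psi>) \<in> borel_measurable (coeffs {- int N..int N})"
    "osc_deriv N \<psi> \<in> borel_measurable (coeffs {- int N..int N})"
    "sqn {- int N..int N} \<in> borel_measurable (coeffs {- int N..int N})"
    by (rule curve_of_measurable, rule osc_measurable, simp add: interval_eq_insert subset_insertI, rule sqn_measurable, simp)
  have meas: "(\<lambda>d. Q (curve_of N d \<psi>, osc_deriv N \<psi> d) * indicator {..r} (sqn {- int N..int N} d)) \<in> borel_measurable (coeffs {- int N..int N})"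
    by measurable
  have "(\<integral>\<^sup>+d. Q (curve_of N d \<psi>, osc_deriv N \<psi> d) * indicator {..r} (sqn {- int N..int N} d) \<partial>coeffs {- int N..int N})
    = (\<integral>\<^sup>+w. \<integral>\<^sup>+d. Q (curve_of N (d(0 := w)) \<psi>, osc_deriv N \<psi> (d(0 := w))) * indicator {..r} (sqn {- int N..int N} (d(0 := w)))
        \<partial>coeffs (freqs N) \<partial>lborel)"
    by (rule coeffs.product_nn_integral_insert_rev[OF freqs_notin(3) interval_eq_insert(2), folded interval_eq_insert(1), OF meas])
  also have "\<dots> = (\<integral>\<^sup>+w. \<integral>\<^sup>+u. \<integral>\<^sup>+v. Q (u + b *\<^sub>R w, v) *
      ennreal (C * pos_power (2 * k) (r - (norm w)\<^sup>2 - (norm u)\<^sup>2 / N - (norm v)\<^sup>2 / sumsq N)) \<partial>lborel \<partial>lborel \<partial>lborel)"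
  proof (rule nn_integral_cong)
    fix w :: "real \<times> real"
    have "(\<integral>\<^sup>+d. Q (curve_of N (d(0 := w)) \<psi>, osc_deriv N \<psi> (d(0 := w))) * indicator {..r} (sqn {- int N..int N} (d(0 := w))) \<partial>coeffs (freqs N))
      = (\<integral>\<^sup>+d. Q (osc N \<psi> d + b *\<^sub>R w, osc_deriv N \<psi> d) * indicator {..r - (norm w)\<^sup>2} (sqn (freqs N) d) \<partial>coeffs (freqs N))"
      by (intro nn_integral_cong) (simp add: curve_of_upd osc_deriv_upd sqn_upd b_def add.commute indicator_def le_diff_eq)
    also have "\<dots> = (\<integral>\<^sup>+u. \<integral>\<^sup>+v. Q (u + b *\<^sub>R w, v) *
      ennreal (C * pos_power (2 * k) (r - (norm w)\<^sup>2 - (norm u)\<^sup>2 / N - (norm v)\<^sup>2 / sumsq N)) \<partial>lborel \<partial>lborel)"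
      using nn_integral_osc[of "\<lambda>z. Q (fst z + b *\<^sub>R w, snd z)" "\<lambda>_. r - (norm w)\<^sup>2" k \<psi>]
      by (simp add: N_def C_def del: of_nat_Suc)
    finally show "(\<integral>\<^sup>+d. Q (curve_of N (d(0 := w)) \<psi>, osc_deriv N \<psi> (d(0 := w))) * indicator {..r} (sqn {- int N..int N} (d(0 := w))) \<partial>coeffs (freqs N))
      = (\<integral>\<^sup>+u. \<integral>\<^sup>+v. Q (u + b *\<^sub>R w, v) *
      ennreal (C * pos_power (2 * k) (r - (norm w)\<^sup>2 - (norm u)\<^sup>2 / N - (norm v)\<^sup>2 / sumsq N)) \<partial>lborel \<partial>lborel)" .
  qed
  also have "\<dots> = (\<integral>\<^sup>+w. \<integral>\<^sup>+u. \<integral>\<^sup>+v. Q (u, v) *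
      ennreal (C * pos_power (2 * k) (r - (norm w)\<^sup>2 - (norm (u - b *\<^sub>R w))\<^sup>2 / N - (norm v)\<^sup>2 / sumsq N)) \<partial>lborel \<partial>lborel \<partial>lborel)"
    (is "_ = (\<integral>\<^sup>+w. \<integral>\<^sup>+u. \<integral>\<^sup>+v. ?g w u v \<partial>lborel \<partial>lborel \<partial>lborel)")
  proof (rule nn_integral_cong)
    fix w :: "real \<times> real"
    have "(\<integral>\<^sup>+u. \<integral>\<^sup>+v. ?g w (u + b *\<^sub>R w) v \<partial>lborel \<partial>lborel) = (\<integral>\<^sup>+u. \<integral>\<^sup>+v. ?g w u v \<partial>lborel \<partial>lborel)"
      by (rule nn_integral_shift) simp
    then show "(\<integral>\<^sup>+u. \<integral>\<^sup>+v. Q (u + b *\<^sub>R w, v) *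
      ennreal (C * pos_power (2 * k) (r - (norm w)\<^sup>2 - (norm u)\<^sup>2 / N - (norm v)\<^sup>2 / sumsq N)) \<partial>lborel \<partial>lborel)
      = (\<integral>\<^sup>+u. \<integral>\<^sup>+v. ?g w u v \<partial>lborel \<partial>lborel)"
      by simp
  qed
  also have "\<dots> = (\<integral>\<^sup>+u. \<integral>\<^sup>+w. \<integral>\<^sup>+v. ?g w u v \<partial>lborel \<partial>lborel \<partial>lborel)"
    using nn_integral_swap[of "\<lambda>z. \<integral>\<^sup>+v. ?g (fst z) (snd z) v \<partial>lborel"] by simp
  also have "\<dots> = (\<integral>\<^sup>+u. \<integral>\<^sup>+v. \<integral>\<^sup>+w. ?g w u v \<partial>lborel \<partial>lborel \<partial>lborel)"
  proof (rule nn_integral_cong)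
    fix u
    show "(\<integral>\<^sup>+w. \<integral>\<^sup>+v. ?g w u v \<partial>lborel \<partial>lborel) = (\<integral>\<^sup>+v. \<integral>\<^sup>+w. ?g w u v \<partial>lborel \<partial>lborel)"
      using nn_integral_swap[of "\<lambda>z. ?g (fst z) u (snd z)"] by simp
  qed
  also have "\<dots> = (\<integral>\<^sup>+u. \<integral>\<^sup>+v. Q (u, v) * ennreal (ball_const k * pos_power (2 * k + 1)
        (r - (norm u)\<^sup>2 / (real N + 1/2) - (norm v)\<^sup>2 / sumsq N)) \<partial>lborel \<partial>lborel)"
  proof (intro nn_integral_cong)
    fix u v :: "real \<times> real"
    have "(\<integral>\<^sup>+w. ?g w u v \<partial>lborel) = Q (u, v) * (ennreal C * (\<integral>\<^sup>+w. ennreal (pos_power (2 * k)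
        ((r - (norm v)\<^sup>2 / sumsq N) - 1 * (norm w)\<^sup>2 - 1 / N * (norm (u - b *\<^sub>R w))\<^sup>2)) \<partial>lborel))"
      using C by (simp add: ennreal_mult' nn_integral_cmult algebra_simps)
    also have "(\<integral>\<^sup>+w. ennreal (pos_power (2 * k) ((r - (norm v)\<^sup>2 / sumsq N) - 1 * (norm w)\<^sup>2 - 1 / N * (norm (u - b *\<^sub>R w))\<^sup>2)) \<partial>lborel)
      = ennreal (2 * pi * real N / (real (2 * k + 3) * real (2 * k + 1)) * pos_power (2 * k + 1)
        (r - (norm u)\<^sup>2 / (real N + 1/2) - (norm v)\<^sup>2 / sumsq N))"
    proof (subst nn_integral_pos_power_square)
      have 1: "1 + 1 / real N * b\<^sup>2 = (2 * real N + 1) / (2 * real N)"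
        using N0 by (simp add: b2 field_simps)
      have n: "1 / n / ((2 * n + 1) / (2 * n)) = 1 / (n + 1/2)" if "n > 0" for n :: real
        using that by (simp add: divide_simps)
      have 3: "real (2 * k + 3) = 2 * real N + 1" "real (2 * k + 1) = real (Suc (2 * k))"
        by (simp_all add: N_def)
      have "pi / ((1 + 1 / real N * b\<^sup>2) * real (Suc (2 * k))) = 2 * pi * real N / (real (2 * k + 3) * real (2 * k + 1))"
        "1 * (1 / real N) / (1 + 1 / real N * b\<^sup>2) = 1 / (real N + 1/2)"
        unfolding 1 3 using N0 n by simp_all
      then show "ennreal (pi / ((1 + 1 / real N * b\<^sup>2) * real (Suc (2 * k))) * pos_power (Suc (2 * k))
          (r - (norm v)\<^sup>2 / sumsq N - 1 * (1 / real N) / (1 + 1 / real N * b\<^sup>2) * (norm u)\<^sup>2))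
        = ennreal (2 * pi * real N / (real (2 * k + 3) * real (2 * k + 1)) * pos_power (2 * k + 1)
        (r - (norm u)\<^sup>2 / (real N + 1/2) - (norm v)\<^sup>2 / sumsq N))"
        by (simp only:) (simp add: diff_diff_eq add.commute)
    qed (use N0 in simp_all)
    finally show "(\<integral>\<^sup>+w. ?g w u v \<partial>lborel) = Q (u, v) * ennreal (ball_const k * pos_power (2 * k + 1)
        (r - (norm u)\<^sup>2 / (real N + 1/2) - (norm v)\<^sup>2 / sumsq N))"
      unfolding bc using C by (simp only: ennreal_mult'[symmetric] mult.assoc)
  qed
  finally show ?thesis .
qed

text \<open>Here the constant coefficient has been eliminated by the condition that the curve passes through \<open>z\<close>:
  it equals \<open>\<surd>2 (z - osc N \<phi> c)\<close> and contributes \<open>2 |z - osc N \<phi> c|\<^sup>2\<close> to the squared norm.\<close>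

lemma nn_integral_osc_through_point:
  fixes Q :: "real \<times> real \<Rightarrow> ennreal" and k :: nat and z :: "real \<times> real"
  defines "N \<equiv> Suc k"
  assumes Q [measurable]: "Q \<in> borel_measurable borel"
  shows "(\<integral>\<^sup>+c. Q (osc_deriv N \<phi> c) * indicator {..r - 2 * (norm (z - osc N \<phi> c))\<^sup>2} (sqn (freqs N) c) \<partial>coeffs (freqs N))
    = (\<integral>\<^sup>+v. Q v * ennreal (ball_const k / 2 * pos_power (2 * k + 1)
        (r - (norm z)\<^sup>2 / (real N + 1/2) - (norm v)\<^sup>2 / sumsq N)) \<partial>lborel)"
proof -
  define C where "C = pi ^ (2 * k) / (fact (2 * k) * real N * sumsq N)"
  have C: "C \<ge> 0" by (simp add: C_def N_def sumsq_pos less_imp_le)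
  have N0: "real N > 0" by (simp add: N_def)
  \<comment> \<open>The half comes from w = sqrt 2 (z - u): passing from w to z scales plane area by
    2. The Jacobian in \<open>nn_integral_count_constant_coeff\<close> carries the compensating
    factor 2.\<close>
  have bc: "ball_const k / 2 = C * (2 * pi * real N / (real (2 * k + 3) * real (2 * k + 1)) / 2)"
    by (simp only: ball_const_def C_def N_def times_divide_eq_right)
  let ?g = "\<lambda>u v. Q v * ennreal (C * pos_power (2 * k) (r - 2 * (norm (z - u))\<^sup>2 - (norm u)\<^sup>2 / N - (norm v)\<^sup>2 / sumsq N))"
  have "(\<integral>\<^sup>+c. Q (osc_deriv N \<phi> c) * indicator {..r - 2 * (norm (z - osc N \<phi> c))\<^sup>2} (sqn (freqs N) c) \<partial>coeffs (freqs N))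
    = (\<integral>\<^sup>+u. \<integral>\<^sup>+v. ?g u v \<partial>lborel \<partial>lborel)"
    using nn_integral_osc[of "\<lambda>w. Q (snd w)" "\<lambda>w. r - 2 * (norm (z - fst w))\<^sup>2" k \<phi>]
    by (simp add: N_def C_def del: of_nat_Suc)
  also have "\<dots> = (\<integral>\<^sup>+v. \<integral>\<^sup>+u. ?g u v \<partial>lborel \<partial>lborel)"
    using nn_integral_swap[of "\<lambda>w. ?g (fst w) (snd w)"] by simp
  also have "\<dots> = (\<integral>\<^sup>+v. Q v * ennreal (ball_const k / 2 * pos_power (2 * k + 1)
        (r - (norm z)\<^sup>2 / (real N + 1/2) - (norm v)\<^sup>2 / sumsq N)) \<partial>lborel)"
  proof (rule nn_integral_cong)
    fix v :: "real \<times> real"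
    have "(\<integral>\<^sup>+u. ?g u v \<partial>lborel) = Q v * (ennreal C * (\<integral>\<^sup>+u. ennreal (pos_power (2 * k)
        ((r - (norm v)\<^sup>2 / sumsq N) - 1 / N * (norm u)\<^sup>2 - 2 * (norm (z - 1 *\<^sub>R u))\<^sup>2)) \<partial>lborel))"
      using C by (simp add: ennreal_mult' nn_integral_cmult algebra_simps)
    also have "(\<integral>\<^sup>+u. ennreal (pos_power (2 * k) ((r - (norm v)\<^sup>2 / sumsq N) - 1 / N * (norm u)\<^sup>2 - 2 * (norm (z - 1 *\<^sub>R u))\<^sup>2)) \<partial>lborel)
      = ennreal (2 * pi * real N / (real (2 * k + 3) * real (2 * k + 1)) / 2 * pos_power (2 * k + 1)
        (r - (norm z)\<^sup>2 / (real N + 1/2) - (norm v)\<^sup>2 / sumsq N))"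
    proof (subst nn_integral_pos_power_square)
      have 1: "1 / real N + 2 * 1\<^sup>2 = (2 * real N + 1) / real N"
        using N0 by (simp add: field_simps)
      have n: "1 / n * 2 / ((2 * n + 1) / n) = 1 / (n + 1/2)" if "n > 0" for n :: real
        using that by (simp add: divide_simps)
      have 3: "real (2 * k + 3) = 2 * real N + 1" "real (2 * k + 1) = real (Suc (2 * k))"
        by (simp_all add: N_def)
      have "pi / ((1 / real N + 2 * 1\<^sup>2) * real (Suc (2 * k))) = 2 * pi * real N / (real (2 * k + 3) * real (2 * k + 1)) / 2"
        "1 / real N * 2 / (1 / real N + 2 * 1\<^sup>2) = 1 / (real N + 1/2)"
        unfolding 1 3 using N0 n by simp_all
      then show "ennreal (pi / ((1 / real N + 2 * 1\<^sup>2) * real (Suc (2 * k))) * pos_power (Suc (2 * k))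
          (r - (norm v)\<^sup>2 / sumsq N - 1 / real N * 2 / (1 / real N + 2 * 1\<^sup>2) * (norm z)\<^sup>2))
        = ennreal (2 * pi * real N / (real (2 * k + 3) * real (2 * k + 1)) / 2 * pos_power (2 * k + 1)
        (r - (norm z)\<^sup>2 / (real N + 1/2) - (norm v)\<^sup>2 / sumsq N))"
        by (simp only:) (simp add: diff_diff_eq add.commute)
    qed (use N0 in simp_all)
    finally show "(\<integral>\<^sup>+u. ?g u v \<partial>lborel) = Q v * ennreal (ball_const k / 2 * pos_power (2 * k + 1)
        (r - (norm z)\<^sup>2 / (real N + 1/2) - (norm v)\<^sup>2 / sumsq N))"
      unfolding bc using C by (simp only: ennreal_mult'[symmetric] mult.assoc)
  qed
  finally show ?thesis .
qed

section \<open>Counting intersections over the constant coefficient\<close>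

lemma trig_basis_has_derivative: "(trig_basis j has_vector_derivative trig_basis_deriv j \<phi>) (at \<phi>)"
  unfolding trig_basis_def[abs_def] trig_basis_deriv_def
  by (cases "j = 0"; cases "0 < j")
    (auto intro!: derivative_eq_intros simp flip: has_real_derivative_iff_has_vector_derivative)

lemma osc_has_derivative: "((\<lambda>\<phi>. osc N \<phi> c) has_vector_derivative osc_deriv N \<phi> c) (at \<phi>)"
  unfolding osc_def osc_deriv_def
  by (intro has_vector_derivative_sum has_vector_derivative_scaleR[where g' = 0, simplified]
      trig_basis_has_derivative[folded has_real_derivative_iff_has_vector_derivative] has_vector_derivative_const)

lemma continuous_trig_basis:
  "continuous_on UNIV (trig_basis j)" "continuous_on UNIV (trig_basis_deriv j)"
  unfolding trig_basis_def[abs_def] trig_basis_deriv_def[abs_def]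
  by (cases "j = 0"; cases "0 < j"; simp; intro continuous_intros)+

lemma trig_basis_measurable [measurable]:
  "trig_basis j \<in> borel_measurable borel" "trig_basis_deriv j \<in> borel_measurable borel"
  using continuous_trig_basis by (auto intro: borel_measurable_continuous_onI)

lemma continuous_osc: "continuous_on UNIV (\<lambda>\<phi>. osc N \<phi> c)" "continuous_on UNIV (\<lambda>\<phi>. osc_deriv N \<phi> c)"
  unfolding osc_def osc_deriv_def
  by (intro continuous_on_sum continuous_on_scaleR continuous_trig_basis continuous_on_const)+

lemma osc_measurable_param [measurable]:
  "(\<lambda>\<phi>. osc N \<phi> c) \<in> borel_measurable borel" "(\<lambda>\<phi>. osc_deriv N \<phi> c) \<in> borel_measurable borel"
  using continuous_osc by (auto intro: borel_measurable_continuous_onI)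

text \<open>Exchanging the integrals over parameters and coefficients requires measurability in both
  jointly.\<close>

lemma osc_measurable_joint [measurable (raw)]:
  assumes [measurable]: "f \<in> borel_measurable M" and g: "g \<in> measurable M (coeffs (freqs N))"
  shows "(\<lambda>x. osc N (f x) (g x)) \<in> borel_measurable M" "(\<lambda>x. osc_deriv N (f x) (g x)) \<in> borel_measurable M"
proof -
  have [measurable]: "(\<lambda>x. g x j) \<in> borel_measurable M" if "j \<in> freqs N" for j
    using measurable_compose[OF g measurable_component_singleton[OF that]] by simp
  show "(\<lambda>x. osc N (f x) (g x)) \<in> borel_measurable M" "(\<lambda>x. osc_deriv N (f x) (g x)) \<in> borel_measurable M"
    unfolding osc_def osc_deriv_def by (intro borel_measurable_sum borel_measurable_scaleR; measurable)+
qed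

lemma curve_of_eq_osc: "curve_of N d \<phi> = (1 / sqrt 2) *\<^sub>R d 0 + osc N \<phi> d"
  using curve_of_upd[of N d "d 0" \<phi>] by simp

lemma square_sets [measurable]: "{0..<2*pi} \<times> {0..<2*pi} \<in> sets (borel :: (real \<times> real) measure)"
proof -
  have "{0..<2*pi} \<times> {0..<2*pi} \<in> sets (borel \<Otimes>\<^sub>M (borel :: real measure))"
    by (rule pair_measureI) auto
  then show ?thesis by (simp only: borel_prod)
qed

lemma emeasure_square: "emeasure lborel ({0..<2*pi} \<times> {0..<2*pi} :: (real \<times> real) set) = ennreal (4 * pi\<^sup>2)"
proof -
  have "emeasure lborel ({0..<2*pi} \<times> {0..<2*pi}) = ennreal (2 * pi) * ennreal (2 * pi)"
    unfolding lborel_prod[symmetric] by (subst lborel.emeasure_pair_measure_Times) auto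
  also have "\<dots> = ennreal (4 * pi\<^sup>2)"
    by (subst ennreal_mult[symmetric]) (auto simp: power2_eq_square)
  finally show ?thesis .
qed

text \<open>The curve \<open>c\<close> with constant coefficient \<open>w\<close> meets \<open>g\<close> at the parameters \<open>(\<phi>, \<psi>)\<close> iff
  \<open>w = \<surd>2 (g \<psi> - osc N \<phi> c)\<close>, so the integral over \<open>w\<close> is given by the area formula.\<close>

lemma nn_integral_count_constant_coeff:
  fixes c d :: "int \<Rightarrow> real \<times> real"
  shows "(\<integral>\<^sup>+w. indicator {..r} ((norm w)\<^sup>2 + s) * emeasure (count_space UNIV) (intersections (curve_of N (c(0 := w))) (curve_of N d)) \<partial>lborel)
    = (\<integral>\<^sup>+z. indicator ({0..<2*pi} \<times> {0..<2*pi}) z * (ennreal (2 * \<bar>det2 (osc_deriv N (fst z) c) (osc_deriv N (snd z) d)\<bar>) *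
        indicator {..r - 2 * (norm (curve_of N d (snd z) - osc N (fst z) c))\<^sup>2} s) \<partial>lborel)"
proof -
  define X where "X = {0..<2*pi} \<times> {0..<2*pi::real}"
  define p q where "p \<phi> = - (sqrt 2 *\<^sub>R osc N \<phi> c)" and "q \<psi> = sqrt 2 *\<^sub>R curve_of N d \<psi>" for \<phi> \<psi> :: real
  define p' q' where "p' \<phi> = - (sqrt 2 *\<^sub>R osc_deriv N \<phi> c)" and "q' \<psi> = sqrt 2 *\<^sub>R osc_deriv N \<psi> d" for \<phi> \<psi> :: real
  \<comment> \<open>A crossing at given parameters determines \<open>w\<close>, so the norm
    condition on \<open>w\<close> becomes a condition on the parameters and is absorbed into the
    domain of the area formula.\<close>
  define A where "A = {z \<in> X. (norm (p (fst z) + q (snd z)))\<^sup>2 + s \<le> r}"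
  have dp: "(p has_vector_derivative p' \<phi>) (at \<phi>)" for \<phi>
    unfolding p_def[abs_def] p'_def
    by (intro has_vector_derivative_minus bounded_linear.has_vector_derivative[OF bounded_linear_scaleR_right] osc_has_derivative)
  have "((\<lambda>\<psi>. (1 / sqrt 2) *\<^sub>R d 0 + osc N \<psi> d) has_vector_derivative 0 + osc_deriv N \<psi> d) (at \<psi>)" for \<psi>
    by (intro has_vector_derivative_add has_vector_derivative_const osc_has_derivative)
  then have dq: "(q has_vector_derivative q' \<psi>) (at \<psi>)" for \<psi>
    unfolding q_def[abs_def] q'_def curve_of_eq_osc
    by (intro bounded_linear.has_vector_derivative[OF bounded_linear_scaleR_right]) simp
  have cont: "continuous_on UNIV p'" "continuous_on UNIV q'" "continuous_on UNIV p" "continuous_on UNIV q"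
    unfolding p_def[abs_def] q_def[abs_def] p'_def[abs_def] q'_def[abs_def] curve_of_eq_osc
    by (intro continuous_intros continuous_osc)+
  have contF: "continuous_on UNIV (\<lambda>z. p (fst z) + q (snd z))"
    using continuous_on_compose2[OF cont(3) continuous_on_fst[OF continuous_on_id]]
        continuous_on_compose2[OF cont(4) continuous_on_snd[OF continuous_on_id]]
    by (intro continuous_on_add) auto
  then have [measurable]: "(\<lambda>z. p (fst z) + q (snd z)) \<in> borel_measurable borel"
    by (rule borel_measurable_continuous_onI)
  have [measurable]: "X \<in> sets borel"
    unfolding X_def by (rule square_sets)
  have A: "A \<in> sets borel"
    unfolding A_def by measurable
  have "X \<subseteq> cbox (0, 0) (2*pi, 2*pi)"
    by (auto simp: X_def)
  then have bA: "bounded A"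
    by (intro bounded_subset[OF bounded_cbox[of "(0, 0)" "(2*pi, 2*pi)"]]) (auto simp: A_def)
  have cX: "(\<lambda>w. emeasure (count_space UNIV) {z \<in> X. dist (p (fst z) + q (snd z)) w = 0}) \<in> borel_measurable borel"
    unfolding X_def
    by (rule borel_measurable_zero_count[OF square_open_compacts]) (use contF in \<open>auto intro!: continuous_on_dist\<close>)
  have eqA: "emeasure (count_space UNIV) {z \<in> A. p (fst z) + q (snd z) = w} =
      indicator {..r} ((norm w)\<^sup>2 + s) * emeasure (count_space UNIV) {z \<in> X. dist (p (fst z) + q (snd z)) w = 0}" for w
  proof (cases "(norm w)\<^sup>2 + s \<le> r")
    case True
    then have "{z \<in> A. p (fst z) + q (snd z) = w} = {z \<in> X. dist (p (fst z) + q (snd z)) w = 0}"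
      by (auto simp: A_def)
    then show ?thesis using True by simp
  next
    case False
    then have "{z \<in> A. p (fst z) + q (snd z) = w} = {}"
      by (auto simp: A_def)
    then show ?thesis using False by (simp only:) simp
  qed
  have m: "(\<lambda>w. emeasure (count_space UNIV) {z \<in> A. p (fst z) + q (snd z) = w}) \<in> borel_measurable borel"
    unfolding eqA using cX by measurable
  have int: "intersections (curve_of N (c(0 := w))) (curve_of N d) = {z \<in> X. dist (p (fst z) + q (snd z)) w = 0}" for w
  proof -
    have "curve_of N (c(0 := w)) \<phi> = curve_of N d \<psi> \<longleftrightarrow> p \<phi> + q \<psi> = w" for \<phi> \<psi>
    proof -
      have "p \<phi> + q \<psi> - w = sqrt 2 *\<^sub>R (curve_of N d \<psi> - curve_of N (c(0 := w)) \<phi>)"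
        by (simp add: p_def q_def curve_of_upd algebra_simps)
      then show ?thesis
        by (metis eq_iff_diff_eq_0 scaleR_eq_0_iff real_sqrt_eq_0_iff zero_neq_numeral)
    qed
    then show ?thesis by (auto simp: intersections_def X_def)
  qed
  have "(\<integral>\<^sup>+w. indicator {..r} ((norm w)\<^sup>2 + s) * emeasure (count_space UNIV) (intersections (curve_of N (c(0 := w))) (curve_of N d)) \<partial>lborel)
    = (\<integral>\<^sup>+w. emeasure (count_space UNIV) {z \<in> A. p (fst z) + q (snd z) = w} \<partial>lborel)"
    unfolding eqA int ..
  also have "\<dots> = (\<integral>\<^sup>+z. ennreal \<bar>det2 (p' (fst z)) (q' (snd z))\<bar> * indicator A z \<partial>lborel)"
    by (rule nn_integral_fibre_count_curves[OF dp dq cont(1,2) A bA m])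
  also have "\<dots> = (\<integral>\<^sup>+z. indicator X z * (ennreal (2 * \<bar>det2 (osc_deriv N (fst z) c) (osc_deriv N (snd z) d)\<bar>) *
        indicator {..r - 2 * (norm (curve_of N d (snd z) - osc N (fst z) c))\<^sup>2} s) \<partial>lborel)"
  proof (rule nn_integral_cong)
    fix z
    have "det2 (p' (fst z)) (q' (snd z)) = - (2 * det2 (osc_deriv N (fst z) c) (osc_deriv N (snd z) d))"
    proof -
      have "det2 (- (a *\<^sub>R x)) (a *\<^sub>R y) = - (a * a * det2 x y)" for a x y
        by (simp add: det2_def algebra_simps)
      from this[of "sqrt 2"] show ?thesis
        by (simp add: p'_def q'_def)
    qed
    moreover have "p (fst z) + q (snd z) = sqrt 2 *\<^sub>R (curve_of N d (snd z) - osc N (fst z) c)"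
      by (simp add: p_def q_def algebra_simps)
    then have "(norm (p (fst z) + q (snd z)))\<^sup>2 = 2 * (norm (curve_of N d (snd z) - osc N (fst z) c))\<^sup>2"
      by (simp add: power_mult_distrib)
    ultimately show "ennreal \<bar>det2 (p' (fst z)) (q' (snd z))\<bar> * indicator A z =
       indicator X z * (ennreal (2 * \<bar>det2 (osc_deriv N (fst z) c) (osc_deriv N (snd z) d)\<bar>) *
        indicator {..r - 2 * (norm (curve_of N d (snd z) - osc N (fst z) c))\<^sup>2} s)"
      by (auto simp: A_def indicator_def abs_mult)
  qed
  finally show ?thesis
    by (simp add: X_def)
qed

section \<open>Exact evaluation of the mean\<close>

lemma borel_measurable_indicator_atMost:
  fixes f g :: "'a \<Rightarrow> real"
  assumes [measurable]: "f \<in> borel_measurable M" "g \<in> borel_measurable M"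
  shows "(\<lambda>x. indicator {..f x} (g x) :: ennreal) \<in> borel_measurable M"
  unfolding indicator_def atMost_iff by measurable

text \<open>The quotient of the crossing integral by the squared ball volume, for degree k + 1. The
  shift leaves out degree 0, where the curves are points.\<close>

definition mean_crossings :: "nat \<Rightarrow> real" where
  "mean_crossings k = 2 * (sumsq (Suc k) / (real (Suc k) + 1/2)) * real (2 * k + 2) * real (2 * k + 3)
     * Beta (1/2) (2 * k + 3) * Beta (3/2) (2 * k + 2)"

text \<open>\<open>V\<close> is the volume pi^(2k+3) / (2k+3)! R^(4k+6) of a ball in dimension 4 k +
  6. For fixed parameters the crossing integral runs over a common value u and velocities v and w,
  weighted by |\<open>det2 v w\<close>| and both densities at u. Its value \<open>K\<close> does not
  depend on the parameters, so the square contributes only its area 4 pi^2.\<close>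

lemma nn_integral_ball_crossings:
  fixes k :: nat
  assumes R: "R > 0"
  defines "N \<equiv> Suc k"
  defines "I \<equiv> {- int N..int N}"
  defines "V \<equiv> ball_const k * pi\<^sup>2 * sumsq N * (real N + 1/2) / (real (2 * k + 2) * real (2 * k + 3)) * (R\<^sup>2) ^ (2 * k + 3)"
  shows "(\<integral>\<^sup>+d. \<integral>\<^sup>+c. indicator {..R\<^sup>2} (sqn I c) * indicator {..R\<^sup>2} (sqn I d) *
      emeasure (count_space UNIV) (intersections (curve_of N c) (curve_of N d)) \<partial>coeffs I \<partial>coeffs I)
    = ennreal (mean_crossings k * V\<^sup>2)"
    and "(\<integral>\<^sup>+d. indicator {..R\<^sup>2} (sqn I d) \<partial>coeffs I) = ennreal V"
proof -
  define n D b g where "n = 2 * k + 1" and "D = ball_const k" and "b = sumsq N" and "g = real N + 1/2"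
  have pos: "D > 0" "b > 0" "g > 0" "n > 0"
    using ball_const_pos by (simp_all add: D_def b_def g_def n_def N_def sumsq_pos)
  have V: "V = D * (pi * b / Suc n) * (pi * g / Suc (Suc n)) * (R\<^sup>2) ^ Suc (Suc n)"
  proof -
    have e: "Suc n = 2 * k + 2" "Suc (2 * k + 2) = 2 * k + 3" by (simp_all add: n_def)
    show ?thesis
      unfolding e V_def D_def b_def g_def by (simp add: power2_eq_square[of pi] del: of_nat_add)
  qed
  have ball: "(\<integral>\<^sup>+d. Q (curve_of N d \<psi>, osc_deriv N \<psi> d) * indicator {..R\<^sup>2} (sqn I d) \<partial>coeffs I)
    = (\<integral>\<^sup>+u. \<integral>\<^sup>+v. Q (u, v) * ennreal (D * pos_power n (R\<^sup>2 - (norm u)\<^sup>2 / g - 1 / b * (norm v)\<^sup>2)) \<partial>lborel \<partial>lborel)"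
    if "Q \<in> borel_measurable borel" for Q \<psi>
    using nn_integral_curve_ball[OF that, of k \<psi> "R\<^sup>2"]
    by (simp add: I_def N_def D_def n_def b_def g_def)
  have pt: "(\<integral>\<^sup>+c. Q (osc_deriv N \<phi> c) * indicator {..R\<^sup>2 - 2 * (norm (z - osc N \<phi> c))\<^sup>2} (sqn (freqs N) c) \<partial>coeffs (freqs N))
    = (\<integral>\<^sup>+v. Q v * ennreal (D / 2 * pos_power n (R\<^sup>2 - (norm z)\<^sup>2 / g - 1 / b * (norm v)\<^sup>2)) \<partial>lborel)"
    if "Q \<in> borel_measurable borel" for Q \<phi> z
    using nn_integral_osc_through_point[OF that, of k \<phi> "R\<^sup>2" z]
    by (simp add: N_def D_def n_def b_def g_def)
  have "(\<integral>\<^sup>+d. indicator {..R\<^sup>2} (sqn I d) \<partial>coeffs I)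
      = (\<integral>\<^sup>+u. \<integral>\<^sup>+(v::real \<times> real). ennreal (D * pos_power n (R\<^sup>2 - (norm u)\<^sup>2 / g - 1 / b * (norm v)\<^sup>2)) \<partial>lborel \<partial>(lborel :: (real \<times> real) measure))"
    using ball[of "\<lambda>_. 1" 0] by simp
  also have "\<dots> = (\<integral>\<^sup>+u. ennreal (D * (pi * b / Suc n)) * ennreal (pos_power (Suc n) (R\<^sup>2 - 1 / g * (norm u)\<^sup>2)) \<partial>(lborel :: (real \<times> real) measure))"
  proof (rule nn_integral_cong)
    fix u :: "real \<times> real"
    have "(\<integral>\<^sup>+(v :: real \<times> real). ennreal (D * pos_power n (R\<^sup>2 - (norm u)\<^sup>2 / g - 1 / b * (norm v)\<^sup>2)) \<partial>lborel)
      = ennreal D * ennreal (pi * pos_power (Suc n) (R\<^sup>2 - (norm u)\<^sup>2 / g) / (1 / b * Suc n))"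
      using pos nn_integral_pos_power_norm[of "1 / b" n "R\<^sup>2 - (norm u)\<^sup>2 / g"]
      by (simp add: ennreal_mult' nn_integral_cmult del: of_nat_Suc)
    also have "\<dots> = ennreal (D * (pi * b / Suc n)) * ennreal (pos_power (Suc n) (R\<^sup>2 - 1 / g * (norm u)\<^sup>2))"
      using pos by (simp add: ennreal_mult'[symmetric] del: of_nat_Suc)
    finally show "(\<integral>\<^sup>+(v :: real \<times> real). ennreal (D * pos_power n (R\<^sup>2 - (norm u)\<^sup>2 / g - 1 / b * (norm v)\<^sup>2)) \<partial>lborel)
      = ennreal (D * (pi * b / Suc n)) * ennreal (pos_power (Suc n) (R\<^sup>2 - 1 / g * (norm u)\<^sup>2))" .
  qed
  also have "\<dots> = ennreal (D * (pi * b / Suc n)) * ennreal (pi * pos_power (Suc (Suc n)) (R\<^sup>2) / (1 / g * Suc (Suc n)))"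
    using pos nn_integral_pos_power_norm[of "1 / g" "Suc n" "R\<^sup>2"] by (simp add: nn_integral_cmult del: of_nat_Suc)
  also have "\<dots> = ennreal V"
    using pos by (simp add: V ennreal_mult'[symmetric] pos_power_def del: of_nat_Suc power_Suc)
  finally show "(\<integral>\<^sup>+d. indicator {..R\<^sup>2} (sqn I d) \<partial>coeffs I) = ennreal V" .

  define X where "X = {0..<2*pi} \<times> {0..<2*pi::real}"
  have X [measurable]: "X \<in> sets borel"
    unfolding X_def by (rule square_sets)
  define \<rho> where "\<rho> u v = pos_power n (R\<^sup>2 - (norm u)\<^sup>2 / g - 1 / b * (norm v)\<^sup>2)" for u v :: "real \<times> real"
  have \<rho>_meas [measurable (raw)]: "(\<lambda>x. \<rho> (f x) (h x)) \<in> borel_measurable M"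
    if [measurable]: "f \<in> borel_measurable M" "h \<in> borel_measurable M" for f h and M :: "'z measure"
    unfolding \<rho>_def by measurable
  \<comment> \<open>The contribution of all first curves through the point \<open>fst w\<close>,
    when the second curve passes it with velocity \<open>snd w\<close>. The factors 2 and 1/2 are
    those of the change from constant coefficient to point.\<close>
  define L where "L w = (\<integral>\<^sup>+v. ennreal (2 * \<bar>det2 v (snd w)\<bar>) * ennreal (D / 2 * \<rho> (fst w) v) \<partial>lborel)" for w
  have L [measurable]: "L \<in> borel_measurable borel"
    unfolding L_def[abs_def] \<rho>_def by measurable
  have inner: "(\<integral>\<^sup>+c. indicator {..R\<^sup>2} (sqn I c) * emeasure (count_space UNIV) (intersections (curve_of N c) (curve_of N d)) \<partial>coeffs I)
      = (\<integral>\<^sup>+z. indicator X z * L (curve_of N d (snd z), osc_deriv N (snd z) d) \<partial>lborel)"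
    if d: "d \<in> space (coeffs I)" for d
  proof -
    have sq: "sqn I \<in> borel_measurable (coeffs I)" by (simp add: sqn_measurable)
    have "curve_of N d \<in> space (curve_vol N)"
      using d by (simp add: curve_vol_def space_embed_measure I_def)
    then have "(\<lambda>f. (f, curve_of N d)) \<in> measurable (curve_vol N) (pair_vol N)"
      unfolding pair_vol_def by (intro measurable_Pair) simp_all
    from measurable_compose[OF this intersection_count_measurable]
    have "(\<lambda>f. emeasure (count_space UNIV) (intersections f (curve_of N d))) \<in> borel_measurable (curve_vol N)"
      by simp
    then have "(\<lambda>c. emeasure (count_space UNIV) (intersections (curve_of N c) (curve_of N d))) \<in> borel_measurable (coeffs I)"
      using measurable_compose[OF measurable_embed_measure2'[OF inj_on_curve_of]] by (auto simp: curve_vol_def I_def)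
    then have meas: "(\<lambda>c. indicator {..R\<^sup>2} (sqn I c) * emeasure (count_space UNIV) (intersections (curve_of N c) (curve_of N d))) \<in> borel_measurable (coeffs I)"
      using sq by measurable
    interpret pair_sigma_finite "coeffs (freqs N)" "lborel :: (real \<times> real) measure"
      by (intro pair_sigma_finite.intro sigma_finite_coeffs sigma_finite_lborel) simp
    \<comment> \<open>The constant coefficient goes innermost, so that the area formula applies with
      all other coefficients fixed.\<close>
    have "(\<integral>\<^sup>+c. indicator {..R\<^sup>2} (sqn I c) * emeasure (count_space UNIV) (intersections (curve_of N c) (curve_of N d)) \<partial>coeffs I)
      = (\<integral>\<^sup>+c. \<integral>\<^sup>+w. indicator {..R\<^sup>2} (sqn I (c(0 := w))) *
          emeasure (count_space UNIV) (intersections (curve_of N (c(0 := w))) (curve_of N d)) \<partial>lborel \<partial>coeffs (freqs N))"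
      unfolding I_def
      by (rule coeffs.product_nn_integral_insert[OF freqs_notin(3) interval_eq_insert(2), folded interval_eq_insert(1), OF meas[unfolded I_def]])
    also have "\<dots> = (\<integral>\<^sup>+c. \<integral>\<^sup>+z. indicator X z * (ennreal (2 * \<bar>det2 (osc_deriv N (fst z) c) (osc_deriv N (snd z) d)\<bar>) *
        indicator {..R\<^sup>2 - 2 * (norm (curve_of N d (snd z) - osc N (fst z) c))\<^sup>2} (sqn (freqs N) c)) \<partial>lborel \<partial>coeffs (freqs N))"
      unfolding I_def sqn_upd nn_integral_count_constant_coeff X_def ..
    \<comment> \<open>With the parameters outside, the coefficients enter only through value,
      derivative and norm, whose joint distribution is known.\<close>
    also have "\<dots> = (\<integral>\<^sup>+z. \<integral>\<^sup>+c. indicator X z * (ennreal (2 * \<bar>det2 (osc_deriv N (fst z) c) (osc_deriv N (snd z) d)\<bar>) *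
        indicator {..R\<^sup>2 - 2 * (norm (curve_of N d (snd z) - osc N (fst z) c))\<^sup>2} (sqn (freqs N) c)) \<partial>coeffs (freqs N) \<partial>lborel)"
    proof (rule Fubini'[symmetric])
      have [measurable]: "sqn (freqs N) \<in> borel_measurable (coeffs (freqs N))" by (simp add: sqn_measurable)
      show "(\<lambda>(c, z). indicator X z * (ennreal (2 * \<bar>det2 (osc_deriv N (fst z) c) (osc_deriv N (snd z) d)\<bar>) *
        indicator {..R\<^sup>2 - 2 * (norm (curve_of N d (snd z) - osc N (fst z) c))\<^sup>2} (sqn (freqs N) c)))
        \<in> borel_measurable (coeffs (freqs N) \<Otimes>\<^sub>M lborel)"
        unfolding curve_of_eq_osc indicator_def[of "{.._}"] atMost_iff by measurable
    qed
    also have "\<dots> = (\<integral>\<^sup>+z. indicator X z * L (curve_of N d (snd z), osc_deriv N (snd z) d) \<partial>lborel)"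
    proof (rule nn_integral_cong)
      fix z :: "real \<times> real"
      have [measurable]: "sqn (freqs N) \<in> borel_measurable (coeffs (freqs N))" "osc N (fst z) \<in> borel_measurable (coeffs (freqs N))"
        "osc_deriv N (fst z) \<in> borel_measurable (coeffs (freqs N))"
        by (simp_all add: sqn_measurable osc_measurable)
      have "(\<integral>\<^sup>+c. indicator X z * (ennreal (2 * \<bar>det2 (osc_deriv N (fst z) c) (osc_deriv N (snd z) d)\<bar>) *
        indicator {..R\<^sup>2 - 2 * (norm (curve_of N d (snd z) - osc N (fst z) c))\<^sup>2} (sqn (freqs N) c)) \<partial>coeffs (freqs N))
        = indicator X z * (\<integral>\<^sup>+c. ennreal (2 * \<bar>det2 (osc_deriv N (fst z) c) (osc_deriv N (snd z) d)\<bar>) *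
        indicator {..R\<^sup>2 - 2 * (norm (curve_of N d (snd z) - osc N (fst z) c))\<^sup>2} (sqn (freqs N) c) \<partial>coeffs (freqs N))"
        by (intro nn_integral_cmult borel_measurable_times_ennreal borel_measurable_indicator_atMost) measurable
      also have "(\<integral>\<^sup>+c. ennreal (2 * \<bar>det2 (osc_deriv N (fst z) c) (osc_deriv N (snd z) d)\<bar>) *
        indicator {..R\<^sup>2 - 2 * (norm (curve_of N d (snd z) - osc N (fst z) c))\<^sup>2} (sqn (freqs N) c) \<partial>coeffs (freqs N))
        = L (curve_of N d (snd z), osc_deriv N (snd z) d)"
        by (subst pt) (simp_all add: L_def \<rho>_def)
      finally show "(\<integral>\<^sup>+c. indicator X z * (ennreal (2 * \<bar>det2 (osc_deriv N (fst z) c) (osc_deriv N (snd z) d)\<bar>) *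
        indicator {..R\<^sup>2 - 2 * (norm (curve_of N d (snd z) - osc N (fst z) c))\<^sup>2} (sqn (freqs N) c)) \<partial>coeffs (freqs N))
        = indicator X z * L (curve_of N d (snd z), osc_deriv N (snd z) d)" .
    qed
    finally show ?thesis .
  qed
  define n' where "n' = 2 * n + 3"
  define K where "K = D * D * (pi * Beta (1/2) (n + 2) * Beta (3/2) (n + 1) / ((1 / b) ^ 3 * Suc n)) * (pi * g / Suc n') * (R\<^sup>2) ^ Suc n'"
  have B: "Beta (1/2) (real (n + 2)) > 0" "Beta (3/2) (real (n + 1)) > 0"
    by (auto simp: Beta_def intro!: divide_pos_pos mult_pos_pos Gamma_real_pos)
  have outer: "(\<integral>\<^sup>+d. L (curve_of N d \<psi>, osc_deriv N \<psi> d) * indicator {..R\<^sup>2} (sqn I d) \<partial>coeffs I) = ennreal K" for \<psi>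
  proof -
    have "(\<integral>\<^sup>+d. L (curve_of N d \<psi>, osc_deriv N \<psi> d) * indicator {..R\<^sup>2} (sqn I d) \<partial>coeffs I)
      = (\<integral>\<^sup>+u. \<integral>\<^sup>+w. L (u, w) * ennreal (D * \<rho> u w) \<partial>lborel \<partial>lborel)"
      by (subst ball[OF L]) (simp add: \<rho>_def)
    also have "\<dots> = (\<integral>\<^sup>+u. \<integral>\<^sup>+w. \<integral>\<^sup>+v. ennreal (D * D) * ennreal (\<bar>det2 v w\<bar> * \<rho> u v * \<rho> u w) \<partial>lborel \<partial>lborel \<partial>lborel)"
    proof (intro nn_integral_cong)
      fix u w :: "real \<times> real"
      have "L (u, w) * ennreal (D * \<rho> u w) = (\<integral>\<^sup>+v. ennreal (2 * \<bar>det2 v w\<bar>) * ennreal (D / 2 * \<rho> u v) * ennreal (D * \<rho> u w) \<partial>lborel)"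
        unfolding L_def by (subst nn_integral_multc) simp_all
      also have "\<dots> = (\<integral>\<^sup>+v. ennreal (D * D) * ennreal (\<bar>det2 v w\<bar> * \<rho> u v * \<rho> u w) \<partial>lborel)"
        using pos by (intro nn_integral_cong) (simp add: ennreal_mult'[symmetric] \<rho>_def ac_simps)
      finally show "L (u, w) * ennreal (D * \<rho> u w) = (\<integral>\<^sup>+v. ennreal (D * D) * ennreal (\<bar>det2 v w\<bar> * \<rho> u v * \<rho> u w) \<partial>lborel)" .
    qed
    also have "\<dots> = (\<integral>\<^sup>+u. ennreal (D * D) * (\<integral>\<^sup>+w. \<integral>\<^sup>+v. ennreal (\<bar>det2 v w\<bar> * \<rho> u v * \<rho> u w) \<partial>lborel \<partial>lborel) \<partial>lborel)"
      by (simp add: nn_integral_cmult)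
    also have "\<dots> = (\<integral>\<^sup>+u. ennreal (D * D) * (ennreal (pi * Beta (1/2) (n + 2) * Beta (3/2) (n + 1) / ((1 / b) ^ 3 * Suc n)) * ennreal (pos_power n' (R\<^sup>2 - 1 / g * (norm u)\<^sup>2))) \<partial>(lborel :: (real \<times> real) measure))"
    proof (rule nn_integral_cong)
      fix u :: "real \<times> real"
      have "(\<integral>\<^sup>+w. \<integral>\<^sup>+v. ennreal (\<bar>det2 v w\<bar> * \<rho> u v * \<rho> u w) \<partial>lborel \<partial>lborel)
        = ennreal (pi * Beta (1/2) (n + 2) * Beta (3/2) (n + 1) / ((1 / b) ^ 3 * Suc n) * pos_power n' (R\<^sup>2 - 1 / g * (norm u)\<^sup>2))"
        unfolding \<rho>_def n'_def using nn_integral_det2_pos_power_pos_power[of "1 / b" n "R\<^sup>2 - (norm u)\<^sup>2 / g"] pos by (simp add: add.commute)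
      then show "ennreal (D * D) * (\<integral>\<^sup>+w. \<integral>\<^sup>+v. ennreal (\<bar>det2 v w\<bar> * \<rho> u v * \<rho> u w) \<partial>lborel \<partial>lborel)
        = ennreal (D * D) * (ennreal (pi * Beta (1/2) (n + 2) * Beta (3/2) (n + 1) / ((1 / b) ^ 3 * Suc n)) * ennreal (pos_power n' (R\<^sup>2 - 1 / g * (norm u)\<^sup>2)))"
        by (simp only: ennreal_mult'' pos_power_nonneg)
    qed
    also have "\<dots> = ennreal (D * D) * (ennreal (pi * Beta (1/2) (n + 2) * Beta (3/2) (n + 1) / ((1 / b) ^ 3 * Suc n)) * ennreal (pi * pos_power (Suc n') (R\<^sup>2) / (1 / g * Suc n')))"
      using pos nn_integral_pos_power_norm[of "1 / g" n' "R\<^sup>2"] by (simp add: nn_integral_cmult del: of_nat_Suc)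
    also have "\<dots> = ennreal K"
    proof -
      have "K = D * D * (pi * Beta (1/2) (n + 2) * Beta (3/2) (n + 1) / ((1 / b) ^ 3 * Suc n) * (pi * pos_power (Suc n') (R\<^sup>2) / (1 / g * Suc n')))"
        using pos by (simp add: K_def pos_power_def del: of_nat_Suc power_Suc)
      then show ?thesis
        using pos B by (simp only: ennreal_mult'' pos_power_nonneg mult_nonneg_nonneg divide_nonneg_nonneg pi_ge_zero less_imp_le of_nat_0_le_iff zero_le_divide_1_iff zero_le_power)
    qed
    finally show ?thesis .
  qed
  have "(\<integral>\<^sup>+d. \<integral>\<^sup>+c. indicator {..R\<^sup>2} (sqn I c) * indicator {..R\<^sup>2} (sqn I d) *
      emeasure (count_space UNIV) (intersections (curve_of N c) (curve_of N d)) \<partial>coeffs I \<partial>coeffs I)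
    = (\<integral>\<^sup>+d. \<integral>\<^sup>+z. indicator X z * (L (curve_of N d (snd z), osc_deriv N (snd z) d) * indicator {..R\<^sup>2} (sqn I d)) \<partial>lborel \<partial>coeffs I)"
  proof (rule nn_integral_cong)
    fix d assume d: "d \<in> space (coeffs I)"
    show "(\<integral>\<^sup>+c. indicator {..R\<^sup>2} (sqn I c) * indicator {..R\<^sup>2} (sqn I d) *
      emeasure (count_space UNIV) (intersections (curve_of N c) (curve_of N d)) \<partial>coeffs I)
      = (\<integral>\<^sup>+z. indicator X z * (L (curve_of N d (snd z), osc_deriv N (snd z) d) * indicator {..R\<^sup>2} (sqn I d)) \<partial>lborel)"
      using inner[OF d] by (cases "sqn I d \<le> R\<^sup>2") simp_all
  qed
  also have "\<dots> = (\<integral>\<^sup>+z. \<integral>\<^sup>+d. indicator X z * (L (curve_of N d (snd z), osc_deriv N (snd z) d) * indicator {..R\<^sup>2} (sqn I d)) \<partial>coeffs I \<partial>lborel)"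
  proof -
    interpret pair_sigma_finite "coeffs I" "lborel :: (real \<times> real) measure"
      by (intro pair_sigma_finite.intro sigma_finite_coeffs sigma_finite_lborel) (simp add: I_def)
    show ?thesis
    proof (rule Fubini'[symmetric])
      have [measurable]: "(\<lambda>x. fst x j) \<in> borel_measurable (coeffs I \<Otimes>\<^sub>M (lborel :: (real \<times> real) measure))" if "j \<in> I" for j
        using measurable_compose[OF measurable_fst[of "coeffs I" "lborel :: (real \<times> real) measure"]
            measurable_component_singleton[OF that, of "\<lambda>_. lborel :: (real \<times> real) measure"]] by simp
      have sub: "freqs N \<subseteq> I" "0 \<in> I" by (auto simp: freqs_def I_def)
      have [measurable]: "(\<lambda>x. osc N (snd (snd x)) (fst x)) \<in> borel_measurable (coeffs I \<Otimes>\<^sub>M (lborel :: (real \<times> real) measure))"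
        "(\<lambda>x. osc_deriv N (snd (snd x)) (fst x)) \<in> borel_measurable (coeffs I \<Otimes>\<^sub>M (lborel :: (real \<times> real) measure))"
        "(\<lambda>x. fst x 0) \<in> borel_measurable (coeffs I \<Otimes>\<^sub>M (lborel :: (real \<times> real) measure))"
        "(\<lambda>x. sqn I (fst x)) \<in> borel_measurable (coeffs I \<Otimes>\<^sub>M (lborel :: (real \<times> real) measure))"
        unfolding osc_def osc_deriv_def sqn_def using sub
        by (auto intro!: borel_measurable_sum borel_measurable_scaleR borel_measurable_power borel_measurable_norm)
      show "(\<lambda>(d, z). indicator X z * (L (curve_of N d (snd z), osc_deriv N (snd z) d) * indicator {..R\<^sup>2} (sqn I d)))
          \<in> borel_measurable (coeffs I \<Otimes>\<^sub>M lborel)"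
        unfolding curve_of_eq_osc case_prod_beta by measurable
    qed
  qed
  also have "\<dots> = (\<integral>\<^sup>+z. indicator X z * ennreal K \<partial>lborel)"
  proof (rule nn_integral_cong)
    fix z :: "real \<times> real"
    show "(\<integral>\<^sup>+d. indicator X z * (L (curve_of N d (snd z), osc_deriv N (snd z) d) * indicator {..R\<^sup>2} (sqn I d)) \<partial>coeffs I) = indicator X z * ennreal K"
      using outer[of "snd z"] by (cases "z \<in> X") simp_all
  qed
  also have "\<dots> = ennreal (4 * pi\<^sup>2) * ennreal K"
    using emeasure_square by (subst nn_integral_multc) (simp_all add: X_def)
  also have "\<dots> = ennreal (mean_crossings k * V\<^sup>2)"
  proof -
    define B1 B2 where "B1 = Beta (1/2) (n + 2)" and "B2 = Beta (3/2) (n + 1)"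
    define S where "S = (R\<^sup>2) ^ Suc (Suc n)"
    \<comment> \<open>The crossing integral has the same power of R as the squared ball volume, so
      the mean does not depend on R.\<close>
    have S2: "(R\<^sup>2) ^ Suc n' = S\<^sup>2"
    proof -
      have "Suc n' = Suc (Suc n) * 2" by (simp add: n'_def)
      then show ?thesis by (simp only: S_def power_mult)
    qed
    have mc: "mean_crossings k = 2 * (b / g) * Suc n * Suc (Suc n) * B1 * B2"
      by (simp add: mean_crossings_def b_def g_def n_def B1_def B2_def N_def add.commute)
    have sn: "real (Suc n') = 2 * real (Suc (Suc n))"
      by (simp add: n'_def)
    have "4 * pi\<^sup>2 * (D * D * (pi * B1 * B2 / ((1 / b) ^ 3 * m)) * (pi * g / (2 * l)) * S\<^sup>2)
        = 2 * (b / g) * m * l * B1 * B2 * (D * (pi * b / m) * (pi * g / l) * S)\<^sup>2" if "m > 0" "l > 0" for m l :: real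
      using pos that by (simp add: power2_eq_square power3_eq_cube field_simps)
    from this[of "Suc n" "Suc (Suc n)"] have "4 * pi\<^sup>2 * K = mean_crossings k * V\<^sup>2"
      unfolding K_def V mc S2 sn B1_def[symmetric] B2_def[symmetric] S_def[symmetric] by simp
    then show ?thesis
      by (subst ennreal_mult'[symmetric]) simp_all
  qed
  finally show "(\<integral>\<^sup>+d. \<integral>\<^sup>+c. indicator {..R\<^sup>2} (sqn I c) * indicator {..R\<^sup>2} (sqn I d) *
      emeasure (count_space UNIV) (intersections (curve_of N c) (curve_of N d)) \<partial>coeffs I \<partial>coeffs I)
    = ennreal (mean_crossings k * V\<^sup>2)" .
qed

section \<open>Asymptotics\<close>

lemma Gamma_midpoint_le:
  assumes "a > 0" "b > 0"
  shows "(Gamma ((a + b) / 2))\<^sup>2 \<le> Gamma a * Gamma (b :: real)"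
proof -
  have G: "Gamma a > 0" "Gamma b > 0" "Gamma ((a + b) / 2) > 0"
    using assms by (auto intro!: Gamma_real_pos)
  have "(ln \<circ> Gamma) ((1 - 1/2) *\<^sub>R a + (1/2) *\<^sub>R b) \<le> (1 - 1/2) * (ln \<circ> Gamma) a + (1/2) * (ln \<circ> Gamma) b"
    using assms by (intro convex_onD[OF log_convex_Gamma_real]) auto
  then have "2 * ln (Gamma ((a + b) / 2)) \<le> ln (Gamma a) + ln (Gamma b)"
    by (simp add: add_divide_distrib)
  then have "ln ((Gamma ((a + b) / 2))\<^sup>2) \<le> ln (Gamma a * Gamma b)"
    using G by (simp add: ln_realpow ln_mult_pos)
  then show ?thesis
    using G by simp
qed

lemma Gamma_real_plus1: "z > 0 \<Longrightarrow> Gamma (z + 1) = z * Gamma (z :: real)"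
  by (rule Gamma_plus1) (auto elim!: nonpos_Ints_cases)

lemma sumsq_closed: "sumsq N = real N * (real N + 1) * (2 * real N + 1) / 6"
  by (induction N) (simp_all add: sumsq_Suc, simp add: sumsq_def, simp add: field_simps power2_eq_square)

text \<open>With x = 2 N + 1, \<open>\<rho>\<close> is the Gamma quotient, and it lies between 1 and
  1 + 1 / (2 x). The main term is pi/3 N (N + 1) \<rho>; the excess over pi/3 N^2 is at most pi/3
  times N + N, hence at most pi N.\<close>

lemma mean_crossings_bounds:
  fixes k :: nat
  defines "N \<equiv> real (Suc k)"
  shows "pi / 3 * N\<^sup>2 \<le> mean_crossings k" "mean_crossings k \<le> pi / 3 * N\<^sup>2 + pi * N"
proof -
  define x where "x = 2 * real k + 3"
  have x: "x > 0" "x = 2 * N + 1" by (simp_all add: x_def N_def)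
  have G: "Gamma x > 0" "Gamma (x + 1/2) > 0"
    using x(1) by (auto intro!: Gamma_real_pos)
  define \<rho> where "\<rho> = x * (Gamma x)\<^sup>2 / (Gamma (x + 1/2))\<^sup>2"
  have Gx1: "Gamma (x + 1) = x * Gamma x"
    using x(1) by (intro Gamma_real_plus1) simp
  \<comment> \<open>Here x + 1/2 is the midpoint of x and x + 1; this bounds the denominator of
    \<open>\<rho>\<close>.\<close>
  have "(Gamma (x + 1/2))\<^sup>2 \<le> Gamma x * Gamma (x + 1)"
    using Gamma_midpoint_le[of x "x + 1"] x(1) by (simp add: add_divide_distrib)
  then have lower: "1 \<le> \<rho>"
    using G by (simp add: \<rho>_def Gx1 power2_eq_square mult_ac)
  \<comment> \<open>Here x + 1 is the midpoint of x + 1/2 and x + 3/2; this bounds the numerator of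
    \<open>\<rho>\<close>.\<close>
  have "(Gamma (x + 1))\<^sup>2 \<le> Gamma (x + 1/2) * Gamma (x + 1/2 + 1)"
    using Gamma_midpoint_le[of "x + 1/2" "x + 1/2 + 1"] x(1) by (simp add: add_divide_distrib add.commute)
  also have "Gamma (x + 1/2 + 1) = (x + 1/2) * Gamma (x + 1/2)"
    using x(1) by (intro Gamma_real_plus1) simp
  finally have "x * (x * (Gamma x)\<^sup>2) \<le> (x + 1/2) * (Gamma (x + 1/2))\<^sup>2"
    by (simp add: Gx1 power2_eq_square mult_ac)
  then have "x * \<rho> \<le> x + 1/2"
    using G by (simp add: \<rho>_def divide_le_eq)
  then have upper: "\<rho> \<le> 1 + 1 / (2 * x)"
    using x(1) by (simp add: field_simps)
  \<comment> \<open>Both Beta functions have the denominator Gamma (x + 1/2), and Gamma(1/2)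
    Gamma(3/2) = pi / 2. The factor 2 k + 2 = x - 1 raises Gamma (x - 1) to Gamma x.\<close>
  have beta: "real (2 * k + 2) * real (2 * k + 3) * Beta (1/2) (2 * k + 3) * Beta (3/2) (2 * k + 2) = pi / 2 * \<rho>"
  proof -
    have r: "real (2 * k + 3) = x" "real (2 * k + 2) = x - 1" "1/2 + x = x + 1/2" "3/2 + (x - 1) = x + 1/2"
      by (simp_all add: x_def)
    have G0: "Gamma x = (x - 1) * Gamma (x - 1)"
      using Gamma_real_plus1[of "x - 1"] by (simp add: x_def add.commute)
    have G32: "Gamma (3/2 :: real) = sqrt pi / 2"
      using Gamma_real_plus1[of "1/2"] by (simp add: Gamma_one_half_real)
    have "real (2 * k + 2) * real (2 * k + 3) * Beta (1/2) (2 * k + 3) * Beta (3/2) (2 * k + 2)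
        = sqrt pi * sqrt pi / 2 * (x * (Gamma x * ((x - 1) * Gamma (x - 1))) / (Gamma (x + 1/2) * Gamma (x + 1/2)))"
    proof -
      have "a * b * (s * G / h) * (s / 2 * K / h) = s * s / 2 * (b * (G * (a * K)) / (h * h))" for a b s G K h :: real
        by (simp add: mult_ac)
      then show ?thesis
        unfolding Beta_def r Gamma_one_half_real G32 .
    qed
    also have "\<dots> = pi / 2 * \<rho>"
      unfolding \<rho>_def G0[symmetric] power2_eq_square by simp
    finally show ?thesis .
  qed
  have "mean_crossings k = 2 * (sumsq (Suc k) / (N + 1/2)) * (real (2 * k + 2) * real (2 * k + 3) * Beta (1/2) (2 * k + 3) * Beta (3/2) (2 * k + 2))"
    by (simp only: mean_crossings_def N_def mult.assoc of_nat_add of_nat_mult of_nat_numeral)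
  \<comment> \<open>The factor 2 N + 1 in the sum of squares cancels against N + 1/2.\<close>
  also have "sumsq (Suc k) / (N + 1/2) = N * (N + 1) / 3"
  proof -
    have "N + 1/2 > 0" by (simp add: N_def add_pos_pos)
    then show ?thesis
      unfolding sumsq_closed N_def[symmetric] by (simp add: divide_simps)
  qed
  finally have mean: "mean_crossings k = pi / 3 * (N * (N + 1) * \<rho>)"
    unfolding beta by simp
  have N: "N > 0" by (simp add: N_def)
  have "N\<^sup>2 \<le> N * (N + 1) * 1" using N by (simp add: power2_eq_square algebra_simps)
  also have "\<dots> \<le> N * (N + 1) * \<rho>" using lower N by (intro mult_left_mono) auto
  finally show "pi / 3 * N\<^sup>2 \<le> mean_crossings k"
    unfolding mean by (intro mult_left_mono) auto
  have "N * (N + 1) * \<rho> \<le> N * (N + 1) * (1 + 1 / (2 * x))"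
    using upper N by (intro mult_left_mono) auto
  also have "\<dots> = N\<^sup>2 + N + N * ((N + 1) / (2 * x))"
    by (simp add: power2_eq_square algebra_simps add_divide_distrib)
  also have "(N + 1) / (2 * x) \<le> 1"
    using N x by (simp add: divide_le_eq)
  finally have "N * (N + 1) * \<rho> \<le> N\<^sup>2 + 2 * N"
    using N by (simp add: mult_left_mono)
  then have "mean_crossings k \<le> pi / 3 * (N\<^sup>2 + 2 * N)"
    unfolding mean by (intro mult_left_mono) auto
  also have "\<dots> \<le> pi / 3 * N\<^sup>2 + pi * N"
    using N by (simp add: algebra_simps)
  finally show "mean_crossings k \<le> pi / 3 * N\<^sup>2 + pi * N" .
qed

section \<open>From the integral to the series of fractions\<close>

lemma curve_ball_iff:
  assumes "R > 0"
  shows "curve_of N c \<in> curve_ball N R \<longleftrightarrow> sqn {- int N..int N} c \<le> R\<^sup>2"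
proof -
  have "curve_dot (curve_of N c) (curve_of N c) = sqn {- int N..int N} c"
    by (simp add: curve_dot_curve_of sqn_def dot_square_norm)
  moreover have "0 \<le> sqn {- int N..int N} c"
    by (simp add: sqn_def sum_nonneg)
  ultimately show ?thesis
    using assms curve_of_in_trig_curves by (auto simp: curve_ball_def real_sqrt_le_iff' )
qed

text \<open>The intersection count is integrated level by level. This loses nothing, because a
  function with finite integral is infinite only on a null set.\<close>

lemma sums_intersection_fraction:
  assumes R: "R > 0"
  shows "(\<lambda>i. real i * intersection_fraction (Suc k) R i) sums mean_crossings k"
proof -
  define N I where "N = Suc k" and "I = {- int N..int N}"
  define V where "V = ball_const k * pi\<^sup>2 * sumsq N * (real N + 1/2) / (real (2 * k + 2) * real (2 * k + 3)) * (R\<^sup>2) ^ (2 * k + 3)"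
  note total = nn_integral_ball_crossings[OF R, of k, folded N_def, folded V_def I_def]
  have V: "V > 0"
    unfolding V_def N_def using R ball_const_pos[of k] sumsq_pos[of k]
    by (intro mult_pos_pos divide_pos_pos) (auto simp: add_pos_pos)
  define P B where "P = pair_vol N" and "B = curve_ball N R \<times> curve_ball N R"
  define cnt where "cnt p = emeasure (count_space UNIV) (intersections (fst p) (snd p))" for p
  have [measurable]: "B \<in> sets P"
    unfolding B_def P_def pair_vol_def using curve_ball_sets by (intro pair_measureI)
  have [measurable]: "cnt \<in> borel_measurable P"
    unfolding cnt_def[abs_def] P_def by (rule intersection_count_measurable)
  have BI: "indicator B (curve_of N c, curve_of N d) = (indicator {..R\<^sup>2} (sqn I c) * indicator {..R\<^sup>2} (sqn I d) :: ennreal)" for c d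
    by (simp add: B_def I_def curve_ball_iff[OF R] indicator_def)
  have sqn_meas: "sqn I \<in> borel_measurable (coeffs I)" by (simp add: sqn_measurable)
  have ind: "(\<lambda>c. indicator {..R\<^sup>2} (sqn I c) :: ennreal) \<in> borel_measurable (coeffs I)"
    by (rule borel_measurable_indicator_atMost[OF _ sqn_meas]) simp
  have eB: "emeasure P B = ennreal (V\<^sup>2)"
  proof -
    have "emeasure P B = (\<integral>\<^sup>+p. indicator B p \<partial>P)" by simp
    also have "\<dots> = (\<integral>\<^sup>+d. \<integral>\<^sup>+c. indicator {..R\<^sup>2} (sqn I c) * indicator {..R\<^sup>2} (sqn I d) \<partial>coeffs I \<partial>coeffs I)"
      unfolding P_def by (subst nn_integral_pair_vol) (simp_all add: P_def[symmetric] BI I_def[symmetric])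
    also have "\<dots> = ennreal V * ennreal V"
      using ind by (simp add: nn_integral_multc nn_integral_cmult total(2))
    finally show ?thesis using V by (simp add: power2_eq_square ennreal_mult')
  qed
  then have mB: "measure P B = V\<^sup>2"
    by (simp add: measure_def)
  have cntB: "(\<integral>\<^sup>+p. indicator B p * cnt p \<partial>P) = ennreal (mean_crossings k * V\<^sup>2)"
  proof -
    have "(\<lambda>p. indicator B p * cnt p) \<in> borel_measurable (pair_vol N)"
      unfolding P_def[symmetric] by measurable
    from nn_integral_pair_vol[OF this] show ?thesis
      unfolding total(1)[symmetric] P_def BI by (simp add: cnt_def I_def)
  qed
  define E where "E i = {(f, g) \<in> curve_ball N R \<times> curve_ball N R. finite (intersections f g) \<and> card (intersections f g) = i}" for i
  \<comment> \<open>The counting measure of an infinite set is infinite, so equality with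
    \<open>of_nat i\<close> already encodes finiteness.\<close>
  have Ei: "E i = {p \<in> space P. p \<in> B \<and> cnt p = of_nat i}" for i
  proof -
    have "finite S \<and> card S = i \<longleftrightarrow> emeasure (count_space UNIV) S = of_nat i" for S :: "(real \<times> real) set"
      by (auto simp: emeasure_count_space)
    moreover have "B \<subseteq> space P"
      using sets.sets_into_space[OF \<open>B \<in> sets P\<close>] .
    ultimately show ?thesis
      by (auto simp: E_def B_def cnt_def)
  qed
  have E [measurable]: "E i \<in> sets P" for i
    unfolding Ei by measurable
  have EB: "E i \<subseteq> B" for i by (auto simp: E_def B_def)
  have eE: "emeasure P (E i) = ennreal (measure P (E i))" for i
  proof (rule emeasure_eq_ennreal_measure)
    have "emeasure P (E i) \<le> emeasure P B" by (rule emeasure_mono[OF EB]) simp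
    then show "emeasure P (E i) \<noteq> top" using eB by (auto simp: top_unique)
  qed
  \<comment> \<open>This discards the pairs with infinitely many intersections, which belong to no
    level set \<open>E i\<close>.\<close>
  have "AE p in P. indicator B p * cnt p \<noteq> \<infinity>"
    by (rule nn_integral_PInf_AE) (simp_all add: cntB)
  then have "AE p in P. indicator B p * cnt p = (\<Sum>i. of_nat i * indicator (E i) p)"
  proof (rule AE_mp, intro AE_I2 impI)
    fix p assume p: "p \<in> space P" "indicator B p * cnt p \<noteq> \<infinity>"
    show "indicator B p * cnt p = (\<Sum>i. of_nat i * indicator (E i) p)"
    proof (cases "p \<in> B")
      case False
      then have "indicator (E i) p = (0 :: ennreal)" for i
        using EB[of i] by (auto simp: indicator_def)
      then show ?thesis using False by simp
    next
      case True
      define S where "S = intersections (fst p) (snd p)"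
      have "cnt p \<noteq> \<infinity>" using p True by simp
      then have "finite S"
        by (auto simp: cnt_def S_def emeasure_count_space split: if_splits)
      then have c: "cnt p = of_nat (card S)"
        by (simp add: cnt_def S_def emeasure_count_space)
      then have "indicator (E i) p = (if i = card S then 1 else 0 :: ennreal)" for i
        using p True by (auto simp: Ei indicator_def)
      then have "(\<Sum>i. of_nat i * indicator (E i) p) = (\<Sum>i. if i = card S then of_nat i else (0::ennreal))"
        by (intro suminf_cong) simp
      also have "\<dots> = (\<Sum>i\<in>{card S}. if i = card S then of_nat i else 0)"
        by (rule suminf_finite) auto
      finally show ?thesis using True c by simp
    qed
  qed
  then have "ennreal (mean_crossings k * V\<^sup>2) = (\<integral>\<^sup>+p. (\<Sum>i. of_nat i * indicator (E i) p) \<partial>P)"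
    unfolding cntB[symmetric] by (rule nn_integral_cong_AE)
  also have "\<dots> = (\<Sum>i. of_nat i * emeasure P (E i))"
    by (subst nn_integral_suminf) (simp_all add: nn_integral_cmult)
  also have "\<dots> = (\<Sum>i. ennreal (real i * measure P (E i)))"
    by (simp add: eE ennreal_mult ennreal_of_nat_eq_real_of_nat)
  finally have sum: "(\<Sum>i. ennreal (real i * measure P (E i))) = ennreal (mean_crossings k * V\<^sup>2)" ..
  \<comment> \<open>A finite sum in \<open>ennreal\<close> yields real summability, after which the
    two sums can be identified.\<close>
  have summ: "summable (\<lambda>i. real i * measure P (E i))"
    by (rule summable_suminf_not_top) (simp_all add: sum)
  have "0 \<le> pi / 3 * (real (Suc k))\<^sup>2" by simp
  then have "mean_crossings k \<ge> 0"
    using mean_crossings_bounds(1)[of k] by linarith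
  moreover have "ennreal (\<Sum>i. real i * measure P (E i)) = ennreal (mean_crossings k * V\<^sup>2)"
    using suminf_ennreal2[OF _ summ] sum by simp
  moreover have "0 \<le> (\<Sum>i. real i * measure P (E i))"
    by (rule suminf_nonneg[OF summ]) simp
  ultimately have "(\<Sum>i. real i * measure P (E i)) = mean_crossings k * V\<^sup>2"
    by (simp add: ennreal_inj)
  then have "(\<lambda>i. real i * measure P (E i)) sums (mean_crossings k * V\<^sup>2)"
    using summ by (simp add: sums_iff)
  then have "(\<lambda>i. real i * measure P (E i) / V\<^sup>2) sums (mean_crossings k * V\<^sup>2 / V\<^sup>2)"
    by (rule sums_divide)
  moreover have "real i * measure P (E i) / V\<^sup>2 = real i * intersection_fraction (Suc k) R i" for i
    using mB by (simp add: intersection_fraction_def E_def P_def B_def N_def)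
  ultimately show ?thesis
    using V by simp
qed

text \<open>Curves of degree \<open>0\<close> are points, so a nonempty intersection set is infinite.\<close>

lemma intersection_fraction_0: "real i * intersection_fraction 0 R i = 0"
proof (cases "i = 0")
  case False
  have zero: "card (intersections f g) = 0" if "f \<in> trig_curves 0" "g \<in> trig_curves 0" "finite (intersections f g)" for f g
  proof -
    have const: "h \<phi> = h 0" if "h \<in> trig_curves 0" for h \<phi>
      using that by (auto simp: trig_curves_def trig_polys_def prod_eq_iff)
    have "intersections f g = (if f 0 = g 0 then {0..<2*pi} \<times> {0..<2*pi} else {})"
    proof -
      have "f a = g b \<longleftrightarrow> f 0 = g 0" for a b
        using const[OF that(1), of a] const[OF that(2), of b] by simp
      then show ?thesis
        unfolding intersections_def by auto
    qed
    moreover have "infinite ({0..<2*pi} \<times> {0..<2*pi})"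
      by (simp add: finite_cartesian_product_iff infinite_Ico)
    ultimately show ?thesis
      using that(3) by auto
  qed
  have "{(f, g) \<in> curve_ball 0 R \<times> curve_ball 0 R. finite (intersections f g) \<and> card (intersections f g) = i} = {}"
    (is "?S = {}")
  proof (rule equals0I)
    fix p assume "p \<in> ?S"
    then obtain f g where "f \<in> trig_curves 0" "g \<in> trig_curves 0" "finite (intersections f g)" "card (intersections f g) = i"
      unfolding curve_ball_def by blast
    then show False using zero False by metis
  qed
  then show ?thesis
    by (simp only: intersection_fraction_def measure_empty div_0 mult_zero_right)
qed simp

theorem corollary1:
  fixes R :: real
  assumes "R > 0"
  shows "(\<forall>N. summable (\<lambda>i. real i * intersection_fraction N R i)) \<and>
    (\<lambda>N. (\<Sum>i. real i * intersection_fraction N R i) - pi / 3 * (real N)\<^sup>2) \<in> O(\<lambda>N. real N)"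
proof
  show "\<forall>N. summable (\<lambda>i. real i * intersection_fraction N R i)"
  proof
    show "summable (\<lambda>i. real i * intersection_fraction N R i)" for N
      using sums_summable[OF sums_intersection_fraction[OF assms]]
      by (cases N) (simp_all only: intersection_fraction_0 summable_zero)
  qed
  show "(\<lambda>N. (\<Sum>i. real i * intersection_fraction N R i) - pi / 3 * (real N)\<^sup>2) \<in> O(\<lambda>N. real N)"
  \<comment> \<open>The constant pi works for every positive degree; only degree 0 has to be
    excluded.\<close>
  proof (rule bigoI[where c = pi], rule eventually_mono[OF eventually_gt_at_top[of 0]])
    fix N :: nat assume "N > 0"
    then obtain k where k: "N = Suc k" by (cases N) auto
    have "(\<Sum>i. real i * intersection_fraction N R i) = mean_crossings k"
      using sums_intersection_fraction[OF assms, of k] by (simp add: k sums_iff)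
    then show "norm ((\<Sum>i. real i * intersection_fraction N R i) - pi / 3 * (real N)\<^sup>2) \<le> pi * norm (real N)"
      using mean_crossings_bounds[of k] by (simp add: k)
  qed
qed

end
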